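(* Let $D=(D_u)_{u\ge 0}$ be a strictly increasing subordinator with $E(e^{-sD_u})=e^{u\phi(s)}$, where $\phi(s)=\int_{\mathbb{R}_+}(e^{-sy}-1)K_2(dy)$ and $K_2$ is a measure supported on $[0,\infty)$ with $K_2(\{0\})=0$, $\int (y\wedge 1)K_2(dy)<\infty$ and $\int K_2(dy)=\infty$. Let $E_t=\inf\{u>0: D_u>t\}$ be its inverse, and for $n\in\mathbb{N}$ and $0<t_1<t_2<\dots<t_n$ let $$h(dx_1,\dots,dx_n;t_1,\dots,t_n)=P(E_{t_1}\in dx_1,\dots,E_{t_n}\in dx_n).$$ Then $$\Phi_{\mathbf t}\,h(d\mathbf x;\mathbf t)=-\mathbb{D}_{\mathbf x}\,h(d\mathbf x;\mathbf t),$$ where $\mathbf x=(x_1,\dots,x_n)$, $\mathbf t=(t_1,\dots,t_n)$, $\Phi_{\mathbf t}$ is the pseudo-differential operator in the time variables with Laplace symbol $-\phi\big(\sum_{i=1}^n s_i\big)$, and $\mathbb{D}_{\mathbf x}$ is the derivative in the space variables along the direction $(1,\dots,1)$, as defined in the context.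
   Context: The operator $\Phi_{\mathbf t}$: it acts on functions of $\mathbf t$ (vanishing outside $0<t_1\le\dots\le t_n$), and having symbol $-\phi(\sum_i s_i)$ means that the Laplace transform of $\Phi_{\mathbf t}f$ in $\mathbf t$, with dual variables $s_1,\dots,s_n$, is $-\phi(\sum_{i=1}^n s_i)$ times the Laplace transform of $f$. It is the directional version, along $(1,\dots,1)$, of the one-variable operator with symbol $-\phi(s)$. The operator $\mathbb{D}_{\mathbf x}$: let $\mathbf k=(k_1,\dots,k_l)$ be a strictly increasing tuple of indices in $\{1,\dots,n\}$ with $k_1=1$, and let $A^n_{\mathbf k}$ be the set of $\mathbf x$ with $0\le x_1\le\dots\le x_n$ such that, with $x_0=0$, $x_{i-1}<x_i$ if and only if $i\in\mathbf k$. On $A^n_{\mathbf k}$ the measure $h(\cdot;\mathbf t)$ is of the form $$f_{\mathbf k}(d\mathbf x)=f(x_{k_1},\dots,x_{k_l})\Big(\prod_{i\notin\mathbf k}\delta_{x_{i-1}}(dx_i)\Big)dx_{k_1}\cdots dx_{k_l},$$ where $f$ (depending on $\mathbf k$ and $\mathbf t$) is assumed absolutely continuous in each of its variables, with $\lim_{x_{k_l}\to\infty}e^{-x_{k_l}}f(x_{k_1},\dots,x_{k_l})=0$. For such measures $$\mathbb{D}_{\mathbf x}f_{\mathbf k}(d\mathbf x)=\sum_{j=1}^{l}\frac{\partial f}{\partial x_{k_j}}(x_{k_1},\dots,x_{k_l})\Big(\prod_{i\notin\mathbf k}\delta_{x_{i-1}}(dx_i)\Big)dx_{k_1}\cdots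 dx_{k_l},$$ and $\mathbb{D}_{\mathbf x}h$ is obtained by applying this on each $A^n_{\mathbf k}$. *)

theory Defs
  imports "HOL-Probability.Probability"
begin

section \<open>Subordinators and their inverses\<close>

text \<open>Only the values of the process at times in \<open>[0, \<infinity>)\<close> are relevant.\<close>

definition subordinator :: "'a measure \<Rightarrow> (real \<Rightarrow> 'a \<Rightarrow> real) \<Rightarrow> bool" where
  "subordinator M D \<longleftrightarrow>
     prob_space M \<and>
     (\<forall>u\<ge>0. D u \<in> borel_measurable M) \<and>
     (\<forall>\<omega>\<in>space M. D 0 \<omega> = 0 \<and> mono_on {0..} (\<lambda>u. D u \<omega>) \<and>
        (\<forall>u\<ge>0. continuous (at_right u) (\<lambda>u. D u \<omega>))) \<and>
     (\<forall>(m::nat) u. 0 \<le> u 0 \<and> (\<forall>i<m. u i \<le> u (Suc i)) \<longrightarrow>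
        prob_space.indep_vars M (\<lambda>_. borel) (\<lambda>i \<omega>. D (u (Suc i)) \<omega> - D (u i) \<omega>) {..<m}) \<and>
     (\<forall>u\<ge>0. \<forall>v\<ge>0. distr M borel (\<lambda>\<omega>. D (u + v) \<omega> - D u \<omega>) = distr M borel (D v))"

definition levy_measure :: "real measure \<Rightarrow> bool" where
  "levy_measure K2 \<longleftrightarrow>
     sets K2 = sets borel \<and> emeasure K2 {..<0} = 0 \<and> emeasure K2 {0} = 0 \<and>
     (\<integral>\<^sup>+y. ennreal (min y 1) \<partial>K2) < \<infinity> \<and> emeasure K2 UNIV = \<infinity>"

definition laplace_exponent :: "real measure \<Rightarrow> real \<Rightarrow> real" where
  "laplace_exponent K2 s = (LINT y|K2. exp (- s * y) - 1)"

text \<open>On the null event where the path stays below \<open>t\<close>, the infimum of the empty set is some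
  fixed but unspecified real number.\<close>

definition inverse_process :: "(real \<Rightarrow> 'a \<Rightarrow> real) \<Rightarrow> real \<Rightarrow> 'a \<Rightarrow> real" where
  "inverse_process D t \<omega> = Inf {u. 0 < u \<and> t < D u \<omega>}"

text \<open>Vectors in \<open>\<real>\<^sup>n\<close> are elements of the product space over \<open>{1..n}\<close>.\<close>

definition inverse_fdd ::
  "'a measure \<Rightarrow> (real \<Rightarrow> 'a \<Rightarrow> real) \<Rightarrow> nat \<Rightarrow> (nat \<Rightarrow> real) \<Rightarrow> (nat \<Rightarrow> real) measure" where
  "inverse_fdd M D n t =
     distr M (\<Pi>\<^sub>M i\<in>{1..n}. borel) (\<lambda>\<omega>. \<lambda>i\<in>{1..n}. inverse_process D (t i) \<omega>)"

definition strict_times :: "nat \<Rightarrow> (nat \<Rightarrow> real) set" where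
  "strict_times n = {t \<in> {1..n} \<rightarrow>\<^sub>E UNIV. 0 < t 1 \<and> (\<forall>i\<in>{1..<n}. t i < t (Suc i))}"

section \<open>The time operator\<close>

definition ordered_times :: "nat \<Rightarrow> (nat \<Rightarrow> real) set" where
  "ordered_times n = {t \<in> {1..n} \<rightarrow>\<^sub>E UNIV. 0 < t 1 \<and> (\<forall>i\<in>{1..<n}. t i \<le> t (Suc i))}"

definition laplace_integrand ::
  "nat \<Rightarrow> ((nat \<Rightarrow> real) \<Rightarrow> real) \<Rightarrow> (nat \<Rightarrow> real) \<Rightarrow> (nat \<Rightarrow> real) \<Rightarrow> real" where
  "laplace_integrand n F s t = exp (- (\<Sum>i=1..n. s i * t i)) * F t"

definition laplace_transform ::
  "nat \<Rightarrow> ((nat \<Rightarrow> real) \<Rightarrow> real) \<Rightarrow> (nat \<Rightarrow> real) \<Rightarrow> real" where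
  "laplace_transform n F s = (LINT t|(\<Pi>\<^sub>M i\<in>{1..n}. lborel). laplace_integrand n F s t)"

text \<open>\<open>Phi_rel n \<phi> F G\<close> states that \<open>G\<close> is the image of \<open>F\<close> under the operator with
  Laplace symbol \<open>- \<phi> (s\<^sub>1 + \<dots> + s\<^sub>n)\<close>; it determines \<open>G\<close> up to null sets of times.\<close>

definition Phi_rel ::
  "nat \<Rightarrow> (real \<Rightarrow> real) \<Rightarrow> ((nat \<Rightarrow> real) \<Rightarrow> real) \<Rightarrow> ((nat \<Rightarrow> real) \<Rightarrow> real) \<Rightarrow> bool" where
  "Phi_rel n \<phi> F G \<longleftrightarrow>
     (\<forall>t\<in>{1..n} \<rightarrow>\<^sub>E UNIV. t \<notin> ordered_times n \<longrightarrow> F t = 0 \<and> G t = 0) \<and>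
     (\<forall>s. (\<forall>i\<in>{1..n}. 0 < s i) \<longrightarrow>
        integrable (\<Pi>\<^sub>M i\<in>{1..n}. lborel) (laplace_integrand n F s) \<and>
        integrable (\<Pi>\<^sub>M i\<in>{1..n}. lborel) (laplace_integrand n G s) \<and>
        laplace_transform n G s = - \<phi> (\<Sum>i=1..n. s i) * laplace_transform n F s)"

section \<open>Strata and the space operator\<close>

text \<open>A strictly increasing tuple \<open>k\<^sub>1 = 1 < \<dots> < k\<^sub>l\<close> is encoded by the set \<open>K\<close> of its
  entries, and \<open>f (x\<^sub>k\<^sub>1, \<dots>, x\<^sub>k\<^sub>l)\<close> by a function of a vector indexed by \<open>K\<close> itself.\<close>

definition index_sets :: "nat \<Rightarrow> nat set set" where
  "index_sets n = {K. K \<subseteq> {1..n} \<and> 1 \<in> K}"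

definition stratum :: "nat \<Rightarrow> nat set \<Rightarrow> (nat \<Rightarrow> real) set" where
  "stratum n K = {x \<in> {1..n} \<rightarrow>\<^sub>E UNIV. \<forall>i\<in>{1..n}.
     let p = (if i = 1 then 0 else x (i - 1)) in p \<le> x i \<and> (p < x i \<longleftrightarrow> i \<in> K)}"

definition chamber :: "nat set \<Rightarrow> (nat \<Rightarrow> real) set" where
  "chamber K = {y \<in> K \<rightarrow>\<^sub>E UNIV. \<forall>i\<in>K. 0 < y i \<and> (\<forall>j\<in>K. i < j \<longrightarrow> y i < y j)}"

text \<open>The factors \<open>\<delta>\<close> at \<open>x\<^sub>i\<^sub>-\<^sub>1\<close>, for \<open>i \<notin> K\<close>, force \<open>x\<^sub>i = x\<^sub>i\<^sub>-\<^sub>1\<close>, hence \<open>x\<^sub>i = x\<^sub>k\<close> for the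
  largest \<open>k \<in> K\<close> with \<open>k \<le> i\<close>. The measures on a stratum are therefore images under
  the following bijection from the chamber onto the stratum.\<close>

definition embed :: "nat \<Rightarrow> nat set \<Rightarrow> (nat \<Rightarrow> real) \<Rightarrow> nat \<Rightarrow> real" where
  "embed n K y = (\<lambda>i\<in>{1..n}. y (Max {k \<in> K. k \<le> i}))"

definition stratum_measure ::
  "nat \<Rightarrow> nat set \<Rightarrow> ((nat \<Rightarrow> real) \<Rightarrow> real) \<Rightarrow> (nat \<Rightarrow> real) measure" where
  "stratum_measure n K f =
     distr (density (\<Pi>\<^sub>M i\<in>K. lborel) (\<lambda>y. ennreal (indicator (chamber K) y * f y)))
       (\<Pi>\<^sub>M i\<in>{1..n}. borel) (embed n K)"

definition partial :: "nat \<Rightarrow> ((nat \<Rightarrow> real) \<Rightarrow> real) \<Rightarrow> (nat \<Rightarrow> real) \<Rightarrow> real" where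
  "partial j f y = deriv (\<lambda>u. f (y(j := u))) (y j)"

text \<open>The usual \<open>\<epsilon>\<close>-\<open>\<delta>\<close> condition over finite families of nonoverlapping compact intervals
  \<open>k = [Inf k, Sup k]\<close>.\<close>

definition abs_cont_on :: "real set \<Rightarrow> (real \<Rightarrow> real) \<Rightarrow> bool" where
  "abs_cont_on S f \<longleftrightarrow>
     (\<forall>\<epsilon>>0. \<exists>\<delta>>0. \<forall>\<D> T. \<D> division_of T \<and> T \<subseteq> S \<and> (\<Sum>k\<in>\<D>. Sup k - Inf k) < \<delta> \<longrightarrow>
        (\<Sum>k\<in>\<D>. \<bar>f (Sup k) - f (Inf k)\<bar>) < \<epsilon>)"

text \<open>The last condition makes the space derivative of the measure with density \<open>f\<close> a (locally
  finite) signed measure on the stratum. The almost everywhere existence of the partial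
  derivatives is a consequence of absolute continuity, their local integrability is not if
  \<open>K\<close> has several elements.\<close>

definition admissible_density :: "nat set \<Rightarrow> ((nat \<Rightarrow> real) \<Rightarrow> real) \<Rightarrow> bool" where
  "admissible_density K f \<longleftrightarrow>
     (\<lambda>y. indicator (chamber K) y * f y) \<in> borel_measurable (\<Pi>\<^sub>M i\<in>K. lborel) \<and>
     (\<forall>y\<in>chamber K. 0 \<le> f y) \<and>
     (\<forall>y\<in>chamber K. \<forall>j\<in>K. \<forall>a b. (\<forall>u\<in>{a..b}. y(j := u) \<in> chamber K) \<longrightarrow>
        abs_cont_on {a..b} (\<lambda>u. f (y(j := u)))) \<and>
     (\<forall>y\<in>chamber K. ((\<lambda>u. exp (- u) * f (y(Max K := u))) \<longlongrightarrow> 0) at_top) \<and>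
     (\<forall>j\<in>K.
        (AE y in (\<Pi>\<^sub>M i\<in>K. lborel). y \<in> chamber K \<longrightarrow>
           (\<lambda>u. f (y(j := u))) differentiable (at (y j))) \<and>
        (\<forall>C. compact C \<and> C \<subseteq> chamber K \<longrightarrow>
           set_integrable (\<Pi>\<^sub>M i\<in>K. lborel) C (partial j f)))"

text \<open>The integral of \<open>\<psi>\<close> against the signed measure obtained by applying the space
  derivative to \<open>stratum_measure n K f\<close>.\<close>

definition Dx_integral ::
  "nat \<Rightarrow> nat set \<Rightarrow> ((nat \<Rightarrow> real) \<Rightarrow> real) \<Rightarrow> ((nat \<Rightarrow> real) \<Rightarrow> real) \<Rightarrow> real" where
  "Dx_integral n K f \<psi> =
     (LINT y|(\<Pi>\<^sub>M i\<in>K. lborel).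
        indicator (chamber K) y * \<psi> (embed n K y) * (\<Sum>j\<in>K. partial j f y))"

text \<open>Continuously differentiable functions with compact support in the open chamber. As
  functions of the coordinates in \<open>K\<close> they separate the locally finite signed measures on a
  stratum.\<close>

definition test_function :: "nat set \<Rightarrow> ((nat \<Rightarrow> real) \<Rightarrow> real) \<Rightarrow> bool" where
  "test_function K g \<longleftrightarrow>
     (\<exists>C. compact C \<and> C \<subseteq> chamber K \<and> (\<forall>y\<in>K \<rightarrow>\<^sub>E UNIV. y \<notin> C \<longrightarrow> g y = 0)) \<and>
     continuous_on (K \<rightarrow>\<^sub>E UNIV) g \<and>
     (\<forall>j\<in>K. (\<forall>y\<in>K \<rightarrow>\<^sub>E UNIV. (\<lambda>u. g (y(j := u))) differentiable (at (y j))) \<and>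
        continuous_on (K \<rightarrow>\<^sub>E UNIV) (partial j g))"

text \<open>The equation \<open>\<Phi>\<^sub>t h = - \<bbbD>\<^sub>x h\<close> between (signed) measures on \<open>\<real>\<^sup>n\<close> depending on the times:
  on each stratum, it holds after integration of both sides against every test function.
  Both sides are extended by zero outside \<open>strict_times n\<close>; \<open>f K t\<close> is the density of
  \<open>h t\<close> on the stratum of \<open>K\<close>.\<close>

definition Phi_eq_minus_Dx ::
  "nat \<Rightarrow> (real \<Rightarrow> real) \<Rightarrow> ((nat \<Rightarrow> real) \<Rightarrow> (nat \<Rightarrow> real) measure) \<Rightarrow>
   (nat set \<Rightarrow> (nat \<Rightarrow> real) \<Rightarrow> (nat \<Rightarrow> real) \<Rightarrow> real) \<Rightarrow> bool" where
  "Phi_eq_minus_Dx n \<phi> h f \<longleftrightarrow>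
     (\<forall>K\<in>index_sets n. \<forall>g. test_function K g \<longrightarrow>
        (let \<psi> = (\<lambda>x. g (restrict x K)) in
         Phi_rel n \<phi>
           (\<lambda>t. indicator (strict_times n) t * (LINT x:stratum n K|h t. \<psi> x))
           (\<lambda>t. indicator (strict_times n) t * (- Dx_integral n K (f K t) \<psi>))))"

end

theory Submission
  imports Defs
begin

text \<open>The Laplace transform in the times of the law of \<open>(E\<^bsub>t\<^sub>1\<^esub>, \<dots>, E\<^bsub>t\<^sub>n\<^esub>)\<close> on a stratum, tested against a
  function \<open>g\<close> supported in \<open>y\<^sub>1 > a\<close>, picks up the factor \<open>exp (a \<phi> (s\<^sub>1 + \<dots> + s\<^sub>n))\<close> when \<open>g\<close> is
  translated by \<open>a\<close> along the diagonal: after the substitution \<open>t = t' + D\<^sub>a\<close>, the inverse of the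
  increment process \<open>D\<^bsub>a + u\<^esub> - D\<^sub>a\<close>, which is independent of \<open>D\<^sub>a\<close>, satisfies \<open>E\<^sub>t = a + E'\<^bsub>t'\<^esub>\<close>.
  Differentiating this identity at \<open>a = 0\<close> turns translation of \<open>g\<close> into its diagonal derivative and
  the factor into \<open>- \<phi> (s\<^sub>1 + \<dots> + s\<^sub>n)\<close>. Finally integration by parts in each variable, which needs
  the fundamental theorem of calculus for absolutely continuous functions, moves the derivative from
  \<open>g\<close> to the density.\<close>


section \<open>Absolutely continuous functions\<close>

text \<open>The densities \<open>f K t\<close> come with no regularity in \<open>t\<close>, so they
  are eliminated at each fixed \<open>t\<close>: the space side becomes the expectation of a bounded
  function of the inverse. Joint measurability in time and path then rests on the equivalence of E_t
  \<le> u with t \<le> D_u, which uses right continuity and strict increase of the paths. The time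
  substitution is made path by path. It leaves over the times with t_1 \<le> D_a; there the first
  inverse is at most \<open>a\<close>, and the support condition on \<open>g\<close> removes them.
  Compact support in the open chamber keeps the first coordinate above some e > 0, so the identity
  holds for 0 < a < e, and a one-sided derivative is enough. Independence enters as an equality of
  two finite measures, the law of the shifted inverse weighted by exp (- s D_a) and a multiple of
  the original law. They are compared on boxes of upper bounds, where the joint event depends on
  finitely many increments. As to the sign: replacing \<open>g\<close> by its composition with the
  translation multiplies the transform by exp (- a \<phi>), whose derivative at 0 is -
  \<phi>.\<close>

lemma abs_cont_on_imp_continuous_on:
  assumes "abs_cont_on {a..b} f"
  shows "continuous_on {a..b} f"
  unfolding continuous_on_iff
proof (intro ballI allI impI)
  fix x e :: real assume x: "x \<in> {a..b}" and e: "0 < e"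
  obtain d where d: "d > 0" and *: "\<And>\<D> T. \<D> division_of T \<Longrightarrow> T \<subseteq> {a..b} \<Longrightarrow>
      (\<Sum>k\<in>\<D>. Sup k - Inf k) < d \<Longrightarrow> (\<Sum>k\<in>\<D>. \<bar>f (Sup k) - f (Inf k)\<bar>) < e"
    using assms e unfolding abs_cont_on_def by meson
  have **: "\<bar>f v - f u\<bar> < e" if "u \<in> {a..b}" "v \<in> {a..b}" "u \<le> v" "v - u < d" for u v
    using *[of "{{u..v}}" "{u..v}"] that division_of_self[of u v] by (simp add: subset_eq)
  show "\<exists>d>0. \<forall>x'\<in>{a..b}. dist x' x < d \<longrightarrow> dist (f x') (f x) < e"
  proof (intro exI conjI ballI impI)
    fix x' assume "x' \<in> {a..b}" "dist x' x < d"
    with x show "dist (f x') (f x) < e"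
      using **[of x x'] **[of x' x] by (cases "x \<le> x'") (auto simp: dist_real_def)
  qed (fact d)
qed

text \<open>Discrete product rule: g v f v - g u f u = g v (f v - f u) + f u (g v - g u). The first
  term is controlled by absolute continuity of \<open>f\<close>, the second by the Lipschitz bound
  and the total length. In the application \<open>g\<close> is a slice of a test function and
  \<open>f\<close> a slice of a density.\<close>

lemma abs_cont_on_mult_lipschitz:
  fixes f g :: "real \<Rightarrow> real"
  assumes f: "abs_cont_on {a..b} f"
    and lip: "\<And>x y. x \<in> {a..b} \<Longrightarrow> y \<in> {a..b} \<Longrightarrow> \<bar>g x - g y\<bar> \<le> L * \<bar>x - y\<bar>"
  shows "abs_cont_on {a..b} (\<lambda>x. g x * f x)"
  unfolding abs_cont_on_def
proof (intro allI impI)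
  fix e :: real assume e: "e > 0"
  have "continuous_on {a..b} f" by (rule abs_cont_on_imp_continuous_on[OF f])
  then have "bounded (f ` {a..b})"
    by (intro compact_imp_bounded compact_continuous_image) auto
  then obtain B where B: "\<And>x. x \<in> {a..b} \<Longrightarrow> \<bar>f x\<bar> \<le> B" and "B > 0"
    unfolding bounded_pos by (metis imageI real_norm_def)
  \<comment> \<open>The absolute value allows for a negative \<open>L\<close>; the added 1 makes
    \<open>G\<close> positive, so that it can be divided by. The same holds for \<open>L1\<close>
    below.\<close>
  define G where "G = \<bar>g a\<bar> + \<bar>L\<bar> * \<bar>b - a\<bar> + 1"
  have G0: "G > 0" unfolding G_def by (smt (verit) zero_le_mult_iff abs_ge_zero)
  have G: "\<bar>g x\<bar> \<le> G" if "x \<in> {a..b}" for x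
  proof -
    have "\<bar>g x - g a\<bar> \<le> L * \<bar>x - a\<bar>" using lip[of x a] that by auto
    also have "\<dots> \<le> \<bar>L\<bar> * \<bar>b - a\<bar>" using that by (intro mult_mono) auto
    finally show ?thesis unfolding G_def by linarith
  qed
  define e1 where "e1 = e / 2 / G"
  have "e1 > 0" using e G0 by (simp add: e1_def)
  then obtain d where d: "d > 0" and *: "\<And>\<D> T. \<D> division_of T \<Longrightarrow> T \<subseteq> {a..b} \<Longrightarrow>
      (\<Sum>k\<in>\<D>. Sup k - Inf k) < d \<Longrightarrow> (\<Sum>k\<in>\<D>. \<bar>f (Sup k) - f (Inf k)\<bar>) < e1"
    using f unfolding abs_cont_on_def by meson
  define L1 where "L1 = \<bar>L\<bar> + 1"
  have L1: "L1 > 0" by (simp add: L1_def)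
  show "\<exists>d>0. \<forall>\<D> T. \<D> division_of T \<and> T \<subseteq> {a..b} \<and> (\<Sum>k\<in>\<D>. Sup k - Inf k) < d \<longrightarrow>
        (\<Sum>k\<in>\<D>. \<bar>g (Sup k) * f (Sup k) - g (Inf k) * f (Inf k)\<bar>) < e"
  proof (intro exI[of _ "min d (e / 2 / (B * L1))"] conjI allI impI)
    show "0 < min d (e / 2 / (B * L1))" using d e \<open>B > 0\<close> L1 by simp
    fix \<D> T assume D: "\<D> division_of T \<and> T \<subseteq> {a..b} \<and> (\<Sum>k\<in>\<D>. Sup k - Inf k) < min d (e / 2 / (B * L1))"
    have le: "\<bar>g (Sup k) * f (Sup k) - g (Inf k) * f (Inf k)\<bar>
        \<le> G * \<bar>f (Sup k) - f (Inf k)\<bar> + B * L1 * (Sup k - Inf k)" if k: "k \<in> \<D>" for k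
    proof -
      have "k \<noteq> {}" "k \<subseteq> {a..b}" "\<exists>u v. k = cbox u v"
        using D k by (meson division_ofD order_trans)+
      then obtain u v where uv: "k = {u..v}" "u \<le> v" "u \<in> {a..b}" "v \<in> {a..b}" by auto
      have "g v * f v - g u * f u = g v * (f v - f u) + f u * (g v - g u)" by (simp add: algebra_simps)
      then have "\<bar>g v * f v - g u * f u\<bar> \<le> \<bar>g v\<bar> * \<bar>f v - f u\<bar> + \<bar>f u\<bar> * \<bar>g v - g u\<bar>"
        by (metis abs_mult abs_triangle_ineq)
      also have "\<dots> \<le> G * \<bar>f v - f u\<bar> + B * (L1 * (v - u))"
      proof (intro add_mono mult_mono)
        have "\<bar>g v - g u\<bar> \<le> L * \<bar>v - u\<bar>" using lip uv by blast
        also have "\<dots> \<le> L1 * (v - u)" using uv by (auto simp: L1_def intro!: mult_right_mono)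
        finally show "\<bar>g v - g u\<bar> \<le> L1 * (v - u)" .
      qed (use uv G B G0 \<open>B > 0\<close> in auto)
      finally show ?thesis using uv by (simp add: algebra_simps)
    qed
    have "(\<Sum>k\<in>\<D>. \<bar>g (Sup k) * f (Sup k) - g (Inf k) * f (Inf k)\<bar>)
        \<le> (\<Sum>k\<in>\<D>. G * \<bar>f (Sup k) - f (Inf k)\<bar> + B * L1 * (Sup k - Inf k))"
      by (intro sum_mono le)
    also have "\<dots> = G * (\<Sum>k\<in>\<D>. \<bar>f (Sup k) - f (Inf k)\<bar>) + B * L1 * (\<Sum>k\<in>\<D>. Sup k - Inf k)"
      by (simp add: sum.distrib sum_distrib_left)
    also have "\<dots> < G * e1 + B * L1 * (e / 2 / (B * L1))"
      using D *[of \<D> T] G0 \<open>B > 0\<close> L1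
      by (intro add_strict_mono mult_strict_left_mono) auto
    also have "\<dots> = e" using G0 \<open>B > 0\<close> L1 by (simp add: e1_def)
    finally show "(\<Sum>k\<in>\<D>. \<bar>g (Sup k) * f (Sup k) - g (Inf k) * f (Inf k)\<bar>) < e" .
  qed
qed

text \<open>Tags outside \<open>N\<close> are handled by differentiability; the intervals tagged in \<open>N\<close> lie in an open
  set of small measure, where absolute continuity bounds the increments of \<open>H\<close>.\<close>

theorem abs_cont_on_has_integral:
  fixes H h :: "real \<Rightarrow> real"
  assumes ab: "a \<le> b" and ac: "abs_cont_on {a..b} H" and N: "negligible N"
    and der: "\<And>x. x \<in> {a..b} - N \<Longrightarrow> (H has_real_derivative h x) (at x)"
  shows "(h has_integral (H b - H a)) {a..b}"
proof -
  \<comment> \<open>Setting the integrand to 0 on \<open>N\<close> reduces each term tagged in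
    \<open>N\<close> to an increment of \<open>H\<close>; the spike at the end restores
    \<open>h\<close>.\<close>
  define k where "k x = (if x \<in> N then 0 else h x)" for x
  have "(k has_integral (H b - H a)) {a..b}"
    unfolding has_integral_real
  proof (intro allI impI)
    fix e :: real assume e: "e > 0"
    \<comment> \<open>The added 1 keeps the denominator positive when a = b.\<close>
    define e1 where "e1 = e / 2 / (b - a + 1)"
    have e1: "e1 > 0" using e ab by (simp add: e1_def)
    have "\<exists>d>0. x \<in> {a..b} - N \<longrightarrow>
        (\<forall>y. \<bar>y - x\<bar> < d \<longrightarrow> \<bar>H y - H x - (y - x) * h x\<bar> \<le> e1 * \<bar>y - x\<bar>)" for x
    proof (cases "x \<in> {a..b} - N")
      case True
      then show ?thesis
        using der[OF True] e1 unfolding has_field_derivative_def has_derivative_at_alt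
        by (auto simp: mult.commute)
    qed (auto intro: exI[of _ 1])
    then obtain d where d0: "\<And>x. d x > 0" and d: "\<And>x y. x \<in> {a..b} - N \<Longrightarrow> \<bar>y - x\<bar> < d x \<Longrightarrow>
        \<bar>H y - H x - (y - x) * h x\<bar> \<le> e1 * \<bar>y - x\<bar>"
      by metis
    obtain \<delta> where \<delta>: "\<delta> > 0" and *: "\<And>\<D> T. \<D> division_of T \<Longrightarrow> T \<subseteq> {a..b} \<Longrightarrow>
        (\<Sum>k\<in>\<D>. Sup k - Inf k) < \<delta> \<Longrightarrow> (\<Sum>k\<in>\<D>. \<bar>H (Sup k) - H (Inf k)\<bar>) < e / 2"
      using ac e unfolding abs_cont_on_def by (meson half_gt_zero)
    have "N \<in> null_sets lebesgue" using N by (simp add: negligible_iff_null_sets)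
    then obtain U where U: "open U" "N \<subseteq> U" "U - N \<in> lmeasurable" "emeasure lebesgue (U - N) < ennreal \<delta>"
      using sets_lebesgue_outer_open[of N \<delta>] \<delta> by auto
    have "U = (U - N) \<union> N" using U by auto
    then have "emeasure lebesgue U = emeasure lebesgue (U - N)"
      using \<open>N \<in> null_sets lebesgue\<close> U(3) by (metis emeasure_Un_null_set fmeasurableD)
    then have mU: "emeasure lebesgue U < ennreal \<delta>" using U by simp
    have sU: "U \<in> sets lebesgue" using U(1) by simp
    define \<gamma> where "\<gamma> x = (if x \<in> N then U else ball x (d x))" for x
    have "gauge \<gamma>" unfolding gauge_def \<gamma>_def using U d0 by auto
    moreover have "norm ((\<Sum>(x, K)\<in>p. measure lborel K *\<^sub>R k x) - (H b - H a)) < e"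
      if p: "p tagged_division_of {a..b}" and fine: "\<gamma> fine p" for p
    proof -
      define p1 where "p1 = {(x, K) \<in> p. x \<in> N}"
      define q where "q = (\<lambda>(x, K). measure lborel K * k x - (H (Sup K) - H (Inf K)))"
      have fin: "finite p" using p by auto
      have p1: "p1 \<subseteq> p" by (auto simp: p1_def)
      have intv: "\<exists>u v. K = {u..v} \<and> u \<le> v \<and> x \<in> {u..v} \<and> {u..v} \<subseteq> {a..b}" if z: "(x, K) \<in> p" for x K
      proof -
        obtain u v where "K = cbox u v" using tagged_division_ofD(4)[OF p z] by auto
        with tagged_division_ofD(2,3)[OF p z] show ?thesis by (intro exI[of _ u] exI[of _ v]) auto
      qed
      have ba: "b - a = (\<Sum>(x,K)\<in>p. Sup K - Inf K)" "H b - H a = (\<Sum>(x,K)\<in>p. H(Sup K) - H(Inf K))"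
        using additive_tagged_division_1[OF ab p, of "\<lambda>x. x"] additive_tagged_division_1[OF ab p, of H] by auto
      have "(\<Sum>(x, K)\<in>p. measure lborel K *\<^sub>R k x) - (H b - H a) = (\<Sum>z\<in>p. q z)"
        by (simp add: ba q_def sum_subtractf[symmetric] split_def)
      also have "\<dots> = (\<Sum>z\<in>p1. q z) + (\<Sum>z\<in>p - p1. q z)"
        using fin p1 by (metis add.commute sum.subset_diff)
      finally have eq: "(\<Sum>(x, K)\<in>p. measure lborel K *\<^sub>R k x) - (H b - H a) = (\<Sum>z\<in>p1. q z) + (\<Sum>z\<in>p - p1. q z)" .
      have "\<bar>\<Sum>z\<in>p - p1. q z\<bar> \<le> (\<Sum>z\<in>p - p1. e1 * (case z of (x, K) \<Rightarrow> Sup K - Inf K))"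
      proof (rule order_trans[OF sum_abs], rule sum_mono)
        fix z assume "z \<in> p - p1"
        then obtain x K where zK: "z = (x, K)" and z: "(x, K) \<in> p" "(x, K) \<notin> p1"
          by (cases z) auto
        then have x: "x \<notin> N" by (auto simp: p1_def)
        obtain u v where uv: "K = {u..v}" "u \<le> v" "x \<in> {u..v}" "{u..v} \<subseteq> {a..b}"
          using intv[OF z(1)] by auto
        have sub: "K \<subseteq> ball x (d x)" using fineD[OF fine z(1)] x by (simp add: \<gamma>_def)
        have xx: "x \<in> {a..b} - N" using uv x by auto
        have "u \<in> K" "v \<in> K" using uv by auto
        with sub have "\<bar>u - x\<bar> < d x" "\<bar>v - x\<bar> < d x" by (auto simp: dist_real_def)
        then have "\<bar>H u - H x - (u - x) * h x\<bar> \<le> e1 * \<bar>u - x\<bar>" "\<bar>H v - H x - (v - x) * h x\<bar> \<le> e1 * \<bar>v - x\<bar>"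
          using d[OF xx] by auto
        \<comment> \<open>Straddle argument: since u \<le> x \<le> v, the remainders at the two
          endpoints add up to at most e1 (v - u).\<close>
        moreover have "measure lborel K * k x - (H (Sup K) - H (Inf K)) =
           (H u - H x - (u - x) * h x) - (H v - H x - (v - x) * h x)"
          using uv x by (simp add: k_def algebra_simps)
        moreover have "e1 * \<bar>u - x\<bar> + e1 * \<bar>v - x\<bar> = e1 * (v - u)" using uv by (simp add: algebra_simps)
        ultimately show "\<bar>q z\<bar> \<le> e1 * (case z of (x, K) \<Rightarrow> Sup K - Inf K)"
          using uv zK by (auto simp: q_def)
      qed
      also have "\<dots> \<le> (\<Sum>z\<in>p. e1 * (case z of (x, K) \<Rightarrow> Sup K - Inf K))"
      proof (rule sum_mono2[OF fin])
        fix z assume "z \<in> p - (p - p1)"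
        then obtain x K where "z = (x, K)" "(x, K) \<in> p" by (cases z) auto
        moreover from this obtain u v where "K = {u..v}" "u \<le> v" using intv[of x K] by auto
        ultimately show "0 \<le> e1 * (case z of (x, K) \<Rightarrow> Sup K - Inf K)" using e1 by simp
      qed auto
      also have "\<dots> = e1 * (b - a)" by (simp add: ba sum_distrib_left)
      also have "\<dots> < e1 * (b - a + 1)" using e1 by simp
      also have "\<dots> = e / 2" using nonzero_eq_divide_eq[of "b - a + 1" e1 "e / 2"] ab by (auto simp: e1_def)
      finally have 2: "\<bar>\<Sum>z\<in>p - p1. q z\<bar> < e / 2" .
      have part: "p1 tagged_partial_division_of {a..b}"
        using p p1 by (meson tagged_division_of_def tagged_partial_division_subset)
      note div = partial_division_of_tagged_division[OF part]
      \<comment> \<open>A degenerate interval may carry several tags, so a tagged sum agrees with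
        the sum over the distinct intervals only for functions that vanish on degenerate
        ones.\<close>
      have conv: "(\<Sum>(x, K)\<in>p1. d K) = sum d (snd ` p1)"
        if "\<And>u v. box u v = {} \<Longrightarrow> d (cbox u v) = 0" for d :: "real set \<Rightarrow> real"
        by (rule sum.over_tagged_division_lemma[OF tagged_partial_division_of_Union_self[OF part], of d]) (rule that)
      have sub: "\<Union>(snd ` p1) \<subseteq> {a..b}" "\<Union>(snd ` p1) \<subseteq> U"
      proof safe
        fix x y K assume z: "(x, K) \<in> p1" "y \<in> snd (x, K)"
        then have "(x, K) \<in> p" "x \<in> N" by (auto simp: p1_def)
        moreover from this have "K \<subseteq> \<gamma> x" using fineD[OF fine] by simp
        ultimately show "y \<in> {a..b}" "y \<in> U" using z(2) intv[of x K] by (auto simp: \<gamma>_def)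
      qed
      have "(\<Sum>K\<in>snd ` p1. Sup K - Inf K) = (\<Sum>K\<in>snd ` p1. measure lebesgue K)"
      proof (intro sum.cong refl)
        fix K assume "K \<in> snd ` p1"
        then obtain x where "(x, K) \<in> p" using p1 by auto
        then obtain u v where "K = {u..v}" "u \<le> v" using intv[of x K] by auto
        then show "Sup K - Inf K = measure lebesgue K" by (simp add: measure_completion)
      qed
      also have "\<dots> = measure lebesgue (\<Union>(snd ` p1))"
        using content_division[OF div] by simp
      finally have m: "(\<Sum>K\<in>snd ` p1. Sup K - Inf K) = measure lebesgue (\<Union>(snd ` p1))" .
      have lm: "\<Union>(snd ` p1) \<in> lmeasurable" using div by (rule lmeasurable_division)
      have "ennreal (measure lebesgue (\<Union>(snd ` p1))) = emeasure lebesgue (\<Union>(snd ` p1))"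
        using fmeasurableD2[OF lm] by (metis emeasure_eq_ennreal_measure)
      also have "\<dots> \<le> emeasure lebesgue U" by (intro emeasure_mono sub sU)
      also have "\<dots> < ennreal \<delta>" by (rule mU)
      finally have "(\<Sum>K\<in>snd ` p1. Sup K - Inf K) < \<delta>" by (simp add: m ennreal_less_iff)
      then have 3: "(\<Sum>K\<in>snd ` p1. \<bar>H (Sup K) - H (Inf K)\<bar>) < e / 2"
        by (rule *[OF div sub(1)])
      have "\<bar>\<Sum>z\<in>p1. q z\<bar> \<le> (\<Sum>z\<in>p1. \<bar>q z\<bar>)" by (rule sum_abs)
      \<comment> \<open>\<open>Sup {}\<close> and \<open>Inf {}\<close> are unspecified, while
        \<open>conv\<close> asks for the value 0 on the empty interval; hence the extra
        clause.\<close>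
      also have "\<dots> = (\<Sum>(x, K)\<in>p1. if K = {} then 0 else \<bar>H (Sup K) - H (Inf K)\<bar>)"
      proof (intro sum.cong refl)
        fix z assume z: "z \<in> p1"
        then obtain x K where zK: "z = (x, K)" by (cases z) auto
        then have "K \<noteq> {}" using z intv[of x K] by (auto simp: p1_def)
        with z zK show "\<bar>q z\<bar> = (case z of (x, K) \<Rightarrow> if K = {} then 0 else \<bar>H (Sup K) - H (Inf K)\<bar>)"
          by (auto simp: q_def k_def p1_def)
      qed
      also have "\<dots> = (\<Sum>K\<in>snd ` p1. if K = {} then 0 else \<bar>H (Sup K) - H (Inf K)\<bar>)"
        by (rule conv) (auto simp: box_eq_empty)
      also have "\<dots> \<le> (\<Sum>K\<in>snd ` p1. \<bar>H (Sup K) - H (Inf K)\<bar>)"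
        by (intro sum_mono) auto
      finally have "\<bar>\<Sum>z\<in>p1. q z\<bar> < e / 2" using 3 by linarith
      with 2 have "\<bar>(\<Sum>z\<in>p1. q z) + (\<Sum>z\<in>p - p1. q z)\<bar> < e" by linarith
      then show ?thesis unfolding eq by simp
    qed
    ultimately show "\<exists>\<gamma>. gauge \<gamma> \<and> (\<forall>p. p tagged_division_of {a..b} \<and> \<gamma> fine p \<longrightarrow>
        norm ((\<Sum>(x, K)\<in>p. measure lborel K *\<^sub>R k x) - (H b - H a)) < e)"
      by (intro exI[of _ \<gamma>] conjI allI impI) auto
  qed
  then show ?thesis
    by (rule has_integral_spike[OF N, of "{a..b}" h k, rotated]) (simp add: k_def)
qed


section \<open>Integration by parts on the chamber\<close>

lemma sets_PiM_lborel: "sets (\<Pi>\<^sub>M i\<in>I. lborel) = sets (\<Pi>\<^sub>M i\<in>I. borel)"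
  by (rule sets_PiM_cong) auto

lemma space_PiM_lborel: "space (\<Pi>\<^sub>M i\<in>I. lborel) = I \<rightarrow>\<^sub>E UNIV"
  by (simp add: space_PiM)

lemma borel_measurable_PiM_lborel:
  "borel_measurable (\<Pi>\<^sub>M i\<in>I. lborel) = borel_measurable (\<Pi>\<^sub>M i\<in>I. borel)"
  by (rule measurable_cong_sets[OF sets_PiM_lborel refl])

lemma chamber_subset: "chamber K \<subseteq> K \<rightarrow>\<^sub>E UNIV"
  by (auto simp: chamber_def)

text \<open>The Borel sets of the product topology on all real sequences are the product
  sigma-algebra over all indices. Vectors over \<open>K\<close> embed there measurably because their
  coordinates outside \<open>K\<close> have the constant value \<open>undefined\<close>.\<close>

lemma continuous_on_PiE_borel_measurable:
  fixes g :: "(nat \<Rightarrow> real) \<Rightarrow> real"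
  assumes g: "continuous_on (K \<rightarrow>\<^sub>E UNIV) g"
  shows "g \<in> borel_measurable (\<Pi>\<^sub>M i\<in>K. borel)"
proof -
  have 1: "(\<lambda>y. y) \<in> measurable (\<Pi>\<^sub>M i\<in>K. (borel :: real measure)) (\<Pi>\<^sub>M i\<in>UNIV. borel)"
  proof (rule measurable_PiM_single')
    fix i :: nat
    show "(\<lambda>y. y i) \<in> borel_measurable (\<Pi>\<^sub>M i\<in>K. (borel :: real measure))"
    proof (cases "i \<in> K")
      case False
      have eq: "y i = undefined" if "y \<in> space (\<Pi>\<^sub>M i\<in>K. (borel :: real measure))" for y
        using that False by (auto simp: space_PiM PiE_def extensional_def)
      show ?thesis
        by (subst measurable_cong[OF eq]) auto
    qed simp
  qed (auto simp: space_PiM)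
  have "(\<lambda>y. y) \<in> measurable (\<Pi>\<^sub>M i\<in>K. (borel :: real measure)) (borel :: (nat \<Rightarrow> real) measure)"
    using 1 measurable_cong_sets[OF refl sets_PiM_equal_borel] by blast
  then have "(\<lambda>y. y) \<in> measurable (\<Pi>\<^sub>M i\<in>K. (borel :: real measure))
      (restrict_space (borel :: (nat \<Rightarrow> real) measure) (K \<rightarrow>\<^sub>E UNIV))"
    by (intro measurable_restrict_space2) (auto simp: space_PiM)
  from measurable_compose[OF this borel_measurable_continuous_on_restrict[OF g]] show ?thesis .
qed

lemma continuous_on_fun_upd_line:
  fixes y :: "nat \<Rightarrow> real"
  shows "continuous_on A (\<lambda>u. y(j := u))"
proof (rule continuous_on_coordinatewise_then_product)
  fix i show "continuous_on A (\<lambda>u. (y(j := u)) i)" by (cases "i = j") auto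
qed

lemma fun_upd_in_PiE: "y \<in> K \<rightarrow>\<^sub>E UNIV \<Longrightarrow> j \<in> K \<Longrightarrow> y(j := u) \<in> K \<rightarrow>\<^sub>E UNIV"
  by (auto simp: PiE_def extensional_def)

section \<open>Test functions: derivatives along coordinate lines, support and bounds\<close>

lemma test_functionD:
  assumes "test_function K g"
  shows "\<exists>C. compact C \<and> C \<subseteq> chamber K \<and> (\<forall>y\<in>K \<rightarrow>\<^sub>E UNIV. y \<notin> C \<longrightarrow> g y = 0)"
    and "continuous_on (K \<rightarrow>\<^sub>E UNIV) g"
    and "j \<in> K \<Longrightarrow> y \<in> K \<rightarrow>\<^sub>E UNIV \<Longrightarrow> (\<lambda>u. g (y(j := u))) differentiable (at (y j))"
    and "j \<in> K \<Longrightarrow> continuous_on (K \<rightarrow>\<^sub>E UNIV) (partial j g)"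
  using assms unfolding test_function_def by (elim conjE; simp)+

lemma test_functionE:
  assumes "test_function K g"
  obtains C where "compact C" "C \<subseteq> chamber K" "\<And>y. y \<in> K \<rightarrow>\<^sub>E UNIV \<Longrightarrow> y \<notin> C \<Longrightarrow> g y = 0"
  using test_functionD(1)[OF assms] by metis

lemma partial_fun_upd: "partial j f (y(j := u)) = deriv (\<lambda>v. f (y(j := v))) u"
  by (simp add: partial_def)

lemma test_function_has_partial:
  assumes "test_function K g" "j \<in> K" "y \<in> K \<rightarrow>\<^sub>E UNIV"
  shows "((\<lambda>u. g (y(j := u))) has_real_derivative partial j g (y(j := u))) (at u)"
proof -
  have "y(j := u) \<in> K \<rightarrow>\<^sub>E UNIV" using assms by (intro fun_upd_in_PiE)
  from test_functionD(3)[OF assms(1,2) this] obtain d where d: "((\<lambda>v. g (y(j := v))) has_real_derivative d) (at u)"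
    by (auto simp: real_differentiable_def)
  with DERIV_imp_deriv[OF d] show ?thesis by (simp add: partial_fun_upd)
qed

text \<open>The complement of \<open>C\<close> meets each coordinate line in an open set, so
  \<open>g\<close> vanishes near the point along that line.\<close>

lemma partial_eq_0_outside:
  assumes C: "closed C" and g: "\<And>y. y \<in> K \<rightarrow>\<^sub>E UNIV \<Longrightarrow> y \<notin> C \<Longrightarrow> g y = 0"
    and y: "y \<in> K \<rightarrow>\<^sub>E UNIV" "j \<in> K" "y \<notin> C"
  shows "partial j g y = 0"
proof -
  let ?S = "(\<lambda>u. y(j := u)) -` (- C)"
  have "open ?S"
    using continuous_on_fun_upd_line C by (intro open_vimage) auto
  moreover have "y j \<in> ?S" using y by simp
  moreover have eq: "0 = g (y(j := u))" if "u \<in> ?S" for u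
    using that y g[OF fun_upd_in_PiE[OF y(1,2), of u]] by auto
  ultimately have "((\<lambda>u. g (y(j := u))) has_real_derivative 0) (at (y j))"
    by (rule has_field_derivative_transform_within_open[OF DERIV_const])
  then show ?thesis unfolding partial_def by (rule DERIV_imp_deriv)
qed

text \<open>\<open>g\<close> and its partial derivatives are continuous and vanish off one compact
  set. Adding up the finitely many separate bounds gives a single constant for all of them.\<close>

lemma test_function_bounded:
  assumes g: "test_function K g"
  obtains B where "B > 0" "\<And>y. y \<in> K \<rightarrow>\<^sub>E UNIV \<Longrightarrow> \<bar>g y\<bar> \<le> B"
    "\<And>j y. j \<in> K \<Longrightarrow> finite K \<Longrightarrow> y \<in> K \<rightarrow>\<^sub>E UNIV \<Longrightarrow> \<bar>partial j g y\<bar> \<le> B"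
proof -
  obtain C where C: "compact C" "C \<subseteq> chamber K" "\<And>y. y \<in> K \<rightarrow>\<^sub>E UNIV \<Longrightarrow> y \<notin> C \<Longrightarrow> g y = 0"
    using test_functionE[OF g] by metis
  have *: "\<exists>B>0. \<forall>y\<in>K \<rightarrow>\<^sub>E UNIV. \<bar>h y\<bar> \<le> B"
    if h: "continuous_on (K \<rightarrow>\<^sub>E UNIV) h" "\<And>y. y \<in> K \<rightarrow>\<^sub>E UNIV \<Longrightarrow> y \<notin> C \<Longrightarrow> h y = 0" for h :: "_ \<Rightarrow> real"
  proof -
    have "continuous_on C h" using h(1) C(2) chamber_subset by (meson continuous_on_subset order_trans)
    then have "bounded (h ` C)" using C(1) by (intro compact_imp_bounded compact_continuous_image)
    then obtain B where B: "B > 0" "\<And>y. y \<in> C \<Longrightarrow> \<bar>h y\<bar> \<le> B"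
      unfolding bounded_pos by (metis imageI real_norm_def)
    show ?thesis
    proof (intro exI[of _ B] conjI ballI B(1))
      fix y assume "y \<in> K \<rightarrow>\<^sub>E (UNIV :: real set)"
      then show "\<bar>h y\<bar> \<le> B" using B h(2)[of y] by (cases "y \<in> C") auto
    qed
  qed
  obtain B0 where B0: "B0 > 0" "\<And>y. y \<in> K \<rightarrow>\<^sub>E UNIV \<Longrightarrow> \<bar>g y\<bar> \<le> B0"
    using *[OF test_functionD(2)[OF g] C(3)] by auto
  have "\<exists>B>0. \<forall>y\<in>K \<rightarrow>\<^sub>E UNIV. \<bar>partial j g y\<bar> \<le> B" if "j \<in> K" for j
    using test_functionD(4)[OF g that] partial_eq_0_outside[OF compact_imp_closed[OF C(1)] C(3) _ that]
    by (intro *) auto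
  then obtain Bj where Bj: "\<And>j. j \<in> K \<Longrightarrow> Bj j > 0"
      "\<And>j y. j \<in> K \<Longrightarrow> y \<in> K \<rightarrow>\<^sub>E UNIV \<Longrightarrow> \<bar>partial j g y\<bar> \<le> Bj j"
    by metis
  show ?thesis
  proof (rule that[of "B0 + sum Bj K"])
    have s: "sum Bj K \<ge> 0" using Bj(1) by (intro sum_nonneg less_imp_le)
    then show "B0 + sum Bj K > 0" using B0 by simp
    show "\<bar>g y\<bar> \<le> B0 + sum Bj K" if "y \<in> K \<rightarrow>\<^sub>E UNIV" for y using B0(2)[OF that] s by simp
    show "\<bar>partial j g y\<bar> \<le> B0 + sum Bj K" if "j \<in> K" "finite K" "y \<in> K \<rightarrow>\<^sub>E UNIV" for j y
    proof -
      have "\<bar>partial j g y\<bar> \<le> Bj j" using Bj(2) that by blast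
      also have "\<dots> \<le> sum Bj K" using that Bj(1) by (intro member_le_sum) (auto intro: less_imp_le)
      finally show ?thesis using B0 by simp
    qed
  qed
qed

lemma test_function_measurable:
  assumes "test_function K g"
  shows "g \<in> borel_measurable (\<Pi>\<^sub>M i\<in>K. borel)"
    and "j \<in> K \<Longrightarrow> partial j g \<in> borel_measurable (\<Pi>\<^sub>M i\<in>K. borel)"
  using test_functionD(2,4)[OF assms] by (auto intro: continuous_on_PiE_borel_measurable)

text \<open>Tonelli for the indicator of the exceptional null set: its sections in the coordinate
  \<open>i\<close> are null for almost every choice of the other coordinates.\<close>

lemma AE_PiM_lborel_slice:
  fixes P :: "(nat \<Rightarrow> real) \<Rightarrow> bool"
  assumes I: "finite I" "i \<notin> I" and P: "AE y in (\<Pi>\<^sub>M i\<in>insert i I. lborel). P y"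
  shows "AE y in (\<Pi>\<^sub>M i\<in>I. lborel). AE u in lborel. P (y(i := u))"
proof -
  interpret product_sigma_finite "\<lambda>_::nat. lborel :: real measure" by standard
  let ?M = "\<Pi>\<^sub>M i\<in>insert i I. lborel :: real measure"
  obtain N where N: "N \<in> null_sets ?M" "{y \<in> space ?M. \<not> P y} \<subseteq> N"
    using P by (auto simp: eventually_ae_filter)
  have [measurable]: "N \<in> sets ?M" using N by auto
  have ins: "(\<lambda>(y, u). y(i := u)) \<in> measurable ((\<Pi>\<^sub>M i\<in>I. lborel) \<Otimes>\<^sub>M lborel) ?M"
    by (rule measurable_add_dim)
  have "0 = (\<integral>\<^sup>+y. indicator N y \<partial>?M)" using N by auto
  also have "\<dots> = (\<integral>\<^sup>+y. (\<integral>\<^sup>+u. indicator N (y(i := u)) \<partial>lborel) \<partial>(\<Pi>\<^sub>M i\<in>I. lborel))"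
    by (intro product_nn_integral_insert I) auto
  finally have "AE y in (\<Pi>\<^sub>M i\<in>I. lborel). (\<integral>\<^sup>+u. indicator N (y(i := u)) \<partial>lborel) = 0"
    using ins by (subst nn_integral_0_iff_AE[symmetric])
      (auto intro!: lborel.borel_measurable_nn_integral measurable_compose[OF ins, of "indicator N", unfolded split_def, simplified] simp: split_beta')
  moreover have "AE u in lborel. P (y(i := u))"
    if y: "y \<in> space (\<Pi>\<^sub>M i\<in>I. lborel :: real measure)"
      and 0: "(\<integral>\<^sup>+u. indicator N (y(i := u)) \<partial>lborel) = 0" for y
  proof -
    have "(\<lambda>u. y(i := u)) \<in> measurable lborel ?M"
      using measurable_compose[OF measurable_Pair1'[OF y] ins] by simp
    then have "AE u in lborel. indicator N (y(i := u)) = (0::ennreal)"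
      using 0 by (subst (asm) nn_integral_0_iff_AE) auto
    moreover have imp: "P (y(i := u))" if "indicator N (y(i := u)) = (0::ennreal)" for u
    proof -
      have "y(i := u) \<notin> N" using that by (simp add: indicator_eq_0_iff)
      moreover have "y(i := u) \<in> space ?M" using y by (auto simp: space_PiM PiE_def extensional_def)
      ultimately show ?thesis using N(2) by blast
    qed
    ultimately show ?thesis by (auto elim: AE_mp)
  qed
  ultimately show ?thesis using AE_space by (auto elim!: AE_mp)
qed

text \<open>The integrand is almost everywhere the derivative of the product of \<open>g\<close> and
  \<open>f\<close> on [c, d], is zero elsewhere, and \<open>g\<close> vanishes at both ends. In the
  application \<open>S\<close> is the slice of the chamber along a coordinate line.\<close>

lemma integral_product_deriv_eq_0:
  fixes f g :: "real \<Rightarrow> real"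
  assumes cd: "c \<le> d" "{c..d} \<subseteq> S" and f: "abs_cont_on {c..d} f"
    and df: "AE u in lborel. u \<in> {c..d} \<longrightarrow> f differentiable (at u)"
    and g: "\<And>u. (g has_real_derivative g' u) (at u)" and g': "\<And>u. \<bar>g' u\<bar> \<le> B"
    and out: "\<And>u. u \<notin> {c..d} \<Longrightarrow> g u = 0" "\<And>u. u \<notin> {c..d} \<Longrightarrow> g' u = 0"
  shows "(LINT u|lborel. indicator S u * g u * deriv f u + indicator S u * g' u * f u) = 0"
    (is "(LINT u|lborel. ?F u) = 0")
proof (cases "integrable lborel ?F")
  \<comment> \<open>The integral of a function that is not integrable is 0 by convention, which is
    the claimed value.\<close>
  case False
  then show ?thesis by (rule not_integrable_integral_eq)
next
  case True
  obtain N where N: "N \<in> null_sets lborel" "{u \<in> space lborel. \<not> (u \<in> {c..d} \<longrightarrow> f differentiable (at u))} \<subseteq> N"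
    using df by (auto simp: eventually_ae_filter)
  have "N \<in> null_sets lebesgue" using N(1) by (rule null_sets_completionI)
  then have negl: "negligible N" by (simp add: negligible_iff_null_sets)
  have cont: "isCont g u" for u using g by (rule DERIV_isCont)
  \<comment> \<open>The endpoints belong to [c, d], so the values there come from continuity and the
    values just outside.\<close>
  have "g c = 0"
  proof (rule tendsto_unique[of "at_left c" g])
    show "(g \<longlongrightarrow> g c) (at_left c)" using cont by (simp add: continuous_at filterlim_at_split)
    have "eventually (\<lambda>u. 0 = g u) (at_left c)" using out by (auto simp: eventually_at_filter)
    then show "(g \<longlongrightarrow> 0) (at_left c)" by (rule Lim_transform_eventually[rotated]) simp
  qed simp
  have "g d = 0"
  proof (rule tendsto_unique[of "at_right d" g])
    show "(g \<longlongrightarrow> g d) (at_right d)" using cont by (simp add: continuous_at filterlim_at_split)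
    have "eventually (\<lambda>u. 0 = g u) (at_right d)" using out by (auto simp: eventually_at_filter)
    then show "(g \<longlongrightarrow> 0) (at_right d)" by (rule Lim_transform_eventually[rotated]) simp
  qed simp
  have lip: "\<bar>g x - g y\<bar> \<le> B * \<bar>x - y\<bar>" for x y
    using field_differentiable_bound[of UNIV g g' B x y] g g' by auto
  \<comment> \<open>This is a gauge integral; integrability of \<open>?F\<close> identifies it with
    the Lebesgue integral at the end.\<close>
  have "((\<lambda>u. g u * deriv f u + g' u * f u) has_integral g d * f d - g c * f c) {c..d}"
  proof (rule abs_cont_on_has_integral[OF cd(1) _ negl])
    show "abs_cont_on {c..d} (\<lambda>u. g u * f u)" by (rule abs_cont_on_mult_lipschitz[OF f lip])
    fix u assume u: "u \<in> {c..d} - N"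
    then have "f differentiable (at u)" using N(2) by auto
    then have "(f has_real_derivative deriv f u) (at u)"
      by (auto simp: real_differentiable_def DERIV_imp_deriv)
    from DERIV_mult[OF g[of u] this]
    show "((\<lambda>u. g u * f u) has_real_derivative g u * deriv f u + g' u * f u) (at u)"
      by (simp add: algebra_simps)
  qed
  then have "((\<lambda>u. g u * deriv f u + g' u * f u) has_integral 0) {c..d}"
    using \<open>g c = 0\<close> \<open>g d = 0\<close> by simp
  then have "((\<lambda>u. if u \<in> {c..d} then g u * deriv f u + g' u * f u else 0) has_integral 0) UNIV"
    by (simp only: has_integral_restrict_UNIV)
  also have "(\<lambda>u. if u \<in> {c..d} then g u * deriv f u + g' u * f u else 0) = ?F"
  proof
    fix u show "(if u \<in> {c..d} then g u * deriv f u + g' u * f u else 0) = ?F u"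
      using cd(2) out[of u] by (cases "u \<in> {c..d}") (auto simp: indicator_def)
  qed
  finally have "(?F has_integral 0) UNIV" .
  then show ?thesis using has_integral_integral_lborel[OF True] by (rule has_integral_unique[symmetric])
qed

text \<open>Each chamber condition is a linear inequality in the single coordinate \<open>j\<close>.
  The support of a test function on a line need not be an interval; this fills its gaps, so that
  absolute continuity can be invoked between its extreme points.\<close>

lemma chamber_slice_convex:
  assumes c: "y(j := c) \<in> chamber K" and d: "y(j := d) \<in> chamber K" and u: "c \<le> u" "u \<le> d"
    and j: "j \<in> K"
  shows "y(j := u) \<in> chamber K"
proof -
  have "0 < (y(j := u)) i" if "i \<in> K" for i
    using c d u that unfolding chamber_def by (cases "i = j") force+
  moreover have "(y(j := u)) i < (y(j := u)) k" if "i \<in> K" "k \<in> K" "i < k" for i k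
  proof -
    have "(y(j := c)) i < (y(j := c)) k" "(y(j := d)) i < (y(j := d)) k"
      using c d that unfolding chamber_def by blast+
    then show ?thesis using u that by (cases "i = j"; cases "k = j") auto
  qed
  moreover have "y(j := u) \<in> K \<rightarrow>\<^sub>E UNIV"
    using c j by (auto simp: chamber_def PiE_def extensional_def)
  ultimately show ?thesis unfolding chamber_def by blast
qed

lemma admissible_densityD:
  assumes "admissible_density K f"
  shows "y \<in> chamber K \<Longrightarrow> j \<in> K \<Longrightarrow> \<forall>u\<in>{a..b}. y(j := u) \<in> chamber K \<Longrightarrow>
      abs_cont_on {a..b} (\<lambda>u. f (y(j := u)))"
    and "j \<in> K \<Longrightarrow> AE y in (\<Pi>\<^sub>M i\<in>K. lborel). y \<in> chamber K \<longrightarrow>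
      (\<lambda>u. f (y(j := u))) differentiable (at (y j))"
    and "j \<in> K \<Longrightarrow> compact C \<Longrightarrow> C \<subseteq> chamber K \<Longrightarrow> set_integrable (\<Pi>\<^sub>M i\<in>K. lborel) C (partial j f)"
    and "(\<lambda>y. indicator (chamber K) y * f y) \<in> borel_measurable (\<Pi>\<^sub>M i\<in>K. lborel)"
    and "y \<in> chamber K \<Longrightarrow> 0 \<le> f y"
  using assms unfolding admissible_density_def by (elim conjE; simp)+

text \<open>Fubini with the coordinate \<open>j\<close> innermost reduces the identity to almost
  every coordinate line, where the sum of the two integrands is the derivative of a product. Local
  integrability of the derivative of \<open>f\<close> makes the first integrand integrable,
  integrability of \<open>f\<close> the second.\<close>

lemma partial_integration_by_parts:
  assumes K: "finite K" "j \<in> K" and f: "admissible_density K f" and g: "test_function K g"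
    and int: "integrable (\<Pi>\<^sub>M i\<in>K. lborel) (\<lambda>y. indicator (chamber K) y * f y)"
  shows "integrable (\<Pi>\<^sub>M i\<in>K. lborel) (\<lambda>y. indicator (chamber K) y * g y * partial j f y)" (is "integrable ?M ?A")
    and "integrable (\<Pi>\<^sub>M i\<in>K. lborel) (\<lambda>y. indicator (chamber K) y * partial j g y * f y)" (is "integrable ?M ?B")
    and "(LINT y|(\<Pi>\<^sub>M i\<in>K. lborel). indicator (chamber K) y * g y * partial j f y) =
      - (LINT y|(\<Pi>\<^sub>M i\<in>K. lborel). indicator (chamber K) y * partial j g y * f y)"
proof -
  interpret product_sigma_finite "\<lambda>_::nat. lborel :: real measure" by standard
  obtain C where C: "compact C" "C \<subseteq> chamber K" "\<And>y. y \<in> K \<rightarrow>\<^sub>E UNIV \<Longrightarrow> y \<notin> C \<Longrightarrow> g y = 0"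
    using test_functionE[OF g] by metis
  have clC: "closed C" using C(1) by (rule compact_imp_closed)
  obtain B where B: "B > 0" "\<And>y. y \<in> K \<rightarrow>\<^sub>E UNIV \<Longrightarrow> \<bar>g y\<bar> \<le> B"
    "\<And>y. y \<in> K \<rightarrow>\<^sub>E UNIV \<Longrightarrow> \<bar>partial j g y\<bar> \<le> B"
    using test_function_bounded[OF g] K by metis
  have [measurable]: "g \<in> borel_measurable ?M" "partial j g \<in> borel_measurable ?M"
    using test_function_measurable[OF g] K by (auto simp: borel_measurable_PiM_lborel)
  have "set_integrable ?M C (partial j f)" using admissible_densityD(3)[OF f K(2) C(1,2)] .
  then have intC: "integrable ?M (\<lambda>y. indicator C y * partial j f y)" by (simp add: set_integrable_def)
  show A: "integrable ?M ?A"
  proof -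
    have "integrable ?M (\<lambda>y. g y * (indicator C y * partial j f y))"
    proof (rule Bochner_Integration.integrable_bound[OF integrable_mult_right[OF intC, of B]])
      show "AE y in ?M. norm (g y * (indicator C y * partial j f y)) \<le> norm (B * (indicator C y * partial j f y))"
        using B by (intro AE_I2) (auto simp: abs_mult space_PiM_lborel intro!: mult_right_mono)
    qed (use intC in measurable)
    then show ?thesis
    proof (rule Bochner_Integration.integrable_cong[THEN iffD1, rotated -1, OF _ refl])
      fix y assume "y \<in> space ?M"
      then show "g y * (indicator C y * partial j f y) = ?A y"
        using C(2) C(3)[of y] by (cases "y \<in> C") (auto simp: space_PiM_lborel)
    qed
  qed
  show Bi: "integrable ?M ?B"
  proof -
    have "integrable ?M (\<lambda>y. partial j g y * (indicator (chamber K) y * f y))"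
    proof (rule Bochner_Integration.integrable_bound[OF integrable_mult_right[OF int, of B]])
      show "AE y in ?M. norm (partial j g y * (indicator (chamber K) y * f y)) \<le> norm (B * (indicator (chamber K) y * f y))"
        using B by (intro AE_I2) (auto simp: abs_mult space_PiM_lborel intro!: mult_right_mono)
    qed (use int in measurable)
    then show ?thesis by (simp add: ac_simps)
  qed
  define I where "I = K - {j}"
  have I: "finite I" "j \<notin> I" "K = insert j I" using K by (auto simp: I_def)
  have "AE y in ?M. y \<in> chamber K \<longrightarrow> (\<lambda>u. f (y(j := u))) differentiable (at (y j))"
    by (rule admissible_densityD(2)[OF f K(2)])
  then have "AE y in (\<Pi>\<^sub>M i\<in>insert j I. lborel). y \<in> chamber K \<longrightarrow> (\<lambda>u. f (y(j := u))) differentiable (at (y j))"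
    by (simp only: I(3)[symmetric])
  from AE_PiM_lborel_slice[OF I(1,2) this]
  have AE: "AE y in (\<Pi>\<^sub>M i\<in>I. lborel). AE u in lborel. y(j := u) \<in> chamber K \<longrightarrow>
      (\<lambda>v. f (y(j := v))) differentiable (at u)"
    by (simp only: fun_upd_upd fun_upd_same)
  have "(LINT y|?M. ?A y + ?B y) = (LINT y|(\<Pi>\<^sub>M i\<in>I. lborel). LINT u|lborel. ?A (y(j := u)) + ?B (y(j := u)))"
    using product_integral_insert[OF I(1,2), of "\<lambda>y. ?A y + ?B y"] A Bi by (simp add: I(3)[symmetric])
  also have "\<dots> = 0"
  proof (rule integral_eq_zero_AE)
    show "AE y in (\<Pi>\<^sub>M i\<in>I. lborel). (LINT u|lborel. ?A (y(j := u)) + ?B (y(j := u))) = 0"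
      using AE
    proof (rule AE_mp, intro AE_I2 impI)
      fix y assume "y \<in> space (\<Pi>\<^sub>M i\<in>I. lborel :: real measure)"
        and df: "AE u in lborel. y(j := u) \<in> chamber K \<longrightarrow> (\<lambda>v. f (y(j := v))) differentiable (at u)"
      then have yK: "y(j := u) \<in> K \<rightarrow>\<^sub>E UNIV" for u
        by (auto simp: space_PiM PiE_def extensional_def I(3))
      \<comment> \<open>The trace of the support on the line. It is bounded because its points are
        \<open>j\<close>-th coordinates of points of \<open>C\<close>.\<close>
      let ?Cy = "(\<lambda>u. y(j := u)) -` C"
      have "closed ?Cy" using clC by (intro closed_vimage continuous_on_fun_upd_line)
      moreover have "bounded ?Cy"
      proof -
        have "bounded ((\<lambda>z. z j) ` C)"
          using C(1) by (intro compact_imp_bounded compact_continuous_image continuous_on_subset[OF continuous_on_product_coordinates subset_UNIV])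
        moreover have "?Cy \<subseteq> (\<lambda>z. z j) ` C" by (force intro: rev_image_eqI)
        ultimately show ?thesis by (rule bounded_subset)
      qed
      ultimately have cpt: "compact ?Cy" by (simp add: compact_eq_bounded_closed)
      have zero: "g (y(j := u)) = 0" "partial j g (y(j := u)) = 0" if "u \<notin> ?Cy" for u
        using that C(3)[OF yK, of u] partial_eq_0_outside[OF clC C(3) yK[of u] K(2)] by auto
      show "(LINT u|lborel. ?A (y(j := u)) + ?B (y(j := u))) = 0"
      proof (cases "?Cy = {}")
        case True
        then show ?thesis using zero by simp
      next
        case False
        obtain c where c: "c \<in> ?Cy" "\<And>u. u \<in> ?Cy \<Longrightarrow> c \<le> u"
          using compact_attains_inf[OF cpt False] by blast
        obtain d where d: "d \<in> ?Cy" "\<And>u. u \<in> ?Cy \<Longrightarrow> u \<le> d"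
          using compact_attains_sup[OF cpt False] by blast
        have sub: "{c..d} \<subseteq> {u. y(j := u) \<in> chamber K}"
        proof
          fix u assume "u \<in> {c..d}"
          moreover have "y(j := c) \<in> chamber K" "y(j := d) \<in> chamber K" using c(1) d(1) C(2) by auto
          ultimately show "u \<in> {u. y(j := u) \<in> chamber K}" using chamber_slice_convex[OF _ _ _ _ K(2), of y c d u] by simp
        qed
        have "(LINT u|lborel. indicator {u. y(j := u) \<in> chamber K} u * g (y(j := u)) * deriv (\<lambda>v. f (y(j := v))) u
          + indicator {u. y(j := u) \<in> chamber K} u * partial j g (y(j := u)) * f (y(j := u))) = 0"
        proof (rule integral_product_deriv_eq_0[where c = c and d = d and B = B])
          show "c \<le> d" by (rule c(2)[OF d(1)])
          \<comment> \<open>The base point has to be moved into the chamber, as \<open>y\<close>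
            itself only carries the coordinates in \<open>I\<close>.\<close>
          have cch: "y(j := c) \<in> chamber K" using c(1) C(2) by auto
          have "\<forall>u\<in>{c..d}. (y(j := c))(j := u) \<in> chamber K" using sub by auto
          then have "abs_cont_on {c..d} (\<lambda>u. f ((y(j := c))(j := u)))"
            by (rule admissible_densityD(1)[OF f cch K(2)])
          then show "abs_cont_on {c..d} (\<lambda>u. f (y(j := u)))" by simp
          show "AE u in lborel. u \<in> {c..d} \<longrightarrow> (\<lambda>u. f (y(j := u))) differentiable (at u)"
            using df by (rule AE_mp) (use sub in \<open>auto simp: subset_eq\<close>)
          show "((\<lambda>u. g (y(j := u))) has_real_derivative partial j g (y(j := u))) (at u)" for u
            using test_function_has_partial[OF g K(2) yK[of 0], of u] by simp
          show "\<bar>partial j g (y(j := u))\<bar> \<le> B" for u by (rule B(3)[OF yK])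
          show "g (y(j := u)) = 0" "partial j g (y(j := u)) = 0" if "u \<notin> {c..d}" for u
            using that zero[of u] c(2)[of u] d(2)[of u] by auto
        qed (rule sub)
        moreover have "indicator {u. y(j := u) \<in> chamber K} u = (indicator (chamber K) (y(j := u)) :: real)" for u
          by (simp add: indicator_def)
        ultimately show ?thesis by (simp add: partial_fun_upd)
      qed
    qed
  qed
  finally have "(LINT y|?M. ?A y) + (LINT y|?M. ?B y) = 0" using A Bi by simp
  then show "(LINT y|?M. ?A y) = - (LINT y|?M. ?B y)" by simp
qed


section \<open>Diagonal translation\<close>

lemma tendsto_coordinatewise:
  fixes f :: "'a \<Rightarrow> nat \<Rightarrow> real"
  assumes "\<And>i. ((\<lambda>x. f x i) \<longlongrightarrow> l i) F"
  shows "(f \<longlongrightarrow> l) F"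
proof -
  have "limitin (product_topology (\<lambda>_::nat. euclidean :: real topology) UNIV) f l F"
    using assms by (auto simp: limitin_componentwise)
  then show ?thesis by (simp add: euclidean_product_topology)
qed

lemma test_function_shift_step:
  assumes g: "test_function K g" and j: "j \<in> K" and z: "z \<in> K \<rightarrow>\<^sub>E UNIV" and a: "0 < a"
  shows "\<exists>\<theta>. z j < \<theta> \<and> \<theta> < z j + a \<and> g (z(j := z j + a)) - g z = a * partial j g (z(j := \<theta>))"
proof -
  have "\<exists>\<theta>. z j < \<theta> \<and> \<theta> < z j + a \<and>
      g (z(j := z j + a)) - g (z(j := z j)) = (z j + a - z j) * partial j g (z(j := \<theta>))"
    by (rule MVT2[of "z j" "z j + a" "\<lambda>u. g (z(j := u))"]) (use a test_function_has_partial[OF g j z] in auto)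
  then show ?thesis by simp
qed

text \<open>The set \<open>J\<close> allows the diagonal translation, which is the case J = K, to be
  carried out one coordinate at a time.\<close>

definition diag_shift :: "nat set \<Rightarrow> real \<Rightarrow> (nat \<Rightarrow> real) \<Rightarrow> nat \<Rightarrow> real" where
  "diag_shift J a y = (\<lambda>i. if i \<in> J then y i + a else y i)"

lemma diag_shift_in_PiE: "y \<in> K \<rightarrow>\<^sub>E UNIV \<Longrightarrow> J \<subseteq> K \<Longrightarrow> diag_shift J a y \<in> K \<rightarrow>\<^sub>E UNIV"
  by (auto simp: diag_shift_def PiE_def extensional_def)

lemma diag_shift_measurable:
  "diag_shift K a \<in> measurable (\<Pi>\<^sub>M i\<in>K. borel) (\<Pi>\<^sub>M i\<in>K. borel)"
proof -
  have "(\<lambda>y. \<lambda>i\<in>K. y i + a) \<in> measurable (\<Pi>\<^sub>M i\<in>K. borel) (\<Pi>\<^sub>M i\<in>K. (borel :: real measure))"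
    by (intro measurable_restrict borel_measurable_add measurable_const measurable_component_singleton) auto
  then show ?thesis
    by (rule measurable_cong[THEN iffD1, rotated])
      (auto simp: diag_shift_def space_PiM PiE_def extensional_def fun_eq_iff)
qed

lemma diag_shift_insert: "j \<notin> J \<Longrightarrow> diag_shift (insert j J) a y = (diag_shift J a y)(j := diag_shift J a y j + a)"
  by (auto simp: diag_shift_def fun_eq_iff)

text \<open>One mean value estimate per coordinate, hence the factor \<open>card J\<close>. After
  division by \<open>a\<close> the bound is uniform in \<open>a\<close> and \<open>y\<close>, and so
  dominates the difference quotients.\<close>

lemma test_function_shift_bound:
  assumes g: "test_function K g" and B: "\<And>j y. j \<in> K \<Longrightarrow> y \<in> K \<rightarrow>\<^sub>E UNIV \<Longrightarrow> \<bar>partial j g y\<bar> \<le> B"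
    and y: "y \<in> K \<rightarrow>\<^sub>E UNIV" and a: "0 < a" and J: "finite J" "J \<subseteq> K"
  shows "\<bar>g (diag_shift J a y) - g y\<bar> \<le> a * (real (card J) * B)"
  using J
proof (induction J rule: finite_induct)
  case empty
  then show ?case by (simp add: diag_shift_def)
next
  case (insert j J)
  let ?z = "diag_shift J a y"
  have z: "?z \<in> K \<rightarrow>\<^sub>E UNIV" using y insert.prems by (intro diag_shift_in_PiE) auto
  obtain \<theta> where \<theta>: "g (?z(j := ?z j + a)) - g ?z = a * partial j g (?z(j := \<theta>))"
    using test_function_shift_step[OF g _ z a, of j] insert.prems by auto
  have "\<bar>partial j g (?z(j := \<theta>))\<bar> \<le> B"
    using insert.prems z by (intro B fun_upd_in_PiE) auto
  then have "a * \<bar>partial j g (?z(j := \<theta>))\<bar> \<le> a * B" using a by (intro mult_left_mono) auto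
  then have "\<bar>g (?z(j := ?z j + a)) - g ?z\<bar> \<le> a * B"
    unfolding \<theta> abs_mult using a by simp
  moreover have "\<bar>g ?z - g y\<bar> \<le> a * (real (card J) * B)" using insert by auto
  ultimately have "\<bar>g (?z(j := ?z j + a)) - g y\<bar> \<le> a * B + a * (real (card J) * B)" by linarith
  then show ?case using insert.hyps by (simp add: diag_shift_insert algebra_simps del: fun_upd_apply)
qed

text \<open>Only partial derivatives are at hand, so the coordinates are moved one after the other.
  Each move contributes a partial derivative at an intermediate point tending to \<open>y\<close>,
  and continuity of the partial derivatives gives the limit.\<close>

lemma test_function_shift_deriv:
  assumes g: "test_function K g" and y: "y \<in> K \<rightarrow>\<^sub>E UNIV"
    and a: "\<And>m. 0 < a m" "a \<longlonglongrightarrow> 0" and J: "finite J" "J \<subseteq> K"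
  shows "(\<lambda>m. (g (diag_shift J (a m) y) - g y) / a m) \<longlonglongrightarrow> (\<Sum>j\<in>J. partial j g y)"
  using J
proof (induction J rule: finite_induct)
  case empty
  then show ?case by (simp add: diag_shift_def)
next
  case (insert j J)
  let ?z = "\<lambda>m. diag_shift J (a m) y"
  have jK: "j \<in> K" and JK: "J \<subseteq> K" using insert.prems by auto
  have z: "?z m \<in> K \<rightarrow>\<^sub>E UNIV" for m using y JK by (rule diag_shift_in_PiE)
  obtain \<theta> where \<theta>: "\<And>m. ?z m j < \<theta> m" "\<And>m. \<theta> m < ?z m j + a m"
    "\<And>m. g ((?z m)(j := ?z m j + a m)) - g (?z m) = a m * partial j g ((?z m)(j := \<theta> m))"
  proof -
    have "\<exists>\<theta>. ?z m j < \<theta> \<and> \<theta> < ?z m j + a m \<and>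
        g ((?z m)(j := ?z m j + a m)) - g (?z m) = a m * partial j g ((?z m)(j := \<theta>))" for m
      by (rule test_function_shift_step[OF g jK z a(1)])
    then show ?thesis using that by metis
  qed
  \<comment> \<open>Coordinate \<open>j\<close> has not been moved yet, so \<open>\<theta> m\<close>
    is squeezed between \<open>y j\<close> and \<open>y j + a m\<close>.\<close>
  have zj: "?z m j = y j" for m using insert.hyps by (simp add: diag_shift_def)
  have lim: "(\<lambda>m. (?z m)(j := \<theta> m)) \<longlonglongrightarrow> y"
  proof (rule tendsto_coordinatewise)
    fix i
    have 1: "(\<lambda>m. y i + a m) \<longlonglongrightarrow> y i" for i using tendsto_add[OF tendsto_const a(2), of "y i"] by simp
    have 2: "\<theta> \<longlonglongrightarrow> y j"
    proof (rule real_tendsto_sandwich[OF _ _ tendsto_const 1])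
      show "\<forall>\<^sub>F m in sequentially. y j \<le> \<theta> m" using \<theta>(1) by (auto simp: zj less_imp_le)
      show "\<forall>\<^sub>F m in sequentially. \<theta> m \<le> y j + a m" using \<theta>(2) by (auto simp: zj less_imp_le)
    qed
    show "(\<lambda>m. ((?z m)(j := \<theta> m)) i) \<longlonglongrightarrow> y i"
      using 1[of i] 2 by (cases "i = j"; cases "i \<in> J") (auto simp: diag_shift_def)
  qed
  have "(\<lambda>m. partial j g ((?z m)(j := \<theta> m))) \<longlonglongrightarrow> partial j g y"
    by (rule continuous_on_tendsto_compose[OF test_functionD(4)[OF g jK] lim y])
      (intro always_eventually allI fun_upd_in_PiE[OF z jK])
  then have "(\<lambda>m. (g (?z m) - g y) / a m + partial j g ((?z m)(j := \<theta> m)))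
      \<longlonglongrightarrow> (\<Sum>j\<in>J. partial j g y) + partial j g y"
    by (rule tendsto_add[OF insert.IH[OF JK]])
  moreover have "(g (?z m) - g y) / a m + partial j g ((?z m)(j := \<theta> m)) =
      (g (diag_shift (insert j J) (a m) y) - g y) / a m" for m
  proof -
    have "g (diag_shift (insert j J) (a m) y) = g (?z m) + a m * partial j g ((?z m)(j := \<theta> m))"
      using \<theta>(3)[of m] by (simp only: diag_shift_insert[OF insert.hyps(2)])
    then show ?thesis using a(1)[of m] by (simp add: field_simps)
  qed
  ultimately show ?case using insert.hyps by (simp add: add.commute)
qed

section \<open>Finite measures determined by boxes of upper bounds, and translation of Lebesgue
  measure\<close>

lemma atMost_boxes_generate:
  assumes "finite I"
  shows "sets (\<Pi>\<^sub>M i\<in>I. (borel :: real measure)) =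
      sigma_sets (I \<rightarrow>\<^sub>E UNIV) {\<Pi>\<^sub>E i\<in>I. {..u i} | u. True}"
proof -
  have "sets (\<Pi>\<^sub>M i\<in>I. (borel :: real measure)) = sets (\<Pi>\<^sub>M i\<in>I. sigma UNIV (range atMost :: real set set))"
    by (simp add: borel_eq_atMost[symmetric])
  also have "\<dots> = sets (sigma (\<Pi>\<^sub>E i\<in>I. UNIV)
      {{f\<in>(\<Pi>\<^sub>E i\<in>I. UNIV). \<forall>i\<in>j. f i \<in> A i} | A j. j \<in> {I} \<and> A \<in> (\<Pi> i\<in>j. range atMost)})"
  proof (rule sets_PiM_sigma)
    show "\<exists>S\<subseteq>range atMost. countable S \<and> (UNIV :: real set) = \<Union> S" if "i \<in> I" for i
    proof (intro exI[of _ "range (\<lambda>n::nat. {..real n})"] conjI)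
      show "(UNIV :: real set) = \<Union> (range (\<lambda>n::nat. {..real n}))"
        using real_arch_simple by auto
    qed auto
  qed (use assms in auto)
  also have "{{f\<in>(\<Pi>\<^sub>E i\<in>I. UNIV). \<forall>i\<in>j. f i \<in> A i} | A j. j \<in> {I} \<and> A \<in> (\<Pi> i\<in>j. range atMost)} =
      {\<Pi>\<^sub>E i\<in>I. {..u i} | u :: _ \<Rightarrow> real. True}" (is "?L = ?R")
  proof
    show "?L \<subseteq> ?R"
    proof
      fix X assume "X \<in> ?L"
      then obtain A where X: "X = {f\<in>(\<Pi>\<^sub>E i\<in>I. UNIV). \<forall>i\<in>I. f i \<in> A i}" and A: "A \<in> (\<Pi> i\<in>I. range atMost)"
        by auto
      have "\<forall>i\<in>I. \<exists>v. A i = {..v}" using A by auto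
      then obtain u where "\<forall>i\<in>I. A i = {..u i}" by metis
      then have "X = (\<Pi>\<^sub>E i\<in>I. {..u i})" unfolding X by (auto simp: PiE_def)
      then show "X \<in> ?R" by (intro CollectI exI[of _ u]) simp
    qed
    show "?R \<subseteq> ?L"
    proof
      fix X assume "X \<in> ?R"
      then obtain u :: "_ \<Rightarrow> real" where "X = (\<Pi>\<^sub>E i\<in>I. {..u i})" by auto
      then have "X = {f\<in>(\<Pi>\<^sub>E i\<in>I. UNIV). \<forall>i\<in>I. f i \<in> (\<lambda>i. {..u i}) i}" by (auto simp: PiE_def)
      then show "X \<in> ?L" by (intro CollectI exI[of _ "\<lambda>i. {..u i}"] exI[of _ I]) auto
    qed
  qed
  finally show ?thesis by (subst (asm) sets_measure_of) auto
qed

text \<open>These boxes are stable under intersection, generate the product sigma-algebra and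
  exhaust the space. For the inverse they are the joint events that each value stays below its
  bound, which the path can express.\<close>

lemma measure_eqI_PiM_atMost:
  fixes P Q :: "('i \<Rightarrow> real) measure"
  assumes I: "finite I" and P: "sets P = sets (\<Pi>\<^sub>M i\<in>I. borel)" and Q: "sets Q = sets (\<Pi>\<^sub>M i\<in>I. borel)"
    and fin: "finite_measure P"
    and eq: "\<And>u. emeasure P (\<Pi>\<^sub>E i\<in>I. {..u i}) = emeasure Q (\<Pi>\<^sub>E i\<in>I. {..u i})"
  shows "P = Q"
proof (rule measure_eqI_generator_eq[where \<Omega> = "I \<rightarrow>\<^sub>E UNIV" and E = "{\<Pi>\<^sub>E i\<in>I. {..u i} | u. True}"
      and A = "\<lambda>n. \<Pi>\<^sub>E i\<in>I. {..real n}"])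
  show "Int_stable {\<Pi>\<^sub>E i\<in>I. {..u i} | u :: 'i \<Rightarrow> real. True}"
  proof (rule Int_stableI)
    fix X Y :: "('i \<Rightarrow> real) set"
    assume "X \<in> {\<Pi>\<^sub>E i\<in>I. {..u i} | u. True}" "Y \<in> {\<Pi>\<^sub>E i\<in>I. {..u i} | u. True}"
    then obtain u v where "X = (\<Pi>\<^sub>E i\<in>I. {..u i})" "Y = (\<Pi>\<^sub>E i\<in>I. {..v i})" by blast
    then have "X \<inter> Y = (\<Pi>\<^sub>E i\<in>I. {..min (u i) (v i)})" by (auto simp: PiE_def Pi_def)
    then show "X \<inter> Y \<in> {\<Pi>\<^sub>E i\<in>I. {..u i} | u. True}"
      by (intro CollectI exI[of _ "\<lambda>i. min (u i) (v i)"]) simp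
  qed
  show "(\<Union>n. \<Pi>\<^sub>E i\<in>I. {..real n}) = I \<rightarrow>\<^sub>E UNIV"
  proof (intro equalityI subsetI)
    fix x :: "'i \<Rightarrow> real" assume x: "x \<in> I \<rightarrow>\<^sub>E UNIV"
    obtain n :: nat where n: "(\<Sum>i\<in>I. \<bar>x i\<bar>) \<le> real n" using real_arch_simple by blast
    have "x i \<le> real n" if "i \<in> I" for i
    proof -
      have "x i \<le> \<bar>x i\<bar>" by simp
      also have "\<dots> \<le> (\<Sum>i\<in>I. \<bar>x i\<bar>)" using that I by (intro member_le_sum) auto
      finally show ?thesis using n by simp
    qed
    then show "x \<in> (\<Union>n. \<Pi>\<^sub>E i\<in>I. {..real n})" using x by (auto simp: PiE_def intro!: exI[of _ n])
  qed (auto simp: PiE_def)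
  show "emeasure P (\<Pi>\<^sub>E i\<in>I. {..real n}) \<noteq> \<infinity>" for n
    using fin by (simp add: finite_measure.emeasure_finite)
  show "sets P = sigma_sets (I \<rightarrow>\<^sub>E UNIV) {\<Pi>\<^sub>E i\<in>I. {..u i} | u. True}"
    "sets Q = sigma_sets (I \<rightarrow>\<^sub>E UNIV) {\<Pi>\<^sub>E i\<in>I. {..u i} | u. True}"
    using P Q atMost_boxes_generate[OF I] by simp_all
  show "\<And>X. X \<in> {\<Pi>\<^sub>E i\<in>I. {..u i} | u. True} \<Longrightarrow> emeasure P X = emeasure Q X" using eq by blast
qed (auto simp: PiE_def)

lemma distr_lborel_translate: "distr lborel borel (\<lambda>x. x + c) = (lborel :: real measure)"
proof -
  have "(\<lambda>x. x + c) = (+) c" by (auto simp: add.commute)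
  then show ?thesis by (simp only: lborel_distr_plus)
qed

text \<open>The substitution behind the shift of all times, applied with
  \<open>c = D a \<omega>\<close> for one fixed outcome.\<close>

lemma PiM_lborel_translate:
  assumes I: "finite I"
  shows "distr (\<Pi>\<^sub>M i\<in>I. lborel) (\<Pi>\<^sub>M i\<in>I. lborel) (\<lambda>t. \<lambda>i\<in>I. t i + (c::real)) = (\<Pi>\<^sub>M i\<in>I. lborel)"
proof -
  interpret product_sigma_finite "\<lambda>_. lborel :: real measure" by standard
  show ?thesis
  proof (rule PiM_eqI[OF I])
    fix A assume A: "\<And>i. i \<in> I \<Longrightarrow> A i \<in> sets (lborel :: real measure)"
    have A': "(\<lambda>x. x + c) -` A i \<in> sets borel" if "i \<in> I" for i
      using measurable_sets[of "\<lambda>x. x + c" borel borel "A i"] A[OF that] by simp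
    have "emeasure (distr (\<Pi>\<^sub>M i\<in>I. lborel) (\<Pi>\<^sub>M i\<in>I. lborel) (\<lambda>t. \<lambda>i\<in>I. t i + c)) (Pi\<^sub>E I A)
        = emeasure (\<Pi>\<^sub>M i\<in>I. lborel) ((\<lambda>t. \<lambda>i\<in>I. t i + c) -` Pi\<^sub>E I A \<inter> space (\<Pi>\<^sub>M i\<in>I. lborel))"
      using A by (intro emeasure_distr sets_PiM_I_finite I) auto
    also have "(\<lambda>t. \<lambda>i\<in>I. t i + c) -` Pi\<^sub>E I A \<inter> space (\<Pi>\<^sub>M i\<in>I. lborel) = (\<Pi>\<^sub>E i\<in>I. (\<lambda>x. x + c) -` A i)"
      by (auto simp: space_PiM PiE_def Pi_def)
    also have "emeasure (\<Pi>\<^sub>M i\<in>I. lborel) \<dots> = (\<Prod>i\<in>I. emeasure lborel ((\<lambda>x. x + c) -` A i))"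
      using A' by (intro emeasure_PiM I) auto
    also have "\<dots> = (\<Prod>i\<in>I. emeasure lborel (A i))"
    proof (rule prod.cong[OF refl])
      fix i assume i: "i \<in> I"
      have "emeasure lborel (A i) = emeasure (distr lborel borel (\<lambda>x. x + c)) (A i)"
        by (simp only: distr_lborel_translate)
      also have "\<dots> = emeasure lborel ((\<lambda>x. x + c) -` A i)"
        using A[OF i] by (subst emeasure_distr) auto
      finally show "emeasure lborel ((\<lambda>x. x + c) -` A i) = emeasure lborel (A i)" ..
    qed
    finally show "emeasure (distr (\<Pi>\<^sub>M i\<in>I. lborel) (\<Pi>\<^sub>M i\<in>I. lborel) (\<lambda>t. \<lambda>i\<in>I. t i + c)) (Pi\<^sub>E I A)
        = (\<Prod>i\<in>I. emeasure lborel (A i))" .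
  qed simp
qed


section \<open>Inverses of strictly increasing paths\<close>

text \<open>Only path properties and measurability are collected here, so that the increment process
  after a time \<open>a\<close> is again an instance.\<close>

locale strict_process =
  fixes M :: "'a measure" and D :: "real \<Rightarrow> 'a \<Rightarrow> real"
  assumes D_measurable: "\<And>u. 0 \<le> u \<Longrightarrow> D u \<in> borel_measurable M"
    and D_strict: "\<And>\<omega>. \<omega> \<in> space M \<Longrightarrow> strict_mono_on {0..} (\<lambda>u. D u \<omega>)"
    and D_right: "\<And>\<omega> u. \<omega> \<in> space M \<Longrightarrow> 0 \<le> u \<Longrightarrow> ((\<lambda>v. D v \<omega>) \<longlongrightarrow> D u \<omega>) (at_right u)"
begin

lemma D_less: "\<omega> \<in> space M \<Longrightarrow> 0 \<le> u \<Longrightarrow> u < v \<Longrightarrow> D u \<omega> < D v \<omega>"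
  using D_strict[of \<omega>] by (auto simp: strict_mono_on_def)

lemma D_le: "\<omega> \<in> space M \<Longrightarrow> 0 \<le> u \<Longrightarrow> u \<le> v \<Longrightarrow> D u \<omega> \<le> D v \<omega>"
  using D_less[of \<omega> u v] by (cases "u = v") auto

text \<open>Right continuity turns exceeding \<open>t\<close> at all times after \<open>u\<close>
  into t \<le> D u. Conversely a strictly increasing path exceeds \<open>D u\<close>, hence
  \<open>t\<close>, immediately after \<open>u\<close>. The time \<open>v\<close> makes the set of
  crossing times nonempty.\<close>

lemma inverse_le_iff:
  assumes \<omega>: "\<omega> \<in> space M" and v: "0 < v" "t < D v \<omega>"
  shows "inverse_process D t \<omega> \<le> u \<longleftrightarrow> 0 \<le> u \<and> t \<le> D u \<omega>"
proof -
  let ?S = "{u. 0 < u \<and> t < D u \<omega>}"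
  have ne: "?S \<noteq> {}" using v by auto
  have bdd: "bdd_below ?S" by (intro bdd_belowI[of _ 0]) auto
  show ?thesis unfolding inverse_process_def
  proof
    assume le: "Inf ?S \<le> u"
    have "0 \<le> Inf ?S" using ne by (intro cInf_greatest) auto
    with le have u: "0 \<le> u" by simp
    have lt: "t < D w \<omega>" if "u < w" for w
    proof -
      have "Inf ?S < w" using le that by simp
      then obtain x where "x \<in> ?S" "x < w" using cInf_lessD[OF ne] by blast
      then show ?thesis using D_less[OF \<omega>, of x w] by auto
    qed
    have "t \<le> D u \<omega>"
    proof (rule tendsto_lowerbound[OF D_right[OF \<omega> u]])
      show "\<forall>\<^sub>F v in at_right u. t \<le> D v \<omega>"
        using lt by (auto simp: eventually_at_right_field less_imp_le intro!: exI[of _ "u + 1"])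
    qed simp
    with u show "0 \<le> u \<and> t \<le> D u \<omega>" by simp
  next
    assume u: "0 \<le> u \<and> t \<le> D u \<omega>"
    show "Inf ?S \<le> u"
    proof (rule dense_ge)
      fix w assume "u < w"
      then have "w \<in> ?S" using u D_less[OF \<omega>, of u w] by auto
      then show "Inf ?S \<le> w" using bdd by (rule cInf_lower)
    qed
  qed
qed

lemma inverse_nonneg:
  assumes "\<omega> \<in> space M" "0 < v" "t < D v \<omega>"
  shows "0 \<le> inverse_process D t \<omega>"
  using inverse_le_iff[OF assms, of "inverse_process D t \<omega>"] by simp

lemma inverse_mono:
  assumes "\<omega> \<in> space M" "0 < v" "t' < D v \<omega>" "t \<le> t'"
  shows "inverse_process D t \<omega> \<le> inverse_process D t' \<omega>"
  using inverse_le_iff[OF assms(1-3), of "inverse_process D t' \<omega>"]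
    inverse_le_iff[OF assms(1,2), of t "inverse_process D t' \<omega>"] assms by simp

text \<open>Fubini in time and outcome relies on this. Where the path exceeds \<open>t\<close>
  somewhere, the event that the inverse is at most \<open>c\<close> is read off from the path at the
  single time \<open>c\<close>; elsewhere the inverse has the constant value
  \<open>Inf {}\<close>.\<close>

lemma inverse_measurable_pair:
  "(\<lambda>(t, \<omega>). inverse_process D t \<omega>) \<in> borel_measurable (borel \<Otimes>\<^sub>M M)"
proof (subst borel_measurable_iff_le, rule allI)
  fix c :: real
  let ?N = "borel \<Otimes>\<^sub>M M :: (real \<times> 'a) measure"
  have m[measurable]: "(\<lambda>p. D u (snd p)) \<in> borel_measurable ?N" if "0 \<le> u" for u
    using D_measurable[OF that] by measurable
  have m1[measurable]: "(\<lambda>p. D (real (Suc m)) (snd p)) \<in> borel_measurable ?N" for m by (rule m) simp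
  \<comment> \<open>Positive integer times suffice because paths increase, and they make this a
    countable union.\<close>
  define G where "G = {p \<in> space ?N. \<exists>m. fst p < D (real (Suc m)) (snd p)}"
  have G[measurable]: "G \<in> sets ?N" unfolding G_def by measurable
  have on_G: "inverse_process D (fst p) (snd p) \<le> c \<longleftrightarrow> 0 \<le> c \<and> fst p \<le> D c (snd p)" if "p \<in> G" for p
  proof -
    from that obtain m where "fst p < D (real (Suc m)) (snd p)" and "snd p \<in> space M"
      by (auto simp: G_def space_pair_measure)
    then show ?thesis by (intro inverse_le_iff[where v = "real (Suc m)"]) auto
  qed
  have off_G: "inverse_process D (fst p) (snd p) = Inf {}" if p: "p \<in> space ?N" "p \<notin> G" for p
  proof -
    have "\<not> (fst p < D u (snd p))" if "0 < u" for u
    proof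
      assume lt: "fst p < D u (snd p)"
      obtain m where "u \<le> real m" using real_arch_simple by blast
      then have "D u (snd p) \<le> D (real (Suc m)) (snd p)"
        using p(1) that by (intro D_le) (auto simp: space_pair_measure)
      moreover have "\<not> fst p < D (real (Suc m)) (snd p)" using p by (auto simp: G_def simp del: of_nat_Suc)
      ultimately show False using lt by linarith
    qed
    then have "{u. 0 < u \<and> fst p < D u (snd p)} = {}" by auto
    then show ?thesis unfolding inverse_process_def by (rule arg_cong)
  qed
  have "{p \<in> space ?N. (case p of (t, \<omega>) \<Rightarrow> inverse_process D t \<omega>) \<le> c} =
      {p \<in> G. 0 \<le> c \<and> fst p \<le> D c (snd p)} \<union> {p \<in> space ?N. p \<notin> G \<and> Inf {} \<le> c}"
  proof (rule set_eqI)
    fix p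
    show "p \<in> {p \<in> space ?N. (case p of (t, \<omega>) \<Rightarrow> inverse_process D t \<omega>) \<le> c} \<longleftrightarrow>
        p \<in> {p \<in> G. 0 \<le> c \<and> fst p \<le> D c (snd p)} \<union> {p \<in> space ?N. p \<notin> G \<and> Inf {} \<le> c}"
      using on_G[of p] off_G[of p] sets.sets_into_space[OF G] by (cases "p \<in> G") (auto simp: split_beta)
  qed
  also have "\<dots> \<in> sets ?N"
  proof (rule sets.Un)
    show "{p \<in> G. 0 \<le> c \<and> fst p \<le> D c (snd p)} \<in> sets ?N"
    proof (cases "0 \<le> c")
      case True
      note m[OF True, measurable]
      have "{p \<in> G. 0 \<le> c \<and> fst p \<le> D c (snd p)} = G \<inter> {p \<in> space ?N. fst p \<le> D c (snd p)}"
        using True sets.sets_into_space[OF G] by auto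
      also have "\<dots> \<in> sets ?N" by measurable
      finally show ?thesis .
    qed simp
    show "{p \<in> space ?N. p \<notin> G \<and> Inf {} \<le> c} \<in> sets ?N" by measurable
  qed
  finally show "{p \<in> space ?N. (case p of (t, \<omega>) \<Rightarrow> inverse_process D t \<omega>) \<le> c} \<in> sets ?N" .
qed

lemma inverse_measurable: "inverse_process D t \<in> borel_measurable M"
  using measurable_compose[OF measurable_Pair1' inverse_measurable_pair, of t] by simp

lemma strict_process_shift:
  assumes a: "0 \<le> a"
  shows "strict_process M (\<lambda>u \<omega>. D (a + u) \<omega> - D a \<omega>)"
proof
  show "(\<lambda>\<omega>. D (a + u) \<omega> - D a \<omega>) \<in> borel_measurable M" if "0 \<le> u" for u
    using that a by (intro borel_measurable_diff D_measurable) auto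
  show "strict_mono_on {0..} (\<lambda>u. D (a + u) \<omega> - D a \<omega>)" if "\<omega> \<in> space M" for \<omega>
    using D_less[OF that] a by (auto simp: strict_mono_on_def)
  show "((\<lambda>v. D (a + v) \<omega> - D a \<omega>) \<longlongrightarrow> D (a + u) \<omega> - D a \<omega>) (at_right u)"
    if "\<omega> \<in> space M" "0 \<le> u" for \<omega> u
  proof (intro tendsto_diff tendsto_const)
    have "filterlim (\<lambda>v. a + v) (at_right (a + u)) (at_right u)"
      unfolding filterlim_at
      by (auto simp: eventually_at_right_field intro!: exI[of _ "u + 1"] tendsto_intros)
    then show "((\<lambda>v. D (a + v) \<omega>) \<longlongrightarrow> D (a + u) \<omega>) (at_right u)"
      using D_right[OF that(1), of "a + u"] a that by (auto intro: filterlim_compose)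
  qed
qed

text \<open>Both sides have the same upper bounds \<open>u\<close>, by the description of such
  bounds through the path. As t > 0, the level t + D a is not reached before time \<open>a\<close>,
  so nothing that happens earlier matters.\<close>

lemma inverse_shift:
  assumes \<omega>: "\<omega> \<in> space M" and a: "0 \<le> a" and t: "0 < t" and v: "0 < v" "t < D (a + v) \<omega> - D a \<omega>"
  shows "inverse_process D (t + D a \<omega>) \<omega> = a + inverse_process (\<lambda>u \<omega>. D (a + u) \<omega> - D a \<omega>) t \<omega>"
proof -
  interpret S: strict_process M "\<lambda>u \<omega>. D (a + u) \<omega> - D a \<omega>" by (rule strict_process_shift[OF a])
  let ?E = "inverse_process D (t + D a \<omega>) \<omega>" and ?E' = "inverse_process (\<lambda>u \<omega>. D (a + u) \<omega> - D a \<omega>) t \<omega>"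
  have 1: "?E \<le> u \<longleftrightarrow> 0 \<le> u \<and> t + D a \<omega> \<le> D u \<omega>" for u
    using v a by (intro inverse_le_iff[OF \<omega>, of "a + v"]) auto
  have 2: "?E' \<le> u \<longleftrightarrow> 0 \<le> u \<and> t \<le> D (a + u) \<omega> - D a \<omega>" for u
    by (rule S.inverse_le_iff[OF \<omega> v])
  have "?E \<le> u \<longleftrightarrow> a + ?E' \<le> u" for u
  proof -
    have "a \<le> u" if "0 \<le> u" "t + D a \<omega> \<le> D u \<omega>"
      using D_le[OF \<omega>, of u a] that t by linarith
    then show ?thesis using 1[of u] 2[of "u - a"] a by (auto simp: algebra_simps)
  qed
  \<comment> \<open>Inserting each of the two values for \<open>u\<close> gives the two
    inequalities.\<close>
  from this[of ?E] this[of "a + ?E'"] show ?thesis by simp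
qed

end

section \<open>Joint events of the inverse at ordered times\<close>

lemma strict_times_pos_mono:
  assumes t: "t \<in> strict_times n" and i: "1 \<le> i" "i \<le> j" "j \<le> n"
  shows "t i \<le> t j" "0 < t i"
proof -
  have step: "t k < t (Suc k)" if "1 \<le> k" "k < n" for k
    using t that unfolding strict_times_def by auto
  have mono: "t i \<le> t j" if "1 \<le> i" "i \<le> j" "j \<le> n" for i j
    using that(2,1,3)
  proof (induction rule: dec_induct)
    case (step k)
    then show ?case using \<open>\<And>k. 1 \<le> k \<Longrightarrow> k < n \<Longrightarrow> t k < t (Suc k)\<close>[of k] by force
  qed simp
  show "t i \<le> t j" using mono i by blast
  have "0 < t 1" using t by (simp add: strict_times_def)
  also have "t 1 \<le> t i" using i by (intro mono) auto
  finally show "0 < t i" .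
qed

text \<open>As the inverse is monotone in time, the upper bounds \<open>u\<close> on its values may be replaced by the
  nondecreasing \<open>tail_min n u\<close>, along which the increments of the process are independent.\<close>

definition tail_min :: "nat \<Rightarrow> (nat \<Rightarrow> real) \<Rightarrow> nat \<Rightarrow> real" where
  "tail_min n u i = (if i = 0 then 0 else Min (u ` {i..n}))"

lemma tail_min_props:
  assumes u: "\<And>i. i \<in> {1..n} \<Longrightarrow> 0 \<le> u i"
  shows "i \<in> {1..n} \<Longrightarrow> tail_min n u i \<le> u i" "i \<le> n \<Longrightarrow> 0 \<le> tail_min n u i"
    "i < n \<Longrightarrow> tail_min n u i \<le> tail_min n u (Suc i)"
proof -
  show "tail_min n u i \<le> u i" if "i \<in> {1..n}"
    using that by (auto simp: tail_min_def)
  show nn: "0 \<le> tail_min n u i" if "i \<le> n" for i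
    using that u by (auto simp: tail_min_def)
  show "tail_min n u i \<le> tail_min n u (Suc i)" if "i < n"
  proof (cases "i = 0")
    case True
    then show ?thesis using nn[of "Suc i"] that by (simp add: tail_min_def)
  next
    case False
    then show ?thesis using that by (auto simp: tail_min_def intro!: Min_antimono)
  qed
qed

context strict_process
begin

lemma inverse_box_iff:
  assumes t: "t \<in> strict_times n" and u: "\<And>i. i \<in> {1..n} \<Longrightarrow> 0 \<le> u i"
    and \<omega>: "\<omega> \<in> space M" and ub: "\<And>t. \<exists>v>0. t < D v \<omega>"
  shows "(\<forall>i\<in>{1..n}. inverse_process D (t i) \<omega> \<le> u i) \<longleftrightarrow> (\<forall>i\<in>{1..n}. t i \<le> D (tail_min n u i) \<omega>)"
proof -
  have iff: "inverse_process D r \<omega> \<le> c \<longleftrightarrow> 0 \<le> c \<and> r \<le> D c \<omega>" for r c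
    using ub[of r] inverse_le_iff[OF \<omega>] by blast
  have mono: "inverse_process D r \<omega> \<le> inverse_process D r' \<omega>" if "r \<le> r'" for r r'
    using ub[of r'] inverse_mono[OF \<omega> _ _ that] by blast
  show ?thesis
  proof (intro iffI ballI)
    fix i assume le: "\<forall>i\<in>{1..n}. inverse_process D (t i) \<omega> \<le> u i" and i: "i \<in> {1..n}"
    have "inverse_process D (t i) \<omega> \<le> u j" if "j \<in> {i..n}" for j
    proof -
      have "inverse_process D (t i) \<omega> \<le> inverse_process D (t j) \<omega>"
        using i that by (intro mono strict_times_pos_mono(1)[OF t]) auto
      also have "\<dots> \<le> u j" using le i that by auto
      finally show ?thesis .
    qed
    then have "inverse_process D (t i) \<omega> \<le> tail_min n u i"
      using i by (auto simp: tail_min_def)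
    then show "t i \<le> D (tail_min n u i) \<omega>" by (simp add: iff)
  next
    fix i assume le: "\<forall>i\<in>{1..n}. t i \<le> D (tail_min n u i) \<omega>" and i: "i \<in> {1..n}"
    moreover have "0 \<le> tail_min n u i" by (rule tail_min_props(2)[OF u]) (use i in auto)
    ultimately have "inverse_process D (t i) \<omega> \<le> tail_min n u i" using i by (simp add: iff)
    also have "\<dots> \<le> u i" by (rule tail_min_props(1)[OF u i])
    finally show "inverse_process D (t i) \<omega> \<le> u i" .
  qed
qed

end


section \<open>The Markov property of the inverse\<close>

text \<open>For y > 0 the quantity 1 - exp (- s y) is at most s y and at most 1. Both bounds are
  covered by max 1 s times min y 1, which has finite integral.\<close>

lemma levy_measure_integrable:
  assumes K2: "levy_measure K2" and s: "0 < s"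
  shows "AE y in K2. 0 < y" "integrable K2 (\<lambda>y. exp (- s * y) - 1)"
proof -
  have sets[measurable_cong]: "sets K2 = sets borel" using K2 by (simp add: levy_measure_def)
  have "{..0::real} = {..<0} \<union> {0}" by auto
  moreover have "{..<0::real} \<in> null_sets K2" "{0::real} \<in> null_sets K2"
    using K2 by (auto simp: levy_measure_def null_sets_def)
  ultimately have "{..0::real} \<in> null_sets K2" by (metis null_sets.Un)
  then show pos: "AE y in K2. 0 < y"
    by (rule AE_I') (auto simp: not_less)
  have "integrable K2 (\<lambda>y. min y 1)"
  proof (rule integrableI_nonneg)
    show "AE y in K2. 0 \<le> min y 1" using pos by eventually_elim simp
    show "(\<integral>\<^sup>+y. ennreal (min y 1) \<partial>K2) < \<infinity>" using K2 by (simp add: levy_measure_def)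
  qed measurable
  then have "integrable K2 (\<lambda>y. max 1 s * min y 1)" by (rule integrable_mult_right)
  then show "integrable K2 (\<lambda>y. exp (- s * y) - 1)"
  proof (rule Bochner_Integration.integrable_bound)
    show "AE y in K2. norm (exp (- s * y) - 1) \<le> norm (max 1 s * min y 1)"
      using pos
    proof eventually_elim
      case (elim y)
      have e: "exp (- s * y) \<le> 1" using elim s by simp
      have "1 - exp (- s * y) \<le> s * y" using exp_ge_add_one_self[of "- s * y"] by simp
      also have "\<dots> \<le> max 1 s * y" using elim by (intro mult_right_mono) auto
      finally have 1: "1 - exp (- s * y) \<le> max 1 s * y" .
      have "1 - exp (- s * y) \<le> 1" by simp
      also have "\<dots> \<le> max 1 s * 1" by simp
      finally have "1 - exp (- s * y) \<le> max 1 s * min y 1" using 1 by (simp add: min_def)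
      moreover have "0 \<le> max 1 s * min y 1" using elim by (intro mult_nonneg_nonneg) auto
      ultimately show ?case using e by (simp only: real_norm_def abs_of_nonneg)
    qed
  qed measurable
qed

text \<open>The integrand is strictly negative almost everywhere, so a zero integral would make
  \<open>K2\<close> the null measure, against its infinite mass. This sign drives the paths to
  infinity.\<close>

lemma laplace_exponent_neg:
  assumes K2: "levy_measure K2" and s: "0 < s"
  shows "laplace_exponent K2 s < 0"
proof -
  note pos = levy_measure_integrable(1)[OF K2 s]
  have int: "integrable K2 (\<lambda>y. 1 - exp (- s * y))"
    using integrable_minus[OF levy_measure_integrable(2)[OF K2 s]] by simp
  have nonneg: "AE y in K2. 0 \<le> 1 - exp (- s * y)"
    using pos by eventually_elim (use s in simp)
  have "(LINT y|K2. 1 - exp (- s * y)) \<noteq> 0"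
  proof
    assume "(LINT y|K2. 1 - exp (- s * y)) = 0"
    then have "AE y in K2. 1 - exp (- s * y) = 0"
      using integral_nonneg_eq_0_iff_AE[OF int nonneg] by simp
    with pos have "AE y in K2. False"
      by eventually_elim (use s in auto)
    then have "AE y in K2. y \<notin> space K2" by eventually_elim simp
    then have "emeasure K2 (space K2) = 0"
      using AE_iff_null_sets[of "space K2" K2] by (auto simp: null_sets_def)
    moreover have "space K2 = UNIV" using K2 sets_eq_imp_space_eq[of K2 borel] by (simp add: levy_measure_def)
    ultimately show False using K2 by (simp add: levy_measure_def)
  qed
  moreover have "0 \<le> (LINT y|K2. 1 - exp (- s * y))" using nonneg by (rule integral_nonneg_AE)
  moreover have "laplace_exponent K2 s = - (LINT y|K2. 1 - exp (- s * y))"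
    unfolding laplace_exponent_def by (subst integral_minus[symmetric]) simp
  ultimately show ?thesis by simp
qed

text \<open>The Levy measure is represented by its exponent, kept as an abstract
  \<open>\<phi>\<close> whose negativity makes almost all paths unbounded.\<close>

locale inverse_subordinator = prob_space M + strict_process M D
  for M :: "'a measure" and D :: "real \<Rightarrow> 'a \<Rightarrow> real" +
  fixes \<phi> :: "real \<Rightarrow> real"
  assumes D_0: "\<And>\<omega>. \<omega> \<in> space M \<Longrightarrow> D 0 \<omega> = 0"
    and D_indep: "\<And>m u. 0 \<le> u 0 \<Longrightarrow> (\<And>i. i < m \<Longrightarrow> u i \<le> u (Suc i)) \<Longrightarrow>
        indep_vars (\<lambda>_. borel) (\<lambda>i \<omega>. D (u (Suc i)) \<omega> - D (u i) \<omega>) {..<(m::nat)}"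
    and D_stationary: "\<And>u v. 0 \<le> u \<Longrightarrow> 0 \<le> v \<Longrightarrow>
        distr M borel (\<lambda>\<omega>. D (u + v) \<omega> - D u \<omega>) = distr M borel (D v)"
    and D_laplace: "\<And>u s. 0 \<le> u \<Longrightarrow> 0 \<le> s \<Longrightarrow> expectation (\<lambda>\<omega>. exp (- s * D u \<omega>)) = exp (u * \<phi> s)"
    and phi_neg: "\<And>s. 0 < s \<Longrightarrow> \<phi> s < 0"
begin

lemma D_nonneg: "\<omega> \<in> space M \<Longrightarrow> 0 \<le> u \<Longrightarrow> 0 \<le> D u \<omega>"
  using D_le[of \<omega> 0 u] D_0[of \<omega>] by simp

lemma exp_D_integrable:
  assumes "0 \<le> u" "0 \<le> s"
  shows "integrable M (\<lambda>\<omega>. exp (- s * D u \<omega>))"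
proof (rule integrable_const_bound[of _ 1])
  note D_measurable[OF assms(1), measurable]
  show "(\<lambda>\<omega>. exp (- s * D u \<omega>)) \<in> borel_measurable M" by measurable
  show "AE \<omega> in M. norm (exp (- s * D u \<omega>)) \<le> 1"
    using D_nonneg assms by (intro AE_I2) simp
qed

text \<open>On the event that the path stays below N at all integer times, exp (- D m) \<ge> exp (-
  N) for every m, whereas the expectation exp (m \<phi> 1) of the left side tends to 0. Off this
  null event the inverse at every time is the infimum of a nonempty set.\<close>

lemma AE_unbounded: "AE \<omega> in M. \<forall>t. \<exists>v>0. t < D v \<omega>"
proof -
  have [measurable]: "D (real m) \<in> borel_measurable M" for m by (rule D_measurable) simp
  define A where "A N = {\<omega> \<in> space M. \<forall>m::nat. D (real m) \<omega> \<le> real N}" for N :: nat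
  have A[measurable]: "A N \<in> sets M" for N unfolding A_def by measurable
  have "prob (A N) = 0" for N
  proof -
    have le: "exp (- real N) * prob (A N) \<le> exp (\<phi> 1) ^ m" for m
    proof -
      have "exp (- real N) * prob (A N) = expectation (\<lambda>\<omega>. exp (- real N) * indicator (A N) \<omega>)"
        by simp
      also have "\<dots> \<le> expectation (\<lambda>\<omega>. exp (- 1 * D (real m) \<omega>))"
      proof (rule integral_mono)
        show "integrable M (\<lambda>\<omega>. exp (- 1 * D (real m) \<omega>))" by (rule exp_D_integrable) auto
        show "exp (- real N) * indicator (A N) \<omega> \<le> exp (- 1 * D (real m) \<omega>)" if "\<omega> \<in> space M" for \<omega>
          by (auto simp: A_def indicator_def)
      qed (simp add: A less_top[symmetric])
      also have "\<dots> = exp (real m * \<phi> 1)" by (rule D_laplace) auto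
      also have "\<dots> = exp (\<phi> 1) ^ m" by (rule exp_of_nat_mult)
      finally show ?thesis .
    qed
    have "(\<lambda>m. exp (\<phi> 1) ^ m) \<longlonglongrightarrow> 0"
      using phi_neg[of 1] by (intro LIMSEQ_realpow_zero) auto
    then have "exp (- real N) * prob (A N) \<le> 0"
      using le by (intro LIMSEQ_le_const[of "\<lambda>m. exp (\<phi> 1) ^ m"]) auto
    then show ?thesis by (simp add: mult_le_0_iff measure_le_0_iff)
  qed
  then have "AE \<omega> in M. \<forall>N. \<omega> \<notin> A N"
    unfolding AE_all_countable by (intro allI AE_not_in) (auto simp: null_sets_def emeasure_eq_measure)
  then show ?thesis
  proof (rule AE_mp, intro AE_I2 impI allI)
    fix \<omega> t assume \<omega>: "\<omega> \<in> space M" and no: "\<forall>N. \<omega> \<notin> A N"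
    obtain N :: nat where "t \<le> real N" using real_arch_simple by blast
    moreover have "\<not> (\<forall>m::nat. D (real m) \<omega> \<le> real N)" using no \<omega> by (auto simp: A_def)
    ultimately obtain m :: nat where m: "t < D (real m) \<omega>" by (meson leI order_trans)
    also have "D (real m) \<omega> \<le> D (real (Suc m)) \<omega>" using \<omega> by (intro D_le) auto
    finally show "\<exists>v>0. t < D v \<omega>" by (intro exI[of _ "real (Suc m)"]) auto
  qed
qed

text \<open>Placing 0 before the times a + w 0, a + w 1, ... makes \<open>D a\<close> the first
  increment, independent of the later ones. By stationarity these have the law of the increments
  over the unshifted times.\<close>

lemma increments_law:
  fixes n :: nat
  assumes a: "0 \<le> a" and s: "0 \<le> s" and w: "w 0 = 0" "\<And>i. i < n \<Longrightarrow> w i \<le> w (Suc i)"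
    and n: "0 < n" and A[measurable]: "A \<in> sets (\<Pi>\<^sub>M i\<in>{..<n}. (borel :: real measure))"
  shows "expectation (\<lambda>\<omega>. exp (- s * D a \<omega>) *
      indicator A (\<lambda>i\<in>{..<n}. D (a + w (Suc i)) \<omega> - D (a + w i) \<omega>)) =
    exp (a * \<phi> s) * expectation (\<lambda>\<omega>. indicator A (\<lambda>i\<in>{..<n}. D (w (Suc i)) \<omega> - D (w i) \<omega>))"
proof -
  have w0: "0 \<le> w i" if "i \<le> n" for i
    using that by (induction i) (use w in \<open>auto intro: order_trans\<close>)
  \<comment> \<open>As \<open>w 0 = 0\<close>, the increment \<open>X 0\<close> is
    \<open>D a\<close>, and \<open>X (Suc i)\<close> is \<open>Z i\<close>.\<close>
  define u where "u i = (case i of 0 \<Rightarrow> 0 | Suc k \<Rightarrow> a + w k)" for i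
  define X where "X i \<omega> = D (u (Suc i)) \<omega> - D (u i) \<omega>" for i \<omega>
  define Z where "Z i \<omega> = D (a + w (Suc i)) \<omega> - D (a + w i) \<omega>" for i \<omega>
  define Y where "Y i \<omega> = D (w (Suc i)) \<omega> - D (w i) \<omega>" for i \<omega>
  let ?Pi = "\<Pi>\<^sub>M i\<in>{..<n}. (borel :: real measure)"
  have Zm: "Z i \<in> borel_measurable M" and Ym: "Y i \<in> borel_measurable M" if "i < n" for i
    unfolding Z_def Y_def using that a w0 by (auto intro!: borel_measurable_diff D_measurable)
  have indX: "indep_vars (\<lambda>_. borel) X {..<Suc n}"
    unfolding X_def
  proof (rule D_indep)
    show "u i \<le> u (Suc i)" if "i < Suc n" for i
      using that a w w0 by (cases i) (auto simp: u_def)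
  qed (simp add: u_def)
  have "indep_var (\<Pi>\<^sub>M i\<in>{0}. borel) (\<lambda>\<omega>. \<lambda>i\<in>{0}. X i \<omega>) (\<Pi>\<^sub>M i\<in>{1..n}. borel) (\<lambda>\<omega>. \<lambda>i\<in>{1..n}. X i \<omega>)"
    by (rule indep_var_restrict[OF indX]) auto
  then have "indep_var borel ((\<lambda>x. exp (- s * x 0)) \<circ> (\<lambda>\<omega>. \<lambda>i\<in>{0}. X i \<omega>))
      borel ((\<lambda>z. indicator A (\<lambda>i\<in>{..<n}. z (Suc i))) \<circ> (\<lambda>\<omega>. \<lambda>i\<in>{1..n}. X i \<omega>) :: _ \<Rightarrow> real)"
  proof (rule indep_var_compose)
    show "(\<lambda>x. exp (- s * x 0)) \<in> borel_measurable (\<Pi>\<^sub>M i\<in>{0::nat}. (borel :: real measure))"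
      by measurable
    have "(\<lambda>z. \<lambda>i\<in>{..<n}. z (Suc i)) \<in> measurable (\<Pi>\<^sub>M i\<in>{1..n}. (borel :: real measure)) ?Pi"
      by (rule measurable_restrict) (rule measurable_component_singleton, auto)
    then show "(\<lambda>z. indicator A (\<lambda>i\<in>{..<n}. z (Suc i)) :: real) \<in> borel_measurable (\<Pi>\<^sub>M i\<in>{1..n}. (borel :: real measure))"
      by (rule measurable_compose[OF _ borel_measurable_indicator[OF A]])
  qed
  moreover have "(\<lambda>i\<in>{..<n}. (\<lambda>i\<in>{1..n}. X i \<omega>) (Suc i)) = (\<lambda>i\<in>{..<n}. Z i \<omega>)" for \<omega>
    by (auto simp: X_def Z_def u_def fun_eq_iff)
  ultimately have ind: "indep_var borel (\<lambda>\<omega>. exp (- s * X 0 \<omega>)) borel (\<lambda>\<omega>. indicator A (\<lambda>i\<in>{..<n}. Z i \<omega>) :: real)"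
    by (simp add: comp_def)
  have X0: "X 0 \<omega> = D a \<omega>" if "\<omega> \<in> space M" for \<omega>
    using that w by (simp add: X_def u_def D_0)
  have Zr: "(\<lambda>\<omega>. \<lambda>i\<in>{..<n}. Z i \<omega>) \<in> measurable M ?Pi" and Yr: "(\<lambda>\<omega>. \<lambda>i\<in>{..<n}. Y i \<omega>) \<in> measurable M ?Pi"
    using Zm Ym by (auto intro: measurable_restrict)
  have int1: "integrable M (\<lambda>\<omega>. exp (- s * X 0 \<omega>))"
    using exp_D_integrable[OF a s] by (rule Bochner_Integration.integrable_cong[THEN iffD1, rotated -1]) (simp_all add: X0)
  have int2: "integrable M (\<lambda>\<omega>. indicator A (\<lambda>i\<in>{..<n}. Z i \<omega>) :: real)"
    using measurable_compose[OF Zr borel_measurable_indicator[OF A]]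
    by (intro integrable_const_bound[of _ 1]) (auto simp: indicator_def)
  have "expectation (\<lambda>\<omega>. exp (- s * D a \<omega>) * indicator A (\<lambda>i\<in>{..<n}. Z i \<omega>)) =
      expectation (\<lambda>\<omega>. exp (- s * X 0 \<omega>) * indicator A (\<lambda>i\<in>{..<n}. Z i \<omega>))"
    by (rule Bochner_Integration.integral_cong) (simp_all only: X0)
  also have "\<dots> = expectation (\<lambda>\<omega>. exp (- s * X 0 \<omega>)) * expectation (\<lambda>\<omega>. indicator A (\<lambda>i\<in>{..<n}. Z i \<omega>))"
    by (rule indep_var_lebesgue_integral[OF ind int1 int2])
  also have "expectation (\<lambda>\<omega>. exp (- s * X 0 \<omega>)) = expectation (\<lambda>\<omega>. exp (- s * D a \<omega>))"
    by (rule Bochner_Integration.integral_cong) (simp_all only: X0)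
  also have "\<dots> = exp (a * \<phi> s)" by (rule D_laplace[OF a s])
  also have "expectation (\<lambda>\<omega>. indicator A (\<lambda>i\<in>{..<n}. Z i \<omega>) :: real) =
      expectation (\<lambda>\<omega>. indicator A (\<lambda>i\<in>{..<n}. Y i \<omega>))"
  proof -
    \<comment> \<open>Independence is expressed through product laws over a nonempty index set, so
      that only the one-dimensional marginals remain to be compared.\<close>
    have ne: "{..<n} \<noteq> {}" using n by auto
    have "indep_vars (\<lambda>_. borel) Z {..<n}"
      unfolding Z_def using D_indep[of "\<lambda>i. a + w i" n] w a by auto
    then have 1: "distr M ?Pi (\<lambda>\<omega>. \<lambda>i\<in>{..<n}. Z i \<omega>) = (\<Pi>\<^sub>M i\<in>{..<n}. distr M borel (Z i))"
      using Zm by (subst (asm) indep_vars_iff_distr_eq_PiM'[OF ne]) auto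
    have "indep_vars (\<lambda>_. borel) Y {..<n}"
      unfolding Y_def using D_indep[of w n] w by auto
    then have 2: "distr M ?Pi (\<lambda>\<omega>. \<lambda>i\<in>{..<n}. Y i \<omega>) = (\<Pi>\<^sub>M i\<in>{..<n}. distr M borel (Y i))"
      using Ym by (subst (asm) indep_vars_iff_distr_eq_PiM'[OF ne]) auto
    have "distr M borel (Z i) = distr M borel (Y i)" if "i < n" for i
    proof -
      have d: "0 \<le> w (Suc i) - w i" using w(2)[OF that] by simp
      have "Z i = (\<lambda>\<omega>. D ((a + w i) + (w (Suc i) - w i)) \<omega> - D (a + w i) \<omega>)" by (simp add: Z_def fun_eq_iff)
      then have "distr M borel (Z i) = distr M borel (D (w (Suc i) - w i))"
        using D_stationary[OF _ d, of "a + w i"] a w0[of i] that by simp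
      moreover have "Y i = (\<lambda>\<omega>. D (w i + (w (Suc i) - w i)) \<omega> - D (w i) \<omega>)" by (simp add: Y_def fun_eq_iff)
      then have "distr M borel (Y i) = distr M borel (D (w (Suc i) - w i))"
        using D_stationary[OF _ d, of "w i"] w0[of i] that by simp
      ultimately show ?thesis by simp
    qed
    then have "distr M ?Pi (\<lambda>\<omega>. \<lambda>i\<in>{..<n}. Z i \<omega>) = distr M ?Pi (\<lambda>\<omega>. \<lambda>i\<in>{..<n}. Y i \<omega>)"
      unfolding 1 2 by (intro PiM_cong) auto
    then have "(LINT z|distr M ?Pi (\<lambda>\<omega>. \<lambda>i\<in>{..<n}. Z i \<omega>). indicator A z :: real) =
        (LINT z|distr M ?Pi (\<lambda>\<omega>. \<lambda>i\<in>{..<n}. Y i \<omega>). indicator A z)"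
      by (rule arg_cong)
    then show ?thesis
      by (simp only: integral_distr[OF Zr borel_measurable_indicator[OF A]] integral_distr[OF Yr borel_measurable_indicator[OF A]])
  qed
  finally show ?thesis unfolding Z_def Y_def .
qed

definition inverse_vec :: "nat \<Rightarrow> (nat \<Rightarrow> real) \<Rightarrow> 'a \<Rightarrow> nat \<Rightarrow> real" where
  "inverse_vec n t \<omega> = (\<lambda>i\<in>{1..n}. inverse_process D (t i) \<omega>)"

definition shifted_vec :: "real \<Rightarrow> nat \<Rightarrow> (nat \<Rightarrow> real) \<Rightarrow> 'a \<Rightarrow> nat \<Rightarrow> real" where
  "shifted_vec a n t \<omega> = (\<lambda>i\<in>{1..n}. inverse_process (\<lambda>u \<omega>. D (a + u) \<omega> - D a \<omega>) (t i) \<omega>)"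

lemma inverse_vec_measurable: "inverse_vec n t \<in> measurable M (\<Pi>\<^sub>M i\<in>{1..n}. borel)"
  unfolding inverse_vec_def[abs_def] by (rule measurable_restrict) (rule inverse_measurable)

lemma shifted_vec_measurable:
  "0 \<le> a \<Longrightarrow> shifted_vec a n t \<in> measurable M (\<Pi>\<^sub>M i\<in>{1..n}. borel)"
  unfolding shifted_vec_def[abs_def]
  by (rule measurable_restrict) (rule strict_process.inverse_measurable[OF strict_process_shift])

lemma shifted_unbounded:
  assumes "\<forall>t. \<exists>v>0. t < D v \<omega>" "0 \<le> a" "\<omega> \<in> space M"
  shows "\<exists>v>0. t < D (a + v) \<omega> - D a \<omega>"
proof -
  obtain v where v: "v > 0" "t + D a \<omega> < D v \<omega>" using assms(1) by blast
  moreover have "D v \<omega> \<le> D (a + v) \<omega>" using v assms by (intro D_le) auto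
  ultimately show ?thesis by (intro exI[of _ v]) auto
qed

text \<open>For nonnegative bounds both box events are the same condition \<open>A\<close> on
  increments of the path, taken over the times \<open>tail_min n u\<close> counted from
  \<open>a\<close> and from 0 respectively; the law of the increments then decides. If some bound is
  negative, both sides vanish because inverses are almost surely nonnegative.\<close>

lemma shifted_box_prob:
  assumes n: "1 \<le> n" and t: "t \<in> strict_times n" and a: "0 \<le> a" and s: "0 \<le> s"
  shows "expectation (\<lambda>\<omega>. exp (- s * D a \<omega>) * indicator (\<Pi>\<^sub>E i\<in>{1..n}. {..u i}) (shifted_vec a n t \<omega>)) =
    exp (a * \<phi> s) * expectation (\<lambda>\<omega>. indicator (\<Pi>\<^sub>E i\<in>{1..n}. {..u i}) (inverse_vec n t \<omega>))"
proof -
  interpret S: strict_process M "\<lambda>u \<omega>. D (a + u) \<omega> - D a \<omega>" by (rule strict_process_shift[OF a])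
  let ?B = "\<Pi>\<^sub>E i\<in>{1..n}. {..u i}"
  have inB: "inverse_vec n t \<omega> \<in> ?B \<longleftrightarrow> (\<forall>i\<in>{1..n}. inverse_process D (t i) \<omega> \<le> u i)"
    "shifted_vec a n t \<omega> \<in> ?B \<longleftrightarrow>
      (\<forall>i\<in>{1..n}. inverse_process (\<lambda>u \<omega>. D (a + u) \<omega> - D a \<omega>) (t i) \<omega> \<le> u i)" for \<omega>
    by (auto simp: inverse_vec_def shifted_vec_def PiE_iff)
  show ?thesis
  proof (cases "\<forall>i\<in>{1..n}. 0 \<le> u i")
    case False
    then obtain i where i: "i \<in> {1..n}" "u i < 0" by force
    have "AE \<omega> in M. exp (- s * D a \<omega>) * indicator ?B (shifted_vec a n t \<omega>) = 0"
      using AE_unbounded AE_space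
    proof eventually_elim
      case (elim \<omega>)
      obtain v where "v > 0" "t i < D (a + v) \<omega> - D a \<omega>" using shifted_unbounded[OF elim(1) a elim(2)] by blast
      from S.inverse_nonneg[OF elim(2) this] i have "shifted_vec a n t \<omega> \<notin> ?B"
        unfolding inB(2) by (meson not_le order_trans)
      then show ?case by simp
    qed
    moreover have "AE \<omega> in M. indicator ?B (inverse_vec n t \<omega>) = (0 :: real)"
      using AE_unbounded AE_space
    proof eventually_elim
      case (elim \<omega>)
      obtain v where "v > 0" "t i < D v \<omega>" using elim(1) by blast
      from inverse_nonneg[OF elim(2) this] i have "inverse_vec n t \<omega> \<notin> ?B"
        unfolding inB(1) by (meson not_le order_trans)
      then show ?case by simp
    qed
    ultimately show ?thesis by (simp add: integral_eq_zero_AE)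
  next
    case True
    then have u: "\<And>i. i \<in> {1..n} \<Longrightarrow> 0 \<le> u i" by blast
    define w where "w = tail_min n u"
    have w: "w 0 = 0" "\<And>i. i < n \<Longrightarrow> w i \<le> w (Suc i)"
      unfolding w_def by (simp add: tail_min_def) (rule tail_min_props(3)[OF u])
    \<comment> \<open>Since \<open>w 0 = 0\<close>, partial sums of the increments telescope to the
      path at \<open>w i\<close> minus its initial value, so \<open>A\<close> encodes the
      inequalities for the times \<open>t i\<close>.\<close>
    define A where "A = {z \<in> space (\<Pi>\<^sub>M i\<in>{..<n}. (borel :: real measure)). \<forall>i\<in>{1..n}. t i \<le> (\<Sum>k<i. z k)}"
    have A: "A \<in> sets (\<Pi>\<^sub>M i\<in>{..<n}. (borel :: real measure))"
    proof -
      have "(\<lambda>z. \<Sum>k<i. z k) \<in> borel_measurable (\<Pi>\<^sub>M i\<in>{..<n}. (borel :: real measure))" if "i \<in> {1..n}" for i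
        using that by (intro borel_measurable_sum measurable_component_singleton) auto
      then show ?thesis unfolding A_def
        by (intro sets.sets_Collect_finite_All) (auto intro!: borel_measurable_le)
    qed
    have inA: "(\<lambda>i\<in>{..<n}. d (w (Suc i)) - d (w i)) \<in> A \<longleftrightarrow> (\<forall>i\<in>{1..n}. t i \<le> d (w i) - d 0)"
      for d :: "real \<Rightarrow> real"
    proof -
      have "(\<Sum>k<i. (\<lambda>i\<in>{..<n}. d (w (Suc i)) - d (w i)) k) = d (w i) - d 0" if "i \<in> {1..n}" for i
      proof -
        have "(\<Sum>k<i. (\<lambda>i\<in>{..<n}. d (w (Suc i)) - d (w i)) k) = (\<Sum>k<i. d (w (Suc k)) - d (w k))"
          using that by (intro sum.cong) auto
        also have "\<dots> = d (w i) - d (w 0)" by (rule sum_lessThan_telescope)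
        finally show ?thesis by (simp add: w)
      qed
      then show ?thesis unfolding A_def by (auto simp: space_PiM)
    qed
    have w0: "0 \<le> w i" if "i \<le> n" for i
      using tail_min_props(2)[OF u that] by (simp add: w_def)
    have Bs: "?B \<in> sets (\<Pi>\<^sub>M i\<in>{1..n}. (borel :: real measure))"
      by (rule sets_PiM_I_finite) auto
    note [measurable] = D_measurable[OF a]
    have Bm1: "(\<lambda>\<omega>. indicator ?B (inverse_vec n t \<omega>) :: real) \<in> borel_measurable M"
      by (rule measurable_compose[OF inverse_vec_measurable borel_measurable_indicator[OF Bs]])
    have Bm2: "(\<lambda>\<omega>. indicator ?B (shifted_vec a n t \<omega>) :: real) \<in> borel_measurable M"
      by (rule measurable_compose[OF shifted_vec_measurable[OF a] borel_measurable_indicator[OF Bs]])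
    have Am: "(\<lambda>\<omega>. indicator A (\<lambda>i\<in>{..<n}. D (b + w (Suc i)) \<omega> - D (b + w i) \<omega>) :: real) \<in> borel_measurable M"
      if "0 \<le> b" for b
    proof (rule measurable_compose[OF measurable_restrict borel_measurable_indicator[OF A]])
      fix i assume "i \<in> {..<n}"
      then show "(\<lambda>\<omega>. D (b + w (Suc i)) \<omega> - D (b + w i) \<omega>) \<in> borel_measurable M"
        using that w0 by (intro borel_measurable_diff D_measurable) auto
    qed
    have "expectation (\<lambda>\<omega>. exp (- s * D a \<omega>) * indicator ?B (shifted_vec a n t \<omega>)) =
        expectation (\<lambda>\<omega>. exp (- s * D a \<omega>) *
          indicator A (\<lambda>i\<in>{..<n}. D (a + w (Suc i)) \<omega> - D (a + w i) \<omega>))"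
    proof (rule integral_cong_AE)
      show "AE \<omega> in M. exp (- s * D a \<omega>) * indicator ?B (shifted_vec a n t \<omega>) =
          exp (- s * D a \<omega>) * indicator A (\<lambda>i\<in>{..<n}. D (a + w (Suc i)) \<omega> - D (a + w i) \<omega>)"
        using AE_unbounded AE_space
      proof eventually_elim
        case (elim \<omega>)
        have "shifted_vec a n t \<omega> \<in> ?B \<longleftrightarrow> (\<forall>i\<in>{1..n}. t i \<le> D (a + w i) \<omega> - D a \<omega>)"
          unfolding w_def
          by (rule trans[OF inB(2) S.inverse_box_iff[OF t u elim(2) shifted_unbounded[OF elim(1) a elim(2)]]])
        also have "\<dots> \<longleftrightarrow> (\<lambda>i\<in>{..<n}. D (a + w (Suc i)) \<omega> - D (a + w i) \<omega>) \<in> A"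
          using inA[of "\<lambda>x. D (a + x) \<omega>"] by simp
        finally have "shifted_vec a n t \<omega> \<in> ?B \<longleftrightarrow> (\<lambda>i\<in>{..<n}. D (a + w (Suc i)) \<omega> - D (a + w i) \<omega>) \<in> A" .
        then show ?case by (simp add: indicator_def)
      qed
    qed (use Bm2 Am[OF a] in measurable)
    also have "\<dots> = exp (a * \<phi> s) * expectation (\<lambda>\<omega>. indicator A (\<lambda>i\<in>{..<n}. D (w (Suc i)) \<omega> - D (w i) \<omega>))"
      using n by (intro increments_law a s w A) auto
    also have "expectation (\<lambda>\<omega>. indicator A (\<lambda>i\<in>{..<n}. D (w (Suc i)) \<omega> - D (w i) \<omega>) :: real) =
        expectation (\<lambda>\<omega>. indicator ?B (inverse_vec n t \<omega>))"
    proof (rule integral_cong_AE)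
      show "AE \<omega> in M. (indicator A (\<lambda>i\<in>{..<n}. D (w (Suc i)) \<omega> - D (w i) \<omega>) :: real) =
          indicator ?B (inverse_vec n t \<omega>)"
        using AE_unbounded AE_space
      proof eventually_elim
        case (elim \<omega>)
        have "inverse_vec n t \<omega> \<in> ?B \<longleftrightarrow> (\<forall>i\<in>{1..n}. t i \<le> D (w i) \<omega>)"
          unfolding w_def
          by (rule trans[OF inB(1) inverse_box_iff[OF t u elim(2) elim(1)[rule_format]]])
        also have "\<dots> \<longleftrightarrow> (\<lambda>i\<in>{..<n}. D (w (Suc i)) \<omega> - D (w i) \<omega>) \<in> A"
          using inA[of "\<lambda>x. D x \<omega>"] elim(2) by (simp add: D_0)
        finally have "inverse_vec n t \<omega> \<in> ?B \<longleftrightarrow> (\<lambda>i\<in>{..<n}. D (w (Suc i)) \<omega> - D (w i) \<omega>) \<in> A" .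
        then show ?case by (simp add: indicator_def)
      qed
    qed (use Bm1 Am[of 0] in simp_all)
    finally show ?thesis .
  qed
qed

end

declare One_nat_def [simp del]

section \<open>Exponential damping in the time variables\<close>

lemma integrable_exp_indicator_Ici:
  fixes c :: real
  assumes "0 < c"
  shows "integrable lborel (\<lambda>x. exp (- c * x) * indicator {0..} x)"
proof -
  interpret prob_space "density lborel (exponential_density c)"
    by (rule prob_space_exponential_density[OF assms])
  have "(\<integral>\<^sup>+x. ennreal (exponential_density c x) \<partial>lborel) = 1"
    using emeasure_space_1 by (simp add: emeasure_density)
  then have "integrable lborel (exponential_density c)"
    using assms by (intro integrableI_nonneg) (auto simp: exponential_density_def)
  then have "integrable lborel (\<lambda>x. inverse c * exponential_density c x)" by (rule integrable_mult_right)
  moreover have "inverse c * exponential_density c x = exp (- c * x) * indicator {0..} x" for x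
    using assms by (simp add: exponential_density_def indicator_def mult.commute)
  ultimately show ?thesis by simp
qed

lemma strict_times_sets: "strict_times n \<in> sets (\<Pi>\<^sub>M i\<in>{1..n}. (borel :: real measure))"
proof (cases "1 \<le> n")
  case True
  have "strict_times n = {t \<in> space (\<Pi>\<^sub>M i\<in>{1..n}. (borel :: real measure)). 0 < t 1 \<and> (\<forall>i\<in>{1..<n}. t i < t (Suc i))}"
    by (auto simp: strict_times_def space_PiM)
  also have "\<dots> \<in> sets (\<Pi>\<^sub>M i\<in>{1..n}. borel)"
    using True by (intro sets.sets_Collect_conj sets.sets_Collect_finite_All borel_measurable_less measurable_component_singleton measurable_const) auto
  finally show ?thesis .
next
  case False
  \<comment> \<open>For \<open>n = 0\<close> the space has a single point and \<open>t 1\<close> is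
    unspecified there; either answer to \<open>0 < t 1\<close> leaves a measurable set.\<close>
  then have "strict_times n \<in> {{}, {\<lambda>k. undefined}}"
    by (auto simp: strict_times_def)
  then show ?thesis using False by (simp add: sets_PiM_empty)
qed

text \<open>The Laplace kernel cut off to strictly ordered times. It is the integrable weight behind
  the uses of Fubini and dominated convergence.\<close>

definition damping :: "nat \<Rightarrow> (nat \<Rightarrow> real) \<Rightarrow> (nat \<Rightarrow> real) \<Rightarrow> real" where
  "damping n s t = exp (- (\<Sum>i=1..n. s i * t i)) * indicator (strict_times n) t"

lemma damping_nonneg: "0 \<le> damping n s t"
  by (simp add: damping_def)

lemma damping_measurable: "damping n s \<in> borel_measurable (\<Pi>\<^sub>M i\<in>{1..n}. lborel)"
proof -
  have "(\<lambda>t. exp (- (\<Sum>i=1..n. s i * t i)) * indicator (strict_times n) t) \<in> borel_measurable (\<Pi>\<^sub>M i\<in>{1..n}. (borel :: real measure))"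
    by (intro borel_measurable_times borel_measurable_indicator strict_times_sets measurable_compose[OF _ borel_measurable_exp] borel_measurable_uminus borel_measurable_sum measurable_component_singleton) auto
  then show ?thesis unfolding damping_def[abs_def] borel_measurable_PiM_lborel .
qed

text \<open>On strictly ordered times all coordinates are positive, so the damping is at most a
  product of one-dimensional exponentials on the half-line, each integrable because
  \<open>s i\<close> is positive.\<close>

lemma damping_integrable:
  assumes s: "\<And>i. i \<in> {1..n} \<Longrightarrow> 0 < s i"
  shows "integrable (\<Pi>\<^sub>M i\<in>{1..n}. lborel) (damping n s)"
proof -
  interpret product_sigma_finite "\<lambda>_::nat. lborel :: real measure" by standard
  have "integrable (\<Pi>\<^sub>M i\<in>{1..n}. lborel) (\<lambda>t. \<Prod>i=1..n. exp (- s i * t i) * indicator {0..} (t i))"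
    using s by (intro product_integrable_prod integrable_exp_indicator_Ici) auto
  then show ?thesis
  proof (rule Bochner_Integration.integrable_bound[OF _ damping_measurable], intro AE_I2)
    fix t
    show "norm (damping n s t) \<le> norm (\<Prod>i=1..n. exp (- s i * t i) * indicator {0..} (t i))"
    proof (cases "t \<in> strict_times n")
      case True
      have "(\<Prod>i=1..n. exp (- s i * t i) * indicator {0..} (t i)) = (\<Prod>i=1..n. exp (- s i * t i))"
        using strict_times_pos_mono(2)[OF True] by (intro prod.cong) (auto simp: less_imp_le)
      also have "\<dots> = exp (- (\<Sum>i=1..n. s i * t i))"
        by (simp add: exp_sum[symmetric] sum_negf)
      finally show ?thesis by (simp add: damping_def)
    qed (simp add: damping_def)
  qed
qed

context strict_process
begin

text \<open>Stated for every strictly increasing process, so that it also covers the increment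
  process after time \<open>a\<close>.\<close>

lemma inverse_vec_pair_measurable:
  "(\<lambda>(t, \<omega>). \<lambda>i\<in>{1..n}. inverse_process D (t i) \<omega>) \<in>
    measurable ((\<Pi>\<^sub>M i\<in>{1..n}. lborel) \<Otimes>\<^sub>M M) (\<Pi>\<^sub>M i\<in>{1..n}. borel)"
  unfolding split_beta'
proof (rule measurable_restrict)
  fix i assume i: "i \<in> {1..n}"
  have "(\<lambda>t. t i) \<in> measurable (\<Pi>\<^sub>M i\<in>{1..n}. lborel) (borel :: real measure)"
    using measurable_component_singleton[OF i, of "\<lambda>_. lborel :: real measure"] by simp
  then have "(\<lambda>p. (fst p i :: real, snd p)) \<in> measurable ((\<Pi>\<^sub>M i\<in>{1..n}. lborel) \<Otimes>\<^sub>M M) (borel \<Otimes>\<^sub>M M)"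
    by (intro measurable_Pair measurable_compose[OF measurable_fst] measurable_snd)
  from measurable_compose[OF this inverse_measurable_pair]
  show "(\<lambda>p. inverse_process D (fst p i) (snd p)) \<in> borel_measurable ((\<Pi>\<^sub>M i\<in>{1..n}. lborel) \<Otimes>\<^sub>M M)"
    by simp
qed

end

context inverse_subordinator
begin

text \<open>Uniqueness of finite measures carries the box identity over to general \<open>G\<close>,
  once exp (- s D a) is absorbed into a density on the outcomes. This exponential weight is what the
  damping leaves behind when the times are shifted by \<open>D a\<close>.\<close>

lemma shifted_expectation:
  assumes n: "1 \<le> n" and t: "t \<in> strict_times n" and a: "0 \<le> a" and s: "0 \<le> s"
    and G: "G \<in> borel_measurable (\<Pi>\<^sub>M i\<in>{1..n}. borel)"
  shows "expectation (\<lambda>\<omega>. exp (- s * D a \<omega>) * G (shifted_vec a n t \<omega>)) =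
    exp (a * \<phi> s) * expectation (\<lambda>\<omega>. G (inverse_vec n t \<omega>) :: real)"
proof -
  let ?Pi = "\<Pi>\<^sub>M i\<in>{1..n}. (borel :: real measure)"
  note [measurable] = D_measurable[OF a] inverse_vec_measurable[of n t] shifted_vec_measurable[OF a, of n t] G
  let ?d = "density M (\<lambda>\<omega>. ennreal (exp (- s * D a \<omega>)))"
  let ?P = "distr ?d ?Pi (shifted_vec a n t)"
  \<comment> \<open>The scalar factor is put into the measure, so that both sides become measures
    that can be compared on boxes.\<close>
  let ?Q = "density (distr M ?Pi (inverse_vec n t)) (\<lambda>_. ennreal (exp (a * \<phi> s)))"
  have sh: "shifted_vec a n t \<in> measurable ?d ?Pi" by simp
  have P: "emeasure ?P B = ennreal (expectation (\<lambda>\<omega>. exp (- s * D a \<omega>) * indicator B (shifted_vec a n t \<omega>)))"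
    if B[measurable]: "B \<in> sets ?Pi" for B
  proof -
    have "emeasure ?P B = emeasure ?d (shifted_vec a n t -` B \<inter> space M)"
      using emeasure_distr[OF sh B] by simp
    also have "\<dots> = (\<integral>\<^sup>+\<omega>. ennreal (exp (- s * D a \<omega>)) * indicator (shifted_vec a n t -` B \<inter> space M) \<omega> \<partial>M)"
      by (rule emeasure_density) measurable
    also have "\<dots> = (\<integral>\<^sup>+\<omega>. ennreal (exp (- s * D a \<omega>) * indicator B (shifted_vec a n t \<omega>)) \<partial>M)"
      by (intro nn_integral_cong) (auto simp: indicator_def)
    also have "\<dots> = ennreal (expectation (\<lambda>\<omega>. exp (- s * D a \<omega>) * indicator B (shifted_vec a n t \<omega>)))"
    proof (rule nn_integral_eq_integral)
      show "integrable M (\<lambda>\<omega>. exp (- s * D a \<omega>) * indicator B (shifted_vec a n t \<omega>))"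
        by (rule Bochner_Integration.integrable_bound[OF exp_D_integrable[OF a s]]) (auto simp: indicator_def)
    qed simp
    finally show ?thesis .
  qed
  have Q: "emeasure ?Q B = ennreal (exp (a * \<phi> s) * expectation (\<lambda>\<omega>. indicator B (inverse_vec n t \<omega>)))"
    if B[measurable]: "B \<in> sets ?Pi" for B
  proof -
    have "expectation (\<lambda>\<omega>. indicator B (inverse_vec n t \<omega>) :: real) = expectation (indicator (inverse_vec n t -` B \<inter> space M))"
      by (intro Bochner_Integration.integral_cong) (auto simp: indicator_def)
    also have "\<dots> = prob (inverse_vec n t -` B \<inter> space M)"
      by simp
    finally have "ennreal (expectation (\<lambda>\<omega>. indicator B (inverse_vec n t \<omega>))) = emeasure (distr M ?Pi (inverse_vec n t)) B"
      by (simp add: emeasure_distr emeasure_eq_measure)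
    then show ?thesis
      by (simp add: emeasure_density nn_integral_cmult_indicator ennreal_mult)
  qed
  have "?P = ?Q"
  proof (rule measure_eqI_PiM_atMost[of "{1..n}"])
    show "finite_measure ?P"
    proof (rule finite_measureI)
      show "emeasure ?P (space ?P) \<noteq> \<infinity>" using P[OF sets.top] by simp
    qed
    fix u :: "nat \<Rightarrow> real"
    have "(\<Pi>\<^sub>E i\<in>{1..n}. {..u i}) \<in> sets ?Pi" by (rule sets_PiM_I_finite) auto
    then show "emeasure ?P (\<Pi>\<^sub>E i\<in>{1..n}. {..u i}) = emeasure ?Q (\<Pi>\<^sub>E i\<in>{1..n}. {..u i})"
      by (simp only: P Q shifted_box_prob[OF n t a s])
  qed simp_all
  have "expectation (\<lambda>\<omega>. exp (- s * D a \<omega>) * G (shifted_vec a n t \<omega>)) = (LINT \<omega>|?d. G (shifted_vec a n t \<omega>))"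
    by (subst integral_density) auto
  also have "\<dots> = (LINT x|?P. G x)" by (subst integral_distr[OF sh G]) simp
  also have "\<dots> = (LINT x|?Q. G x)" by (simp only: \<open>?P = ?Q\<close>)
  also have "\<dots> = (LINT x|distr M ?Pi (inverse_vec n t). exp (a * \<phi> s) * G x)"
    by (subst integral_density) auto
  also have "\<dots> = exp (a * \<phi> s) * expectation (\<lambda>\<omega>. G (inverse_vec n t \<omega>))"
    by (subst integral_distr) auto
  finally show ?thesis .
qed

text \<open>The Laplace transform at \<open>s\<close> of the function that maps strictly ordered
  times to the integral of \<open>G\<close> against the law of the inverse at these times.\<close>

definition fdd_laplace :: "nat \<Rightarrow> (nat \<Rightarrow> real) \<Rightarrow> ((nat \<Rightarrow> real) \<Rightarrow> real) \<Rightarrow> real" where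
  "fdd_laplace n s G =
    (LINT t|(\<Pi>\<^sub>M i\<in>{1..n}. lborel). damping n s t * expectation (\<lambda>\<omega>. G (inverse_vec n t \<omega>)))"

text \<open>The damping is integrable in the times, the outcomes have total mass 1 and
  \<open>F\<close> is bounded. This licenses the exchanges of time integral and expectation.\<close>

lemma damped_pair_integrable:
  assumes s: "\<And>i. i \<in> {1..n} \<Longrightarrow> 0 < s i"
    and F: "(\<lambda>(t, \<omega>). F t \<omega>) \<in> borel_measurable ((\<Pi>\<^sub>M i\<in>{1..n}. lborel) \<Otimes>\<^sub>M M)"
    and B: "\<And>t \<omega>. \<omega> \<in> space M \<Longrightarrow> \<bar>F t \<omega>\<bar> \<le> B"
  shows "integrable ((\<Pi>\<^sub>M i\<in>{1..n}. lborel) \<Otimes>\<^sub>M M) (\<lambda>(t, \<omega>). damping n s t * F t \<omega>)"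
proof -
  interpret product_sigma_finite "\<lambda>_::nat. lborel :: real measure" by standard
  let ?N = "\<Pi>\<^sub>M i\<in>{1..n}. lborel :: real measure"
  interpret N: sigma_finite_measure ?N by (rule sigma_finite) simp
  interpret NM: pair_sigma_finite ?N M ..
  have [measurable]: "damping n s \<in> borel_measurable ?N" by (rule damping_measurable)
  note [measurable] = F
  have B0: "0 \<le> B" using B not_empty by (meson abs_ge_zero all_not_in_conv order_trans)
  have "integrable (?N \<Otimes>\<^sub>M M) (\<lambda>p. B * damping n s (fst p))"
  proof (rule NM.Fubini_integrable)
    show "integrable ?N (\<lambda>t. LINT \<omega>|M. norm (B * damping n s (fst (t, \<omega>))))"
      using damping_integrable[OF s] by (simp add: prob_space abs_mult)
    show "AE t in ?N. integrable M (\<lambda>\<omega>. B * damping n s (fst (t, \<omega>)))" by simp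
  qed measurable
  then show ?thesis
  proof (rule Bochner_Integration.integrable_bound)
    show "(\<lambda>(t, \<omega>). damping n s t * F t \<omega>) \<in> borel_measurable (?N \<Otimes>\<^sub>M M)"
      using F by (simp add: split_beta')
    show "AE p in ?N \<Otimes>\<^sub>M M. norm (case p of (t, \<omega>) \<Rightarrow> damping n s t * F t \<omega>) \<le> norm (B * damping n s (fst p))"
    proof (rule AE_I2, clarify)
      fix t \<omega> assume "(t, \<omega>) \<in> space (?N \<Otimes>\<^sub>M M)"
      then have "\<bar>F t \<omega>\<bar> \<le> B" by (intro B) (simp add: space_pair_measure)
      then show "norm (damping n s t * F t \<omega>) \<le> norm (B * damping n s (fst (t, \<omega>)))"
        using damping_nonneg[of n s t] B0 by (simp add: abs_mult mult.commute[of _ "damping n s t"] mult_left_mono)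
    qed
  qed
qed

text \<open>The substitution of times is made for a fixed path, whereas independence is available
  for fixed times; hence Fubini is used before and after. Under the substitution the damping
  releases the factor exp (- \<sigma> D a), whose expectation is exp (a \<phi> \<sigma>).\<close>

lemma fdd_laplace_shift:
  assumes n: "1 \<le> n" and s: "\<And>i. i \<in> {1..n} \<Longrightarrow> 0 < s i" and a: "0 \<le> a"
    and G: "G \<in> borel_measurable (\<Pi>\<^sub>M i\<in>{1..n}. borel)" "\<And>x. x \<in> {1..n} \<rightarrow>\<^sub>E UNIV \<Longrightarrow> \<bar>G x\<bar> \<le> B"
    and G': "G' \<in> borel_measurable (\<Pi>\<^sub>M i\<in>{1..n}. borel)" "\<And>x. x \<in> {1..n} \<rightarrow>\<^sub>E UNIV \<Longrightarrow> \<bar>G' x\<bar> \<le> B"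
    and zero: "\<And>x. x \<in> {1..n} \<rightarrow>\<^sub>E UNIV \<Longrightarrow> x 1 \<le> a \<Longrightarrow> G x = 0"
    and shift: "\<And>x. x \<in> {1..n} \<rightarrow>\<^sub>E {0..} \<Longrightarrow> G (\<lambda>i\<in>{1..n}. a + x i) = G' x"
  shows "fdd_laplace n s G = exp (a * \<phi> (\<Sum>i=1..n. s i)) * fdd_laplace n s G'"
proof -
  interpret product_sigma_finite "\<lambda>_::nat. lborel :: real measure" by standard
  let ?N = "\<Pi>\<^sub>M i\<in>{1..n}. lborel :: real measure"
  interpret N: sigma_finite_measure ?N by (rule sigma_finite) simp
  interpret NM: pair_sigma_finite ?N M ..
  interpret S: strict_process M "\<lambda>u \<omega>. D (a + u) \<omega> - D a \<omega>" by (rule strict_process_shift[OF a])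
  define \<sigma> where "\<sigma> = (\<Sum>i=1..n. s i)"
  have \<sigma>: "0 \<le> \<sigma>" unfolding \<sigma>_def using s by (intro sum_nonneg) (auto intro: less_imp_le)
  have vec_in: "inverse_vec n t \<omega> \<in> {1..n} \<rightarrow>\<^sub>E UNIV" "shifted_vec a n t \<omega> \<in> {1..n} \<rightarrow>\<^sub>E UNIV" for t \<omega>
    by (auto simp: inverse_vec_def shifted_vec_def)
  have pm: "(\<lambda>(t, \<omega>). inverse_vec n t \<omega>) \<in> measurable (?N \<Otimes>\<^sub>M M) (\<Pi>\<^sub>M i\<in>{1..n}. borel)"
    "(\<lambda>(t, \<omega>). shifted_vec a n t \<omega>) \<in> measurable (?N \<Otimes>\<^sub>M M) (\<Pi>\<^sub>M i\<in>{1..n}. borel)"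
    unfolding inverse_vec_def shifted_vec_def
    by (rule inverse_vec_pair_measurable, rule S.inverse_vec_pair_measurable)
  note [measurable] = D_measurable[OF a]
  have int1: "integrable (?N \<Otimes>\<^sub>M M) (\<lambda>(t, \<omega>). damping n s t * G (inverse_vec n t \<omega>))"
    using measurable_compose[OF pm(1) G(1)] G(2)[OF vec_in(1)]
    by (intro damped_pair_integrable[where B = B, OF s]) (auto simp: split_beta')
  have int2: "integrable (?N \<Otimes>\<^sub>M M) (\<lambda>(t, \<omega>). damping n s t * (exp (- \<sigma> * D a \<omega>) * G' (shifted_vec a n t \<omega>)))"
  proof (rule damped_pair_integrable[where B = B, OF s])
    have "(\<lambda>p. G' (shifted_vec a n (fst p) (snd p))) \<in> borel_measurable (?N \<Otimes>\<^sub>M M)"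
      using measurable_compose[OF pm(2) G'(1)] by (simp add: split_beta')
    then show "(\<lambda>(t, \<omega>). exp (- \<sigma> * D a \<omega>) * G' (shifted_vec a n t \<omega>)) \<in> borel_measurable (?N \<Otimes>\<^sub>M M)"
      unfolding split_beta' by measurable
    show "\<bar>exp (- \<sigma> * D a \<omega>) * G' (shifted_vec a n t \<omega>)\<bar> \<le> B" if "\<omega> \<in> space M" for t \<omega>
    proof -
      have "exp (- \<sigma> * D a \<omega>) \<le> 1" using D_nonneg[OF that a] \<sigma> by simp
      then have "exp (- \<sigma> * D a \<omega>) * \<bar>G' (shifted_vec a n t \<omega>)\<bar> \<le> 1 * \<bar>G' (shifted_vec a n t \<omega>)\<bar>"
        by (intro mult_right_mono) auto
      then show ?thesis using G'(2)[OF vec_in(2), of t \<omega>] by (simp add: abs_mult)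
    qed
  qed simp
  have "fdd_laplace n s G = (LINT t|?N. expectation (\<lambda>\<omega>. damping n s t * G (inverse_vec n t \<omega>)))"
    by (simp add: fdd_laplace_def)
  also have "\<dots> = expectation (\<lambda>\<omega>. LINT t|?N. damping n s t * G (inverse_vec n t \<omega>))"
    by (rule NM.Fubini_integral[OF int1, symmetric])
  also have "\<dots> = expectation (\<lambda>\<omega>. LINT t|?N. damping n s t * (exp (- \<sigma> * D a \<omega>) * G' (shifted_vec a n t \<omega>)))"
  proof (rule integral_cong_AE)
    show "(\<lambda>\<omega>. LINT t|?N. damping n s t * G (inverse_vec n t \<omega>)) \<in> borel_measurable M"
      "(\<lambda>\<omega>. LINT t|?N. damping n s t * (exp (- \<sigma> * D a \<omega>) * G' (shifted_vec a n t \<omega>))) \<in> borel_measurable M"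
      using NM.integrable_snd[OF int1] NM.integrable_snd[OF int2] by auto
    show "AE \<omega> in M. (LINT t|?N. damping n s t * G (inverse_vec n t \<omega>)) =
        (LINT t|?N. damping n s t * (exp (- \<sigma> * D a \<omega>) * G' (shifted_vec a n t \<omega>)))"
      using AE_unbounded AE_space
    proof eventually_elim
      case (elim \<omega>)
      note \<omega> = elim(2)
      define c where "c = D a \<omega>"
      have c: "0 \<le> c" unfolding c_def by (rule D_nonneg[OF \<omega> a])
      let ?T = "\<lambda>t. \<lambda>i\<in>{1..n}. t i + c"
      have Tm: "?T \<in> measurable ?N ?N"
        by (intro measurable_restrict) (auto intro!: borel_measurable_add simp: measurable_component_singleton)
      have m1: "(\<lambda>t. damping n s t * G (inverse_vec n t \<omega>)) \<in> borel_measurable ?N"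
        using measurable_compose[OF measurable_Pair2'[OF \<omega>] borel_measurable_integrable[OF int1]]
        by simp
      have "(LINT t|?N. damping n s t * G (inverse_vec n t \<omega>)) =
          (LINT t|distr ?N ?N ?T. damping n s t * G (inverse_vec n t \<omega>))"
        by (simp only: PiM_lborel_translate[OF finite_atLeastAtMost])
      also have "\<dots> = (LINT t|?N. damping n s (?T t) * G (inverse_vec n (?T t) \<omega>))"
        by (rule integral_distr[OF Tm m1])
      also have "\<dots> = (LINT t|?N. damping n s t * (exp (- \<sigma> * D a \<omega>) * G' (shifted_vec a n t \<omega>)))"
      proof (rule Bochner_Integration.integral_cong[OF refl])
        fix t assume "t \<in> space ?N"
        then have t: "t \<in> {1..n} \<rightarrow>\<^sub>E UNIV" by (simp add: space_PiM)
        show "damping n s (?T t) * G (inverse_vec n (?T t) \<omega>) =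
            damping n s t * (exp (- \<sigma> * D a \<omega>) * G' (shifted_vec a n t \<omega>))"
        proof (cases "t \<in> strict_times n")
          case True
          then have "?T t \<in> strict_times n"
            using n c by (auto simp: strict_times_def)
          moreover have "exp (- (\<Sum>i=1..n. s i * ?T t i)) = exp (- (\<Sum>i=1..n. s i * t i)) * exp (- \<sigma> * c)"
          proof -
            have "(\<Sum>i=1..n. s i * ?T t i) = (\<Sum>i=1..n. s i * t i + s i * c)"
              by (intro sum.cong) (auto simp: algebra_simps)
            also have "\<dots> = (\<Sum>i=1..n. s i * t i) + \<sigma> * c"
              by (simp add: sum.distrib \<sigma>_def sum_distrib_right)
            finally show ?thesis by (simp add: exp_add[symmetric])
          qed
          ultimately have "damping n s (?T t) = damping n s t * exp (- \<sigma> * c)"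
            using True by (simp add: damping_def)
          moreover have "G (inverse_vec n (?T t) \<omega>) = G' (shifted_vec a n t \<omega>)"
          proof -
            have "inverse_vec n (?T t) \<omega> = (\<lambda>i\<in>{1..n}. a + shifted_vec a n t \<omega> i)"
              unfolding inverse_vec_def shifted_vec_def
            proof (rule restrict_ext)
              fix i assume i: "i \<in> {1..n}"
              obtain v where v: "0 < v" "t i < D (a + v) \<omega> - D a \<omega>"
                using shifted_unbounded[OF elim(1) a \<omega>] by blast
              have "0 < t i" using strict_times_pos_mono(2)[OF True, of i i] i by simp
              from inverse_shift[OF \<omega> a this v] i
              show "inverse_process D (?T t i) \<omega> =
                  a + (\<lambda>i\<in>{1..n}. inverse_process (\<lambda>u \<omega>. D (a + u) \<omega> - D a \<omega>) (t i) \<omega>) i"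
                by (simp add: c_def)
            qed
            moreover have "shifted_vec a n t \<omega> \<in> {1..n} \<rightarrow>\<^sub>E {0..}"
            proof -
              have "0 \<le> inverse_process (\<lambda>u \<omega>. D (a + u) \<omega> - D a \<omega>) (t i) \<omega>" for i
              proof -
                obtain v where v: "0 < v" "t i < D (a + v) \<omega> - D a \<omega>"
                  using shifted_unbounded[OF elim(1) a \<omega>] by blast
                show ?thesis by (rule S.inverse_nonneg[OF \<omega> v])
              qed
              then show ?thesis by (auto simp: shifted_vec_def)
            qed
            ultimately show ?thesis using shift by simp
          qed
          ultimately show ?thesis by (simp add: c_def)
        next
          case False
          \<comment> \<open>If the shifted times are admissible although \<open>t\<close> is not,
            then t 1 \<le> 0: the first shifted time is at most \<open>D a\<close>, its inverse is
            at most \<open>a\<close>, and \<open>G\<close> vanishes.\<close>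
          have "damping n s (?T t) * G (inverse_vec n (?T t) \<omega>) = 0"
          proof (cases "?T t \<in> strict_times n")
            case True
            have "t i < t (Suc i)" if "i \<in> {1..<n}" for i
              using True that by (auto simp: strict_times_def)
            then have "t 1 \<le> 0" using False t by (force simp: strict_times_def)
            obtain v where v: "0 < v" "t 1 + c < D v \<omega>" using elim(1) by blast
            have "inverse_process D (t 1 + c) \<omega> \<le> a"
              using inverse_le_iff[OF \<omega> v, of a] a \<open>t 1 \<le> 0\<close> by (simp add: c_def)
            then have "inverse_vec n (?T t) \<omega> 1 \<le> a" using n by (simp add: inverse_vec_def)
            then have "G (inverse_vec n (?T t) \<omega>) = 0" by (rule zero[OF vec_in(1)])
            then show ?thesis by simp
          qed (simp add: damping_def)
          then show ?thesis using False by (simp add: damping_def)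
        qed
      qed
      finally show ?case .
    qed
  qed
  also have "\<dots> = (LINT t|?N. expectation (\<lambda>\<omega>. damping n s t * (exp (- \<sigma> * D a \<omega>) * G' (shifted_vec a n t \<omega>))))"
    by (rule NM.Fubini_integral[OF int2])
  also have "\<dots> = (LINT t|?N. exp (a * \<phi> \<sigma>) * (damping n s t * expectation (\<lambda>\<omega>. G' (inverse_vec n t \<omega>))))"
  proof (rule Bochner_Integration.integral_cong[OF refl])
    fix t
    show "expectation (\<lambda>\<omega>. damping n s t * (exp (- \<sigma> * D a \<omega>) * G' (shifted_vec a n t \<omega>))) =
        exp (a * \<phi> \<sigma>) * (damping n s t * expectation (\<lambda>\<omega>. G' (inverse_vec n t \<omega>)))"
    proof (cases "t \<in> strict_times n")
      case True
      then show ?thesis using shifted_expectation[OF n True a \<sigma> G'(1)] by simp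
    qed (simp add: damping_def)
  qed
  also have "\<dots> = exp (a * \<phi> \<sigma>) * fdd_laplace n s G'"
    by (simp add: fdd_laplace_def)
  finally show ?thesis unfolding \<sigma>_def .
qed

end


section \<open>Differentiation along the diagonal\<close>

lemma stratum_sets: "stratum n K \<in> sets (\<Pi>\<^sub>M i\<in>{1..n}. (borel :: real measure))"
proof -
  have prev: "(\<lambda>x. if i = 1 then 0 else x (i - 1)) \<in> borel_measurable (\<Pi>\<^sub>M i\<in>{1..n}. (borel :: real measure))"
    if "i \<in> {1..n}" for i
  proof (cases "i = 1")
    case False
    then have "i - 1 \<in> {1..n}" using that by auto
    then show ?thesis using False by (simp add: measurable_component_singleton)
  qed simp
  have "stratum n K = {x \<in> space (\<Pi>\<^sub>M i\<in>{1..n}. (borel :: real measure)). \<forall>i\<in>{1..n}.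
     (if i = 1 then 0 else x (i - 1)) \<le> x i \<and> ((if i = 1 then 0 else x (i - 1)) < x i \<longleftrightarrow> i \<in> K)}"
    unfolding stratum_def Let_def space_PiM by simp
  also have "\<dots> \<in> sets (\<Pi>\<^sub>M i\<in>{1..n}. borel)"
  proof (intro sets.sets_Collect_finite_All sets.sets_Collect_conj finite_atLeastAtMost)
    fix i assume i: "i \<in> {1..n}"
    have c: "(\<lambda>x. x i) \<in> borel_measurable (\<Pi>\<^sub>M i\<in>{1..n}. (borel :: real measure))"
      using i by (rule measurable_component_singleton)
    show "{x \<in> space (\<Pi>\<^sub>M i\<in>{1..n}. borel). (if i = 1 then 0 else x (i - 1)) \<le> x i} \<in> sets (\<Pi>\<^sub>M i\<in>{1..n}. (borel :: real measure))"
      by (rule borel_measurable_le[OF prev[OF i] c])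
    show "{x \<in> space (\<Pi>\<^sub>M i\<in>{1..n}. borel). ((if i = 1 then 0 else x (i - 1)) < x i) = (i \<in> K)} \<in> sets (\<Pi>\<^sub>M i\<in>{1..n}. (borel :: real measure))"
    proof (cases "i \<in> K")
      case True
      then show ?thesis using borel_measurable_less[OF prev[OF i] c] by simp
    next
      case False
      then show ?thesis using borel_measurable_le[OF c prev[OF i]] by (simp add: not_less)
    qed
  qed
  finally show ?thesis .
qed

lemma embed_measurable:
  assumes K: "K \<in> index_sets n"
  shows "embed n K \<in> measurable (\<Pi>\<^sub>M i\<in>K. lborel) (\<Pi>\<^sub>M i\<in>{1..n}. borel)"
  unfolding embed_def[abs_def]
proof (rule measurable_restrict)
  fix i assume i: "i \<in> {1..n}"
  have "finite {k \<in> K. k \<le> i}" by (rule finite_subset[of _ "{..i}"]) auto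
  moreover have "{k \<in> K. k \<le> i} \<noteq> {}" using K i by (auto simp: index_sets_def)
  ultimately have "Max {k \<in> K. k \<le> i} \<in> {k \<in> K. k \<le> i}" by (rule Max_in)
  then have "(\<lambda>y. y (Max {k \<in> K. k \<le> i})) \<in> measurable (\<Pi>\<^sub>M i\<in>K. lborel) (lborel :: real measure)"
    by (intro measurable_component_singleton) auto
  then show "(\<lambda>y. y (Max {k \<in> K. k \<le> i})) \<in> borel_measurable (\<Pi>\<^sub>M i\<in>K. (lborel :: real measure))"
    by simp
qed

lemma restrict_embed:
  assumes K: "K \<in> index_sets n" and y: "y \<in> K \<rightarrow>\<^sub>E UNIV"
  shows "restrict (embed n K y) K = y"
proof
  fix i
  show "restrict (embed n K y) K i = y i"
  proof (cases "i \<in> K")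
    case True
    have "finite {k \<in> K. k \<le> i}" by (rule finite_subset[of _ "{..i}"]) auto
    then have "Max {k \<in> K. k \<le> i} = i" using True by (intro Max_eqI) auto
    moreover have "i \<in> {1..n}" using True K by (auto simp: index_sets_def)
    ultimately show ?thesis using True by (simp add: embed_def)
  next
    case False
    then show ?thesis using PiE_arb[OF y False] by simp
  qed
qed

lemma index_set_finite: "K \<in> index_sets n \<Longrightarrow> finite K"
  unfolding index_sets_def using finite_subset[of K "{1..n}"] by auto

text \<open>Extends a function on a stratum by zero to all vectors, so that its integral over the
  stratum becomes one expectation of the inverse vector.\<close>

definition stratum_lift :: "nat \<Rightarrow> nat set \<Rightarrow> ((nat \<Rightarrow> real) \<Rightarrow> real) \<Rightarrow> (nat \<Rightarrow> real) \<Rightarrow> real" where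
  "stratum_lift n K g x = indicator (stratum n K) x * g (restrict x K)"

lemma restrict_index_measurable:
  assumes "K \<in> index_sets n"
  shows "(\<lambda>x. restrict x K) \<in> measurable (\<Pi>\<^sub>M i\<in>{1..n}. borel) (\<Pi>\<^sub>M i\<in>K. borel)"
  using assms by (intro measurable_restrict_subset) (auto simp: index_sets_def)

lemma stratum_lift_measurable:
  assumes K: "K \<in> index_sets n" and g: "g \<in> borel_measurable (\<Pi>\<^sub>M i\<in>K. borel)"
  shows "stratum_lift n K g \<in> borel_measurable (\<Pi>\<^sub>M i\<in>{1..n}. borel)"
  unfolding stratum_lift_def[abs_def]
  by (intro borel_measurable_times borel_measurable_indicator stratum_sets measurable_compose[OF restrict_index_measurable[OF K] g])

lemma stratum_lift_bounded:
  assumes g: "\<And>y. y \<in> K \<rightarrow>\<^sub>E UNIV \<Longrightarrow> \<bar>g y\<bar> \<le> B"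
  shows "\<bar>stratum_lift n K g x\<bar> \<le> B"
proof -
  have "\<bar>g (restrict x K)\<bar> \<le> B" by (rule g) auto
  then show ?thesis by (auto simp: stratum_lift_def indicator_def intro: order_trans[OF abs_ge_zero])
qed

text \<open>After integration by parts in each coordinate the density survives only as a weight;
  pushing forward under \<open>embed\<close> and using \<open>hf\<close> exchanges it for the law
  \<open>h\<close>. The space side no longer mentions the density afterwards.\<close>

lemma Dx_integral_eq:
  assumes K: "K \<in> index_sets n" and f: "admissible_density K f" and g: "test_function K g"
    and h: "prob_space h" "sets h = sets (\<Pi>\<^sub>M i\<in>{1..n}. (borel :: real measure))"
    and hf: "density h (indicator (stratum n K)) = stratum_measure n K f"
  shows "- Dx_integral n K f (\<lambda>x. g (restrict x K)) =
    (LINT x|h. stratum_lift n K (\<lambda>y. \<Sum>j\<in>K. partial j g y) x)"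
proof -
  interpret h: prob_space h by (rule h(1))
  let ?M = "\<Pi>\<^sub>M i\<in>K. lborel :: real measure"
  let ?Pi = "\<Pi>\<^sub>M i\<in>{1..n}. (borel :: real measure)"
  let ?ch = "\<lambda>y. indicator (chamber K) y :: real"
  define Dg where "Dg y = (\<Sum>j\<in>K. partial j g y)" for y
  note fK = index_set_finite[OF K]
  note em = embed_measurable[OF K]
  have fm: "(\<lambda>y. ?ch y * f y) \<in> borel_measurable ?M" by (rule admissible_densityD(4)[OF f])
  have f0: "0 \<le> ?ch y * f y" for y using admissible_densityD(5)[OF f, of y] by (simp add: indicator_def)
  let ?d = "density ?M (\<lambda>y. ennreal (?ch y * f y))"
  have emd: "embed n K \<in> measurable ?d ?Pi" using em by simp
  have sp: "space h = space ?Pi" using h(2) by (rule sets_eq_imp_space_eq)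
  have str: "stratum n K \<in> sets h" using stratum_sets h(2) by simp
  have Dgm: "Dg \<in> borel_measurable (\<Pi>\<^sub>M i\<in>K. borel)"
    unfolding Dg_def[abs_def] by (intro borel_measurable_sum test_function_measurable(2)[OF g])
  \<comment> \<open>The total mass of the density is the mass that \<open>h\<close> gives to the
    stratum, which is at most 1.\<close>
  have int: "integrable ?M (\<lambda>y. ?ch y * f y)"
  proof (rule integrableI_nonneg[OF fm])
    have "(\<integral>\<^sup>+y. ennreal (?ch y * f y) \<partial>?M) = emeasure ?d (space ?M)"
      using fm by (subst emeasure_density) (auto intro!: nn_integral_cong)
    also have "\<dots> = emeasure (stratum_measure n K f) (space ?Pi)"
    proof -
      have "embed n K -` space ?Pi \<inter> space ?d = space ?M"
        using measurable_space[OF em] by auto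
      then show ?thesis
        unfolding stratum_measure_def by (subst emeasure_distr[OF emd]) auto
    qed
    also have "\<dots> = emeasure (density h (indicator (stratum n K))) (space h)"
      by (simp only: hf sp)
    also have "\<dots> = (\<integral>\<^sup>+x. indicator (stratum n K) x * indicator (space h) x \<partial>h)"
      using str by (intro emeasure_density) auto
    also have "\<dots> \<le> (\<integral>\<^sup>+x. 1 \<partial>h)"
      by (intro nn_integral_mono) (auto simp: indicator_def)
    also have "\<dots> < \<infinity>" by (simp add: h.emeasure_space_1)
    finally show "(\<integral>\<^sup>+y. ennreal (?ch y * f y) \<partial>?M) < \<infinity>" .
  qed (simp add: f0)
  note ibp = partial_integration_by_parts[OF fK _ f g int]
  have "Dx_integral n K f (\<lambda>x. g (restrict x K)) = (LINT y|?M. (\<Sum>j\<in>K. ?ch y * g y * partial j f y))"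
    unfolding Dx_integral_def
  proof (rule Bochner_Integration.integral_cong[OF refl])
    fix y assume "y \<in> space ?M"
    then have "restrict (embed n K y) K = y" by (intro restrict_embed[OF K]) (simp add: space_PiM)
    then show "?ch y * g (restrict (embed n K y) K) * (\<Sum>j\<in>K. partial j f y) = (\<Sum>j\<in>K. ?ch y * g y * partial j f y)"
      by (simp add: sum_distrib_left)
  qed
  also have "\<dots> = (\<Sum>j\<in>K. LINT y|?M. ?ch y * g y * partial j f y)"
    by (rule Bochner_Integration.integral_sum) (rule ibp(1))
  also have "\<dots> = (\<Sum>j\<in>K. - (LINT y|?M. ?ch y * partial j g y * f y))"
    by (intro sum.cong refl ibp(3))
  also have "\<dots> = - (LINT y|?M. (\<Sum>j\<in>K. ?ch y * partial j g y * f y))"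
    by (subst Bochner_Integration.integral_sum) (auto simp: sum_negf intro: ibp(2))
  also have "(LINT y|?M. (\<Sum>j\<in>K. ?ch y * partial j g y * f y)) = (LINT y|?M. (?ch y * f y) *\<^sub>R Dg (restrict (embed n K y) K))"
  proof (rule Bochner_Integration.integral_cong[OF refl])
    fix y assume "y \<in> space ?M"
    then have "restrict (embed n K y) K = y" by (intro restrict_embed[OF K]) (simp add: space_PiM)
    then show "(\<Sum>j\<in>K. ?ch y * partial j g y * f y) = (?ch y * f y) *\<^sub>R Dg (restrict (embed n K y) K)"
      by (simp add: Dg_def sum_distrib_left ac_simps)
  qed
  also have "\<dots> = (LINT y|?d. Dg (restrict (embed n K y) K))"
  proof (rule integral_density[symmetric])
    show "(\<lambda>y. Dg (restrict (embed n K y) K)) \<in> borel_measurable ?M"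
      by (rule measurable_compose[OF em measurable_compose[OF restrict_index_measurable[OF K] Dgm]])
  qed (use fm f0 in auto)
  also have "\<dots> = (LINT x|stratum_measure n K f. Dg (restrict x K))"
    unfolding stratum_measure_def
    by (rule integral_distr[OF emd measurable_compose[OF restrict_index_measurable[OF K] Dgm], symmetric])
  also have "\<dots> = (LINT x|density h (\<lambda>x. ennreal (indicator (stratum n K) x)). Dg (restrict x K))"
    by (simp only: hf[symmetric] ennreal_indicator)
  also have "\<dots> = (LINT x|h. indicator (stratum n K) x *\<^sub>R Dg (restrict x K))"
  proof (rule integral_density)
    show "(\<lambda>x. Dg (restrict x K)) \<in> borel_measurable h"
      using measurable_compose[OF restrict_index_measurable[OF K] Dgm] measurable_cong_sets[OF h(2) refl] by blast
  qed (use str in auto)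
  finally show ?thesis unfolding stratum_lift_def Dg_def by (simp only: minus_minus real_scaleR_def)
qed

text \<open>A diagonal translation keeps the differences of neighbouring coordinates. Only the
  comparison of the first coordinate with 0 could change, and it is strict before and after.\<close>

lemma stratum_translate:
  assumes n: "1 \<le> n" and x: "x \<in> {1..n} \<rightarrow>\<^sub>E UNIV" and a: "0 \<le> a" and K: "1 \<in> K" and pos: "0 < x 1"
  shows "(\<lambda>i\<in>{1..n}. a + x i) \<in> stratum n K \<longleftrightarrow> x \<in> stratum n K"
proof -
  let ?z = "\<lambda>i\<in>{1..n}. a + x i"
  have "(let p = (if i = 1 then 0 else ?z (i - 1)) in p \<le> ?z i \<and> (p < ?z i \<longleftrightarrow> i \<in> K)) \<longleftrightarrow>
      (let p = (if i = 1 then 0 else x (i - 1)) in p \<le> x i \<and> (p < x i \<longleftrightarrow> i \<in> K))"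
    if "i \<in> {1..n}" for i
  proof (cases "i = 1")
    case True
    then show ?thesis using a K pos n by simp
  next
    case False
    then have "i - 1 \<in> {1..n}" using that by auto
    then show ?thesis using False that by (simp add: Let_def)
  qed
  then show ?thesis using x unfolding stratum_def by simp
qed

context inverse_subordinator
begin

text \<open>The stratum is compatible with diagonal translation away from x 1 = 0; at that boundary
  the support condition on \<open>g\<close> takes over.\<close>

lemma stratum_laplace_shift:
  assumes n: "1 \<le> n" and s: "\<And>i. i \<in> {1..n} \<Longrightarrow> 0 < s i" and a: "0 < a" and K: "K \<in> index_sets n"
    and g: "g \<in> borel_measurable (\<Pi>\<^sub>M i\<in>K. borel)" "\<And>y. y \<in> K \<rightarrow>\<^sub>E UNIV \<Longrightarrow> \<bar>g y\<bar> \<le> B"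
    and zero: "\<And>y. y \<in> K \<rightarrow>\<^sub>E UNIV \<Longrightarrow> y 1 \<le> a \<Longrightarrow> g y = 0"
  shows "fdd_laplace n s (stratum_lift n K g) =
    exp (a * \<phi> (\<Sum>i=1..n. s i)) * fdd_laplace n s (stratum_lift n K (\<lambda>y. g (diag_shift K a y)))"
proof (rule fdd_laplace_shift[OF n s])
  have K1: "1 \<in> K" "K \<subseteq> {1..n}" using K by (auto simp: index_sets_def)
  show "0 \<le> a" using a by simp
  show "stratum_lift n K g \<in> borel_measurable (\<Pi>\<^sub>M i\<in>{1..n}. borel)"
    by (rule stratum_lift_measurable[OF K g(1)])
  show "stratum_lift n K (\<lambda>y. g (diag_shift K a y)) \<in> borel_measurable (\<Pi>\<^sub>M i\<in>{1..n}. borel)"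
    by (rule stratum_lift_measurable[OF K measurable_compose[OF diag_shift_measurable g(1)]])
  show "\<bar>stratum_lift n K g x\<bar> \<le> B" for x by (rule stratum_lift_bounded[OF g(2)])
  show "\<bar>stratum_lift n K (\<lambda>y. g (diag_shift K a y)) x\<bar> \<le> B" for x
    by (rule stratum_lift_bounded[OF g(2)[OF diag_shift_in_PiE[OF _ subset_refl]]])
  show "stratum_lift n K g x = 0" if "x \<in> {1..n} \<rightarrow>\<^sub>E UNIV" "x 1 \<le> a" for x
    using zero[of "restrict x K"] that K1 by (simp add: stratum_lift_def)
  show "stratum_lift n K g (\<lambda>i\<in>{1..n}. a + x i) = stratum_lift n K (\<lambda>y. g (diag_shift K a y)) x"
    if x: "x \<in> {1..n} \<rightarrow>\<^sub>E {0..}" for x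
  proof -
    have xU: "x \<in> {1..n} \<rightarrow>\<^sub>E UNIV" using x by (auto simp: PiE_def)
    have r: "restrict (\<lambda>i\<in>{1..n}. a + x i) K = diag_shift K a (restrict x K)"
      using K1 by (auto simp: diag_shift_def fun_eq_iff)
    have "0 \<le> x 1" using x n by (auto simp: PiE_def Pi_def)
    then consider "x 1 = 0" | "0 < x 1" by linarith
    then show ?thesis
    proof cases
      \<comment> \<open>The translated point may enter the stratum although \<open>x\<close> lies
        outside it, but its first coordinate is exactly \<open>a\<close>, where \<open>g\<close>
        vanishes.\<close>
      case 1
      then have "x \<notin> stratum n K" using K1 n by (auto simp: stratum_def Let_def)
      moreover have "g (restrict (\<lambda>i\<in>{1..n}. a + x i) K) = 0"
        using 1 K1 n by (intro zero) auto
      ultimately show ?thesis by (simp add: stratum_lift_def)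
    next
      case 2
      then show ?thesis
        unfolding stratum_lift_def r indicator_def
        by (simp only: stratum_translate[OF n xU less_imp_le[OF a] K1(1) 2])
    qed
  qed
qed

lemma expectation_lift_bounded:
  assumes "\<And>x. \<bar>G x\<bar> \<le> B" "G \<in> borel_measurable (\<Pi>\<^sub>M i\<in>{1..n}. borel)"
  shows "integrable M (\<lambda>\<omega>. G (inverse_vec n t \<omega>) :: real)"
  using measurable_compose[OF inverse_vec_measurable assms(2)] assms(1)
  by (intro integrable_const_bound[of _ B]) auto

lemma damped_expectation_integrable:
  assumes s: "\<And>i. i \<in> {1..n} \<Longrightarrow> 0 < s i"
    and G: "\<And>x. \<bar>G x\<bar> \<le> B" "G \<in> borel_measurable (\<Pi>\<^sub>M i\<in>{1..n}. borel)"
  shows "integrable (\<Pi>\<^sub>M i\<in>{1..n}. lborel) (\<lambda>t. damping n s t * expectation (\<lambda>\<omega>. G (inverse_vec n t \<omega>)))"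
proof -
  interpret product_sigma_finite "\<lambda>_::nat. lborel :: real measure" by standard
  let ?N = "\<Pi>\<^sub>M i\<in>{1..n}. lborel :: real measure"
  interpret N: sigma_finite_measure ?N by (rule sigma_finite) simp
  interpret NM: pair_sigma_finite ?N M ..
  have pm: "(\<lambda>(t, \<omega>). inverse_vec n t \<omega>) \<in> measurable (?N \<Otimes>\<^sub>M M) (\<Pi>\<^sub>M i\<in>{1..n}. borel)"
    unfolding inverse_vec_def by (rule inverse_vec_pair_measurable)
  have "integrable (?N \<Otimes>\<^sub>M M) (\<lambda>(t, \<omega>). damping n s t * G (inverse_vec n t \<omega>))"
    using measurable_compose[OF pm G(2)] G(1)
    by (intro damped_pair_integrable[where B = B, OF s]) (auto simp: split_beta')
  from NM.integrable_fst[OF this] show ?thesis by simp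
qed

text \<open>The transforms of the difference quotients \<open>h m\<close> have a limit that is
  computed twice: from the explicit exponential factor, and by dominated convergence from the
  diagonal derivative of \<open>g\<close>.\<close>

theorem stratum_laplace_directional_derivative:
  assumes n: "1 \<le> n" and s: "\<And>i. i \<in> {1..n} \<Longrightarrow> 0 < s i" and K: "K \<in> index_sets n" and g: "test_function K g"
  shows "fdd_laplace n s (stratum_lift n K (\<lambda>y. \<Sum>j\<in>K. partial j g y)) =
    - \<phi> (\<Sum>i=1..n. s i) * fdd_laplace n s (stratum_lift n K g)"
proof -
  let ?N = "\<Pi>\<^sub>M i\<in>{1..n}. lborel :: real measure"
  let ?L = "\<lambda>g. fdd_laplace n s (stratum_lift n K g)"
  define \<phi>s where "\<phi>s = \<phi> (\<Sum>i=1..n. s i)"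
  note fK = index_set_finite[OF K]
  have K1: "1 \<in> K" using K by (auto simp: index_sets_def)
  obtain C where C: "compact C" "C \<subseteq> chamber K" "\<And>y. y \<in> K \<rightarrow>\<^sub>E UNIV \<Longrightarrow> y \<notin> C \<Longrightarrow> g y = 0"
    using test_functionE[OF g] by metis
  obtain B where B: "B > 0" "\<And>y. y \<in> K \<rightarrow>\<^sub>E UNIV \<Longrightarrow> \<bar>g y\<bar> \<le> B"
    "\<And>j y. j \<in> K \<Longrightarrow> y \<in> K \<rightarrow>\<^sub>E UNIV \<Longrightarrow> \<bar>partial j g y\<bar> \<le> B"
    using test_function_bounded[OF g] fK by metis
  note gm = test_function_measurable(1)[OF g]
  \<comment> \<open>Compactness of the support inside the open chamber keeps the first coordinate
    away from 0. For shifts below this distance the shift identity applies to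
    \<open>g\<close>.\<close>
  have "\<exists>e>0. \<forall>y\<in>C. e \<le> y 1"
  proof (cases "C = {}")
    case False
    have "compact ((\<lambda>y. y 1) ` C)"
      using C(1) by (intro compact_continuous_image continuous_on_subset[OF continuous_on_product_coordinates subset_UNIV])
    then obtain y where y: "y \<in> C" "\<And>z. z \<in> C \<Longrightarrow> y 1 \<le> z 1"
      using compact_attains_inf[of "(\<lambda>y. y 1) ` C"] False by auto
    moreover have "0 < y 1" using y(1) C(2) K1 by (auto simp: chamber_def)
    ultimately show ?thesis by blast
  qed (auto intro: exI[of _ 1])
  then obtain e where e: "e > 0" "\<And>y. y \<in> C \<Longrightarrow> e \<le> y 1" by blast
  \<comment> \<open>The double successor makes the factor at most 1/2, so that
    \<open>a m < e\<close> holds strictly already for m = 0.\<close>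
  define a where "a m = e * inverse (real (Suc (Suc m)))" for m
  have a0: "0 < a m" for m using e by (simp add: a_def)
  have ae: "a m < e" for m
  proof -
    have "inverse (real (Suc (Suc m))) < 1" by (simp add: inverse_eq_divide)
    then show ?thesis using e(1) mult_strict_left_mono[of _ 1 e] by (simp add: a_def)
  qed
  have alim: "a \<longlonglongrightarrow> 0"
    using tendsto_mult_right_zero[OF LIMSEQ_Suc[OF LIMSEQ_inverse_real_of_nat], of e] by (simp add: a_def[abs_def])
  define h where "h m y = (g (diag_shift K (a m) y) - g y) / a m" for m y
  define R where "R = real (card K) * B"
  have hB: "\<bar>h m y\<bar> \<le> R" if "y \<in> K \<rightarrow>\<^sub>E UNIV" for m y
    using test_function_shift_bound[OF g B(3) that a0 fK subset_refl, of m] a0[of m]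
    by (simp add: h_def R_def abs_divide divide_le_eq mult.commute)
  have hlim: "(\<lambda>m. h m y) \<longlonglongrightarrow> (\<Sum>j\<in>K. partial j g y)" if "y \<in> K \<rightarrow>\<^sub>E UNIV" for y
    unfolding h_def by (rule test_function_shift_deriv[OF g that a0 alim fK subset_refl])
  have gshm: "(\<lambda>y. g (diag_shift K c y)) \<in> borel_measurable (\<Pi>\<^sub>M i\<in>K. borel)" for c
    by (rule measurable_compose[OF diag_shift_measurable gm])
  have hm: "h m \<in> borel_measurable (\<Pi>\<^sub>M i\<in>K. borel)" for m
    unfolding h_def[abs_def] by (intro borel_measurable_divide borel_measurable_diff gshm gm measurable_const) auto
  have Dgm: "(\<lambda>y. \<Sum>j\<in>K. partial j g y) \<in> borel_measurable (\<Pi>\<^sub>M i\<in>K. borel)"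
    by (intro borel_measurable_sum test_function_measurable(2)[OF g])
  have gshB: "\<bar>g (diag_shift K c y)\<bar> \<le> B" if "y \<in> K \<rightarrow>\<^sub>E UNIV" for c y
    by (rule B(2)[OF diag_shift_in_PiE[OF that subset_refl]])
  have Lh: "?L (h m) = ?L g * ((exp (- a m * \<phi>s) - 1) / a m)" for m
  proof -
    let ?g' = "\<lambda>y. g (diag_shift K (a m) y)"
    note i1 = expectation_lift_bounded[OF stratum_lift_bounded[OF gshB] stratum_lift_measurable[OF K gshm]]
    note i2 = expectation_lift_bounded[OF stratum_lift_bounded[OF B(2)] stratum_lift_measurable[OF K gm]]
    note d1 = damped_expectation_integrable[OF s stratum_lift_bounded[OF gshB] stratum_lift_measurable[OF K gshm]]
    note d2 = damped_expectation_integrable[OF s stratum_lift_bounded[OF B(2)] stratum_lift_measurable[OF K gm]]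
    have "stratum_lift n K (h m) x = (stratum_lift n K ?g' x - stratum_lift n K g x) / a m" for x
      by (simp add: stratum_lift_def h_def diff_divide_distrib right_diff_distrib)
    then have "?L (h m) = (LINT t|?N. (damping n s t * expectation (\<lambda>\<omega>. stratum_lift n K ?g' (inverse_vec n t \<omega>))
        - damping n s t * expectation (\<lambda>\<omega>. stratum_lift n K g (inverse_vec n t \<omega>))) / a m)"
      unfolding fdd_laplace_def using i1 i2
      by (simp add: Bochner_Integration.integral_diff diff_divide_distrib right_diff_distrib)
    also have "\<dots> = (?L ?g' - ?L g) / a m"
      unfolding fdd_laplace_def using d1 d2 by (simp add: Bochner_Integration.integral_diff)
    \<comment> \<open>The shift identity is solved for the translated function; the reciprocal
      factor is the source of the minus sign.\<close>
    also have "?L ?g' = exp (- a m * \<phi>s) * ?L g"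
    proof -
      have "?L g = exp (a m * \<phi>s) * ?L ?g'"
        unfolding \<phi>s_def
      proof (rule stratum_laplace_shift[OF n s a0 K gm B(2)])
        fix y assume y: "y \<in> K \<rightarrow>\<^sub>E (UNIV :: real set)" "y 1 \<le> a m"
        then have "y \<notin> C" using e(2)[of y] ae[of m] by auto
        then show "g y = 0" by (rule C(3)[OF y(1)])
      qed
      then show ?thesis by (simp add: exp_minus)
    qed
    finally show ?thesis by (simp add: algebra_simps diff_divide_distrib)
  qed
  have lim1: "(\<lambda>m. ?L (h m)) \<longlonglongrightarrow> ?L g * (- \<phi>s)"
  proof -
    have "((\<lambda>x. exp (- x * \<phi>s)) has_real_derivative - \<phi>s) (at 0)"
      by (auto intro!: derivative_eq_intros)
    then have "((\<lambda>c. (exp (- c * \<phi>s) - 1) / c) \<longlongrightarrow> - \<phi>s) (at 0)"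
      by (simp add: DERIV_def)
    moreover have "filterlim a (at 0) sequentially"
      using alim a0 by (auto simp: filterlim_at eventually_sequentially less_imp_neq[symmetric])
    ultimately have "(\<lambda>m. (exp (- a m * \<phi>s) - 1) / a m) \<longlonglongrightarrow> - \<phi>s"
      by (rule filterlim_compose)
    then show ?thesis unfolding Lh by (intro tendsto_mult_left)
  qed
  \<comment> \<open>Dominated convergence is used twice: over the times with \<open>R\<close> times
    the damping, and inside over the outcomes with the constant \<open>R\<close>.\<close>
  have lim2: "(\<lambda>m. ?L (h m)) \<longlonglongrightarrow> ?L (\<lambda>y. \<Sum>j\<in>K. partial j g y)"
    unfolding fdd_laplace_def
  proof (rule integral_dominated_convergence[where w = "\<lambda>t. R * damping n s t"])
    have DB: "\<bar>\<Sum>j\<in>K. partial j g y\<bar> \<le> R" if "y \<in> K \<rightarrow>\<^sub>E UNIV" for y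
      unfolding R_def using B(3)[OF _ that] by (intro order_trans[OF sum_abs] sum_bounded_above)
    show "(\<lambda>t. damping n s t * expectation (\<lambda>\<omega>. stratum_lift n K (\<lambda>y. \<Sum>j\<in>K. partial j g y) (inverse_vec n t \<omega>)))
        \<in> borel_measurable ?N"
      using damped_expectation_integrable[OF s stratum_lift_bounded[OF DB] stratum_lift_measurable[OF K Dgm]]
      by (rule borel_measurable_integrable)
    show "(\<lambda>t. damping n s t * expectation (\<lambda>\<omega>. stratum_lift n K (h m) (inverse_vec n t \<omega>))) \<in> borel_measurable ?N" for m
      using damped_expectation_integrable[OF s stratum_lift_bounded[OF hB] stratum_lift_measurable[OF K hm]]
      by (rule borel_measurable_integrable)
    show "integrable ?N (\<lambda>t. R * damping n s t)" by (rule integrable_mult_right[OF damping_integrable[OF s]])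
    show "AE t in ?N. (\<lambda>m. damping n s t * expectation (\<lambda>\<omega>. stratum_lift n K (h m) (inverse_vec n t \<omega>)))
        \<longlonglongrightarrow> damping n s t * expectation (\<lambda>\<omega>. stratum_lift n K (\<lambda>y. \<Sum>j\<in>K. partial j g y) (inverse_vec n t \<omega>))"
    proof (intro AE_I2 tendsto_mult_left integral_dominated_convergence[where w = "\<lambda>_. R"])
      fix t m
      show "(\<lambda>\<omega>. stratum_lift n K (\<lambda>y. \<Sum>j\<in>K. partial j g y) (inverse_vec n t \<omega>)) \<in> borel_measurable M"
        by (rule measurable_compose[OF inverse_vec_measurable stratum_lift_measurable[OF K Dgm]])
      show "(\<lambda>\<omega>. stratum_lift n K (h m) (inverse_vec n t \<omega>)) \<in> borel_measurable M"
        by (rule measurable_compose[OF inverse_vec_measurable stratum_lift_measurable[OF K hm]])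
      fix \<omega>
      show "(\<lambda>m. stratum_lift n K (h m) (inverse_vec n t \<omega>)) \<longlonglongrightarrow>
          stratum_lift n K (\<lambda>y. \<Sum>j\<in>K. partial j g y) (inverse_vec n t \<omega>)"
        unfolding stratum_lift_def by (intro tendsto_mult_left hlim) auto
      show "norm (stratum_lift n K (h m) (inverse_vec n t \<omega>)) \<le> R"
        using stratum_lift_bounded[OF hB] by simp
    qed simp
    show "AE t in ?N. norm (damping n s t * expectation (\<lambda>\<omega>. stratum_lift n K (h m) (inverse_vec n t \<omega>)))
        \<le> R * damping n s t" for m
    proof (rule AE_I2)
      fix t
      have "\<bar>expectation (\<lambda>\<omega>. stratum_lift n K (h m) (inverse_vec n t \<omega>))\<bar>
          \<le> expectation (\<lambda>\<omega>. \<bar>stratum_lift n K (h m) (inverse_vec n t \<omega>)\<bar>)"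
        by (rule integral_abs_bound)
      also have "\<dots> \<le> R"
        using stratum_lift_bounded[OF hB] expectation_lift_bounded[OF stratum_lift_bounded[OF hB] stratum_lift_measurable[OF K hm]]
        by (intro integral_le_const) auto
      finally show "norm (damping n s t * expectation (\<lambda>\<omega>. stratum_lift n K (h m) (inverse_vec n t \<omega>))) \<le> R * damping n s t"
        using damping_nonneg[of n s t] by (simp add: abs_mult mult.commute[of _ "damping n s t"] mult_left_mono)
    qed
  qed
  show ?thesis using LIMSEQ_unique[OF lim2 lim1] by (simp add: \<phi>s_def)
qed

end

theorem theorem1:
  fixes M :: "'a measure"
    and D :: "real \<Rightarrow> 'a \<Rightarrow> real"
    and K2 :: "real measure"
    and n :: nat
    and f :: "nat set \<Rightarrow> (nat \<Rightarrow> real) \<Rightarrow> (nat \<Rightarrow> real) \<Rightarrow> real"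
  assumes "subordinator M D"
    and "\<And>\<omega>. \<omega> \<in> space M \<Longrightarrow> strict_mono_on {0..} (\<lambda>u. D u \<omega>)"
    and "levy_measure K2"
    and "\<And>u s. 0 \<le> u \<Longrightarrow> 0 \<le> s \<Longrightarrow>
           (LINT \<omega>|M. exp (- s * D u \<omega>)) = exp (u * laplace_exponent K2 s)"
    and "1 \<le> n"
    and "\<And>K t. K \<in> index_sets n \<Longrightarrow> t \<in> strict_times n \<Longrightarrow> admissible_density K (f K t)"
    and "\<And>K t. K \<in> index_sets n \<Longrightarrow> t \<in> strict_times n \<Longrightarrow>
           density (inverse_fdd M D n t) (indicator (stratum n K)) = stratum_measure n K (f K t)"
  shows "Phi_eq_minus_Dx n (laplace_exponent K2) (inverse_fdd M D n) f"
proof -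
  note sub = assms(1)[unfolded subordinator_def]
  interpret prob_space M using sub by blast
  interpret inverse_subordinator M D "laplace_exponent K2"
  proof
    show "D u \<in> borel_measurable M" if "0 \<le> u" for u using sub that by blast
    show "strict_mono_on {0..} (\<lambda>u. D u \<omega>)" if "\<omega> \<in> space M" for \<omega> using assms(2) that .
    show "((\<lambda>v. D v \<omega>) \<longlongrightarrow> D u \<omega>) (at_right u)" if "\<omega> \<in> space M" "0 \<le> u" for \<omega> u
    proof -
      have "continuous (at_right u) (\<lambda>u. D u \<omega>)" using sub that by blast
      then show ?thesis by (simp add: continuous_within)
    qed
    show "D 0 \<omega> = 0" if "\<omega> \<in> space M" for \<omega> using sub that by blast
    show "indep_vars (\<lambda>_. borel) (\<lambda>i \<omega>. D (u (Suc i)) \<omega> - D (u i) \<omega>) {..<m}"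
      if "0 \<le> u 0" "\<And>i. i < m \<Longrightarrow> u i \<le> u (Suc i)" for m :: nat and u
      using sub that by blast
    show "distr M borel (\<lambda>\<omega>. D (u + v) \<omega> - D u \<omega>) = distr M borel (D v)" if "0 \<le> u" "0 \<le> v" for u v
      using sub that by blast
    show "expectation (\<lambda>\<omega>. exp (- s * D u \<omega>)) = exp (u * laplace_exponent K2 s)" if "0 \<le> u" "0 \<le> s" for u s
      using assms(4) that .
    show "laplace_exponent K2 s < 0" if "0 < s" for s using laplace_exponent_neg[OF assms(3) that] .
  qed
  let ?Pi = "\<Pi>\<^sub>M i\<in>{1..n}. (borel :: real measure)"
  have fdd: "inverse_fdd M D n t = distr M ?Pi (inverse_vec n t)" for t
    by (simp add: inverse_fdd_def inverse_vec_def[abs_def])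
  have strat_int: "(LINT x|inverse_fdd M D n t. stratum_lift n K g x) =
      expectation (\<lambda>\<omega>. stratum_lift n K g (inverse_vec n t \<omega>))"
    if "K \<in> index_sets n" "g \<in> borel_measurable (\<Pi>\<^sub>M i\<in>K. borel)" for K g t
    unfolding fdd by (rule integral_distr[OF inverse_vec_measurable stratum_lift_measurable[OF that]])
  show ?thesis unfolding Phi_eq_minus_Dx_def Let_def
  proof (intro ballI allI impI)
    fix K g assume K: "K \<in> index_sets n" and g: "test_function K g"
    let ?\<psi> = "\<lambda>x. g (restrict x K)" and ?Dg = "\<lambda>y. \<Sum>j\<in>K. partial j g y"
    define F where "F t = indicator (strict_times n) t * (LINT x:stratum n K|inverse_fdd M D n t. ?\<psi> x)" for t
    define G where "G t = indicator (strict_times n) t * (- Dx_integral n K (f K t) ?\<psi>)" for t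
    note fK = index_set_finite[OF K]
    have gm: "g \<in> borel_measurable (\<Pi>\<^sub>M i\<in>K. borel)" by (rule test_function_measurable(1)[OF g])
    have Dgm: "?Dg \<in> borel_measurable (\<Pi>\<^sub>M i\<in>K. borel)"
      by (intro borel_measurable_sum test_function_measurable(2)[OF g])
    have Feq: "F t = indicator (strict_times n) t * expectation (\<lambda>\<omega>. stratum_lift n K g (inverse_vec n t \<omega>))" for t
      using strat_int[OF K gm, of t] by (simp add: F_def set_lebesgue_integral_def stratum_lift_def)
    \<comment> \<open>At each admissible \<open>t\<close> the density is traded for an expectation,
      from which integrability in the times can be derived.\<close>
    have Geq: "G t = indicator (strict_times n) t * expectation (\<lambda>\<omega>. stratum_lift n K ?Dg (inverse_vec n t \<omega>))" for t
    proof (cases "t \<in> strict_times n")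
      case True
      have "- Dx_integral n K (f K t) ?\<psi> = (LINT x|inverse_fdd M D n t. stratum_lift n K ?Dg x)"
      proof (rule Dx_integral_eq[OF K assms(6)[OF K True] g _ _ assms(7)[OF K True]])
        show "prob_space (inverse_fdd M D n t)" unfolding fdd by (rule prob_space_distr[OF inverse_vec_measurable])
      qed (simp add: fdd)
      then show ?thesis using strat_int[OF K Dgm, of t] by (simp add: G_def)
    qed (simp add: G_def)
    obtain B where B: "\<And>y. y \<in> K \<rightarrow>\<^sub>E UNIV \<Longrightarrow> \<bar>g y\<bar> \<le> B"
      "\<And>j y. j \<in> K \<Longrightarrow> y \<in> K \<rightarrow>\<^sub>E UNIV \<Longrightarrow> \<bar>partial j g y\<bar> \<le> B"
      using test_function_bounded[OF g] fK by metis
    have DB: "\<bar>?Dg y\<bar> \<le> real (card K) * B" if "y \<in> K \<rightarrow>\<^sub>E UNIV" for y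
      using B(2)[OF _ that] by (intro order_trans[OF sum_abs] sum_bounded_above)
    show "Phi_rel n (laplace_exponent K2) F G" unfolding Phi_rel_def
    proof (intro conjI ballI allI impI)
      fix t assume "t \<in> {1..n} \<rightarrow>\<^sub>E (UNIV :: real set)" "t \<notin> ordered_times n"
      moreover have "strict_times n \<subseteq> ordered_times n"
        unfolding strict_times_def ordered_times_def using less_imp_le by blast
      ultimately have "t \<notin> strict_times n" by blast
      then show "F t = 0" "G t = 0" by (simp_all add: F_def G_def)
    next
      fix s :: "nat \<Rightarrow> real" assume "\<forall>i\<in>{1..n}. 0 < s i"
      then have s: "\<And>i. i \<in> {1..n} \<Longrightarrow> 0 < s i" by blast
      \<comment> \<open>The cut-off to strictly ordered times is absorbed into
        \<open>damping\<close>, so both Laplace transforms become instances of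
        \<open>fdd_laplace\<close>.\<close>
      have iF: "laplace_integrand n F s = (\<lambda>t. damping n s t * expectation (\<lambda>\<omega>. stratum_lift n K g (inverse_vec n t \<omega>)))"
        and iG: "laplace_integrand n G s = (\<lambda>t. damping n s t * expectation (\<lambda>\<omega>. stratum_lift n K ?Dg (inverse_vec n t \<omega>)))"
        by (simp_all add: fun_eq_iff laplace_integrand_def Feq Geq damping_def)
      show "integrable (\<Pi>\<^sub>M i\<in>{1..n}. lborel) (laplace_integrand n F s)" unfolding iF
        by (rule damped_expectation_integrable[OF s stratum_lift_bounded[OF B(1)] stratum_lift_measurable[OF K gm]])
      show "integrable (\<Pi>\<^sub>M i\<in>{1..n}. lborel) (laplace_integrand n G s)" unfolding iG
        by (rule damped_expectation_integrable[OF s stratum_lift_bounded[OF DB] stratum_lift_measurable[OF K Dgm]])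
      show "laplace_transform n G s = - laplace_exponent K2 (\<Sum>i=1..n. s i) * laplace_transform n F s"
        using stratum_laplace_directional_derivative[OF assms(5) s K g]
        by (simp add: laplace_transform_def iF iG fdd_laplace_def)
    qed
  qed
qed

end
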